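(* Let $Q=(-10,10)^n\times(0,10]$, $J_1=(-1,1)^n\times(0,\tfrac12]$ and $J_3=(-\tfrac12,\tfrac12)^n\times(\tfrac14,\tfrac12]$. Let $q>n+2$, $p_1<p\le q$, $f\in L^p_+(Q)$ and $\mu\in L^q_+(Q)$. Assume that $\|f\|_{L^p(Q)}\le\varepsilon_1$, where $\varepsilon_1>0$ is the constant described in the context. Suppose that $v\in C(Q)$ is an $L^p$-viscosity subsolution of $$v_t+\mathcal P^-(D^2v)-\mu|Dv|-f=0\quad\text{in }Q$$ satisfying $$|\{(x,t)\in J_1: v(x,t)\ge s\}|\le A_0s^{-\beta_0}\quad\text{for all }s\ge1,$$ where $\beta_0>0$ and $A_0>1$. Then there exist $\nu=\nu(n,\Lambda,\lambda,p,q,\beta_0,A_0)>1$, $n_0=n_0(n,\Lambda,\lambda,p,q,\beta_0,A_0)\in\mathbb N$ and $\ell_j=\ell_j(n,\Lambda,\lambda,p,q,\beta_0,A_0)\in(0,1)$ for $j\in\mathbb N$ such that $\sum_{j=1}^\infty\ell_j<\infty$, and if $v(x_0,t_0)\ge\nu^{j-1}$ for some $j\ge n_0$ and $(x_0,t_0)\in\overline{J_3}$, then $$\sup_{\hat Q_j}v\ge\nu^j,\qquad\text{where }\hat Q_j=(x_0,t_0)+(-\ell_j,\ell_j)^n\times\left(-\tfrac{\ell_j^2}{10},0\right].$$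
   Context: Fix $n\in\mathbb N$ and constants $0<\lambda\le\Lambda<\infty$. $\mathbb S^n$ is the set of real symmetric $n\times n$ matrices with the usual order. The Pucci operators are $\mathcal P^+(X)=\max\{-\mathrm{Tr}(AX): A\in\mathbb S^n,\ \lambda I\le A\le\Lambda I\}$ and $\mathcal P^-(X)=\min\{-\mathrm{Tr}(AX): A\in\mathbb S^n,\ \lambda I\le A\le\Lambda I\}$ for $X\in\mathbb S^n$. $Du$, $D^2u$ are the first and second derivatives in the space variable $x$, and $u_t$ is the time derivative. $L^p_+(Q)$ is the set of nonnegative functions in $L^p(Q)$. For $Q=\Omega\times(0,T]$ the parabolic boundary is $\partial_pQ=(\Omega\times\{0\})\cup(\partial\Omega\times[0,T))$. The parabolic distance is $d((x,t),(y,s))=\sqrt{|x-y|^2+|t-s|}$, and $Q'\Subset Q$ means that the parabolic distance from $Q'$ to $\partial_pQ$ is positive. $W^{2,1}_p(Q)$ is the set of $f\in L^p(Q)$ with weak derivatives $f_t,f_{x_k},f_{x_kx_\ell}\in L^p(Q)$, with norm the sum of the $L^p$ norms of $f$ and of these derivatives; $W^{2,1}_{p,\mathrm{loc}}(Q)$ consists of functions in $W^{2,1}_p(Q')$ for all $Q'\Subset Q$. Set $Q_r(x,t)=(x,t)+(-r,r)^n\times(-r^2,0]$. $L^p$-viscosity sub/supersolutions: $u\in C(Q)$ is an $L^p$-viscosity subsolution (resp. supersolution) of $u_t+F(x,t,Du,D^2u)=0$ in $Q$ if for every $\phi\in W^{2,1}_{p,\mathrm{loc}}(Q)$ and every $(x,t)\in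 Q$ such that $u-\phi$ attains a maximum (resp. minimum) at $(x,t)$ over some cylinder $Q_r(x,t)\subset Q$, one has $\lim_{\varepsilon\to0}\operatorname{ess\,inf}_{(y,s)\in Q_\varepsilon(x,t)}\{\phi_t+F(y,s,D\phi,D^2\phi)\}\le0$ (resp. $\lim_{\varepsilon\to0}\operatorname{ess\,sup}_{(y,s)\in Q_\varepsilon(x,t)}\{\phi_t+F(y,s,D\phi,D^2\phi)\}\ge0$). $p_1=p_1(n,\Lambda/\lambda)\in[\frac{n+2}2,n+1)$ is the constant giving the range $p>p_1$ of exponents for which the Aleksandrov-Bakelman-Pucci maximum principle holds, i.e. for every $p>p_1$ there is $C=C(n,\Lambda,\lambda,p)$ such that, with $Q^*=\{|x|<1\}\times(0,1]$, for every $f\in L^p(Q^* )$ there is $u\in C(\overline{Q^*})\cap W^{2,1}_{p,\mathrm{loc}}(Q^* )$ with $u_t+\mathcal P^+(D^2u)=f$ a.e. in $Q^*$, $u=0$ on $\partial_pQ^*$, $-C\|f^-\|_{L^p(Q^* )}\le u\le C\|f^+\|_{L^p(Q^* )}$, and $\|u\|_{W^{2,1}_p(Q')}\le C'\|f\|_{L^p(Q^* )}$ for every $Q'\Subset Q^*$, where $C'$ depends only on $n,\Lambda,\lambda,p$ and the distance of $Q'$ to $\partial_pQ^*$. The constant $\varepsilon_1$ is the one fixed in the proof of the weak Harnack inequality: with $J_2=(-1,1)^n\times(9,10]$, there exist constants $A_*,\beta_*,\varepsilon_1>0$, depending only on $n,\Lambda,\lambda,p,q,\|\mu\|_{L^q(Q)}$,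 such that for all $\hat\mu\in L^q_+(Q)$ with $\|\hat\mu\|_{L^q(Q)}\le\|\mu\|_{L^q(Q)}$ and all $\hat f\in L^p_+(Q)$ with $\|\hat f\|_{L^p(Q)}\le\varepsilon_1$, every nonnegative $L^p$-viscosity supersolution $w\in C(Q)$ of $w_t+\mathcal P^+(D^2w)+\hat\mu|Dw|+\hat f=0$ in $Q$ with $\inf_{J_2}w\le1$ satisfies $|\{(x,t)\in J_1: w(x,t)\ge s\}|\le A_*s^{-\beta_*}$ for all $s>0$. The source remarks that the constants $A_0,\beta_0$ of the lemma will be these constants $A_*,\beta_*$.
   Formalization: ν, n_0 and ℓ_j may depend also on the weak Harnack constants A_*, β_* attached to ‖μ‖; the printed dependence fails for arbitrary A_0, β_0 (a fast travelling Gaussian spike with f=0 and μ a large constant), and is recovered when A_0=A_*, β_0=β_*. *)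

theory Defs
  imports "HOL-Analysis.Analysis" "HOL-Probability.Essential_Supremum"
begin

text \<open>Points of space-time are pairs \<open>(x, t)\<close> of type \<open>(real^'n) \<times> real\<close>; the dimension is
  \<open>CARD('n)\<close>.\<close>

type_synonym 'n spacetime = "(real^'n) \<times> real"

section \<open>Pucci operators\<close>

definition loewner_le :: "real^'n^'n \<Rightarrow> real^'n^'n \<Rightarrow> bool" where
  "loewner_le A B \<longleftrightarrow> (\<forall>\<xi>. \<xi> \<bullet> (A *v \<xi>) \<le> \<xi> \<bullet> (B *v \<xi>))"

definition elliptic_matrices :: "real \<Rightarrow> real \<Rightarrow> (real^'n^'n) set" where
  "elliptic_matrices lam Lam =
     {A. transpose A = A \<and> loewner_le (mat lam) A \<and> loewner_le A (mat Lam)}"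

text \<open>For \<open>0 < lam \<le> Lam\<close> the set of elliptic matrices is nonempty and compact, so the supremum and
  the infimum below are a maximum and a minimum.\<close>

definition pucci_plus :: "real \<Rightarrow> real \<Rightarrow> real^'n^'n \<Rightarrow> real" where
  "pucci_plus lam Lam X = (SUP A \<in> elliptic_matrices lam Lam. - trace (A ** X))"

definition pucci_minus :: "real \<Rightarrow> real \<Rightarrow> real^'n^'n \<Rightarrow> real" where
  "pucci_minus lam Lam X = (INF A \<in> elliptic_matrices lam Lam. - trace (A ** X))"

section \<open>Lebesgue spaces\<close>

definition Lp :: "real \<Rightarrow> 'a::euclidean_space set \<Rightarrow> ('a \<Rightarrow> real) \<Rightarrow> bool" where
  "Lp p Q f \<longleftrightarrow> f \<in> borel_measurable (lebesgue_on Q) \<and>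
     integrable (lebesgue_on Q) (\<lambda>z. \<bar>f z\<bar> powr p)"

definition Lp_norm :: "real \<Rightarrow> 'a::euclidean_space set \<Rightarrow> ('a \<Rightarrow> real) \<Rightarrow> real" where
  "Lp_norm p Q f = (integral\<^sup>L (lebesgue_on Q) (\<lambda>z. \<bar>f z\<bar> powr p)) powr (1 / p)"

definition Lp_plus :: "real \<Rightarrow> 'a::euclidean_space set \<Rightarrow> ('a \<Rightarrow> real) \<Rightarrow> bool" where
  "Lp_plus p Q f \<longleftrightarrow> Lp p Q f \<and> (AE z in lebesgue_on Q. 0 \<le> f z)"

section \<open>Parabolic geometry\<close>

definition cyl :: "(real^'n) set \<Rightarrow> real \<Rightarrow> 'n spacetime set" where
  "cyl \<Omega> T = \<Omega> \<times> {0<..T}"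

definition par_boundary :: "(real^'n) set \<Rightarrow> real \<Rightarrow> 'n spacetime set" where
  "par_boundary \<Omega> T = (\<Omega> \<times> {0}) \<union> (frontier \<Omega> \<times> {0..<T})"

definition par_dist :: "'n::finite spacetime \<Rightarrow> 'n spacetime \<Rightarrow> real" where
  "par_dist z w = sqrt ((norm (fst z - fst w))\<^sup>2 + \<bar>snd z - snd w\<bar>)"

definition par_setdist :: "'n::finite spacetime set \<Rightarrow> 'n spacetime set \<Rightarrow> real" where
  "par_setdist A B = (INF (z, w) \<in> A \<times> B. par_dist z w)"

text \<open>The sets \<open>Q'\<close> compactly contained in \<open>Q = cyl \<Omega> T\<close> range over nonempty cylinders.  This loses
  nothing: the set of points of \<open>Q\<close> at parabolic distance more than \<open>d\<close> from the parabolic boundary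
  is the cylinder \<open>{x \<in> \<Omega>. infdist x (frontier \<Omega>) > d} \<times> {d\<^sup>2<..T}\<close>.\<close>

definition par_inside :: "'n::finite spacetime set \<Rightarrow> (real^'n) set \<Rightarrow> real \<Rightarrow> bool" where
  "par_inside Q' \<Omega> T \<longleftrightarrow>
     (\<exists>\<Omega>' a b. open \<Omega>' \<and> \<Omega>' \<noteq> {} \<and> a < b \<and> Q' = \<Omega>' \<times> {a<..b}) \<and>
     Q' \<subseteq> cyl \<Omega> T \<and> par_setdist Q' (par_boundary \<Omega> T) > 0"

definition cube :: "real \<Rightarrow> (real^'n) set" where
  "cube r = {x. \<forall>i. \<bar>x $ i\<bar> < r}"

definition Qr :: "real \<Rightarrow> 'n::finite spacetime \<Rightarrow> 'n spacetime set" where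
  "Qr r z = (\<lambda>w. z + w) ` (cube r \<times> {- (r\<^sup>2)<..0})"

section \<open>Parabolic Sobolev spaces\<close>

primrec Ck :: "nat \<Rightarrow> ('a::euclidean_space \<Rightarrow> real) \<Rightarrow> bool" where
  "Ck 0 f \<longleftrightarrow> continuous_on UNIV f"
| "Ck (Suc k) f \<longleftrightarrow>
     (\<exists>f'. (\<forall>x. (f has_derivative f' x) (at x)) \<and> (\<forall>b\<in>Basis. Ck k (\<lambda>x. f' x b)))"

definition test_function :: "'a::euclidean_space set \<Rightarrow> ('a \<Rightarrow> real) \<Rightarrow> bool" where
  "test_function U \<psi> \<longleftrightarrow> (\<forall>k. Ck k \<psi>) \<and>
     compact (closure {z. \<psi> z \<noteq> 0}) \<and> closure {z. \<psi> z \<noteq> 0} \<subseteq> U"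

text \<open>\<open>g\<close> is the weak derivative of \<open>f\<close> in direction \<open>b\<close> on the interior of \<open>Q\<close>.  Only used for \<open>f\<close>
  and \<open>g\<close> in \<open>L\<^sup>p(Q)\<close> with \<open>p > 1\<close>, so that both integrands are integrable.\<close>

definition weak_partial ::
  "'a::euclidean_space set \<Rightarrow> 'a \<Rightarrow> ('a \<Rightarrow> real) \<Rightarrow> ('a \<Rightarrow> real) \<Rightarrow> bool" where
  "weak_partial Q b f g \<longleftrightarrow>
     (\<forall>\<psi>. test_function (interior Q) \<psi> \<longrightarrow>
        integral\<^sup>L (lebesgue_on Q) (\<lambda>z. f z * frechet_derivative \<psi> (at z) b) =
        - integral\<^sup>L (lebesgue_on Q) (\<lambda>z. g z * \<psi> z))"

definition time_dir :: "'n::finite spacetime" where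
  "time_dir = (0, 1)"

definition space_dir :: "'n::finite \<Rightarrow> 'n spacetime" where
  "space_dir k = (axis k 1, 0)"

text \<open>\<open>f\<close> lies in \<open>W\<^sup>2\<^sup>,\<^sup>1\<^sub>p(Q)\<close>, with weak time derivative \<open>ft\<close>, spatial gradient \<open>Df\<close> and spatial
  Hessian \<open>D2f\<close>.\<close>

definition W21 ::
  "real \<Rightarrow> 'n::finite spacetime set \<Rightarrow> ('n spacetime \<Rightarrow> real) \<Rightarrow> ('n spacetime \<Rightarrow> real) \<Rightarrow>
   ('n spacetime \<Rightarrow> real^'n) \<Rightarrow> ('n spacetime \<Rightarrow> real^'n^'n) \<Rightarrow> bool" where
  "W21 p Q f ft Df D2f \<longleftrightarrow>
     Lp p Q f \<and> Lp p Q ft \<and> (\<forall>k. Lp p Q (\<lambda>z. Df z $ k)) \<and> (\<forall>k l. Lp p Q (\<lambda>z. D2f z $ k $ l)) \<and>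
     weak_partial Q time_dir f ft \<and>
     (\<forall>k. weak_partial Q (space_dir k) f (\<lambda>z. Df z $ k)) \<and>
     (\<forall>k l. weak_partial Q (space_dir l) (\<lambda>z. Df z $ k) (\<lambda>z. D2f z $ k $ l))"

definition W21_norm ::
  "real \<Rightarrow> 'n::finite spacetime set \<Rightarrow> ('n spacetime \<Rightarrow> real) \<Rightarrow> ('n spacetime \<Rightarrow> real) \<Rightarrow>
   ('n spacetime \<Rightarrow> real^'n) \<Rightarrow> ('n spacetime \<Rightarrow> real^'n^'n) \<Rightarrow> real" where
  "W21_norm p Q f ft Df D2f =
     Lp_norm p Q f + Lp_norm p Q ft + (\<Sum>k\<in>UNIV. Lp_norm p Q (\<lambda>z. Df z $ k)) +
     (\<Sum>k\<in>UNIV. \<Sum>l\<in>UNIV. Lp_norm p Q (\<lambda>z. D2f z $ k $ l))"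

text \<open>The weak derivatives on the various \<open>Q'\<close> agree almost everywhere on overlaps, hence they glue
  to functions on all of \<open>cyl \<Omega> T\<close>.\<close>

definition W21_loc ::
  "real \<Rightarrow> (real^'n::finite) set \<Rightarrow> real \<Rightarrow> ('n spacetime \<Rightarrow> real) \<Rightarrow> ('n spacetime \<Rightarrow> real) \<Rightarrow>
   ('n spacetime \<Rightarrow> real^'n) \<Rightarrow> ('n spacetime \<Rightarrow> real^'n^'n) \<Rightarrow> bool" where
  "W21_loc p \<Omega> T f ft Df D2f \<longleftrightarrow> (\<forall>Q'. par_inside Q' \<Omega> T \<longrightarrow> W21 p Q' f ft Df D2f)"

section \<open>\<open>L\<^sup>p\<close>-viscosity solutions\<close>

definition ess_sup_on :: "'a::euclidean_space set \<Rightarrow> ('a \<Rightarrow> real) \<Rightarrow> ereal" where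
  "ess_sup_on S g = esssup (lebesgue_on S) (\<lambda>z. ereal (g z))"

definition ess_inf_on :: "'a::euclidean_space set \<Rightarrow> ('a \<Rightarrow> real) \<Rightarrow> ereal" where
  "ess_inf_on S g = - esssup (lebesgue_on S) (\<lambda>z. - ereal (g z))"

text \<open>Since \<open>u - \<phi>\<close> is evaluated pointwise, the test function \<open>\<phi>\<close> must be the continuous
  representative of its class, which exists for \<open>p > (CARD('n) + 2) / 2\<close>.  The limits exist in the
  extended reals because the essential infimum and supremum are monotone in \<open>\<epsilon>\<close>.\<close>

definition visc_subsolution ::
  "real \<Rightarrow> (real^'n::finite) set \<Rightarrow> real \<Rightarrow>
   ('n spacetime \<Rightarrow> real^'n \<Rightarrow> real^'n^'n \<Rightarrow> real) \<Rightarrow> ('n spacetime \<Rightarrow> real) \<Rightarrow> bool" where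
  "visc_subsolution p \<Omega> T F u \<longleftrightarrow>
     continuous_on (cyl \<Omega> T) u \<and>
     (\<forall>\<phi> \<phi>t D\<phi> D2\<phi>. \<forall>z\<in>cyl \<Omega> T.
        continuous_on (cyl \<Omega> T) \<phi> \<and> W21_loc p \<Omega> T \<phi> \<phi>t D\<phi> D2\<phi> \<and>
        (\<exists>r>0. Qr r z \<subseteq> cyl \<Omega> T \<and> (\<forall>w\<in>Qr r z. u w - \<phi> w \<le> u z - \<phi> z)) \<longrightarrow>
        Lim (at_right 0)
          (\<lambda>\<epsilon>. ess_inf_on (Qr \<epsilon> z) (\<lambda>w. \<phi>t w + F w (D\<phi> w) (D2\<phi> w))) \<le> 0)"

definition visc_supersolution ::
  "real \<Rightarrow> (real^'n::finite) set \<Rightarrow> real \<Rightarrow>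
   ('n spacetime \<Rightarrow> real^'n \<Rightarrow> real^'n^'n \<Rightarrow> real) \<Rightarrow> ('n spacetime \<Rightarrow> real) \<Rightarrow> bool" where
  "visc_supersolution p \<Omega> T F u \<longleftrightarrow>
     continuous_on (cyl \<Omega> T) u \<and>
     (\<forall>\<phi> \<phi>t D\<phi> D2\<phi>. \<forall>z\<in>cyl \<Omega> T.
        continuous_on (cyl \<Omega> T) \<phi> \<and> W21_loc p \<Omega> T \<phi> \<phi>t D\<phi> D2\<phi> \<and>
        (\<exists>r>0. Qr r z \<subseteq> cyl \<Omega> T \<and> (\<forall>w\<in>Qr r z. u w - \<phi> w \<ge> u z - \<phi> z)) \<longrightarrow>
        Lim (at_right 0)
          (\<lambda>\<epsilon>. ess_sup_on (Qr \<epsilon> z) (\<lambda>w. \<phi>t w + F w (D\<phi> w) (D2\<phi> w))) \<ge> 0)"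

section \<open>The range of the Aleksandrov-Bakelman-Pucci maximum principle\<close>

text \<open>\<open>p1\<close> is a lower bound, in the interval \<open>[(n+2)/2, n+1)\<close>, for the exponents \<open>p\<close> in the maximum
  principle.  The argument \<open>TYPE('n)\<close> carries the dimension.\<close>

definition ABP_exponent :: "'n::finite itself \<Rightarrow> real \<Rightarrow> real \<Rightarrow> real \<Rightarrow> bool" where
  "ABP_exponent TY lam Lam p1 \<longleftrightarrow>
     (real CARD('n) + 2) / 2 \<le> p1 \<and> p1 < real CARD('n) + 1 \<and>
     (\<forall>p>p1. \<exists>C. \<exists>C' :: real \<Rightarrow> real.
        let B = ball (0 :: real^'n) 1; Qs = cyl B 1 in
        \<forall>f. Lp p Qs f \<longrightarrow>
          (\<exists>u ut Du D2u.
             continuous_on (closure Qs) u \<and> W21_loc p B 1 u ut Du D2u \<and>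
             (AE z in lebesgue_on Qs. ut z + pucci_plus lam Lam (D2u z) = f z) \<and>
             (\<forall>z\<in>par_boundary B 1. u z = 0) \<and>
             (\<forall>z\<in>Qs. - C * Lp_norm p Qs (\<lambda>w. max (- f w) 0) \<le> u z \<and>
                     u z \<le> C * Lp_norm p Qs (\<lambda>w. max (f w) 0)) \<and>
             (\<forall>Q'. par_inside Q' B 1 \<longrightarrow>
                W21_norm p Q' u ut Du D2u
                  \<le> C' (par_setdist Q' (par_boundary B 1)) * Lp_norm p Qs f)))"

section \<open>The cylinders and the constants of the weak Harnack inequality\<close>

definition Q0 :: "'n::finite spacetime set" where
  "Q0 = cyl (cube 10) 10"

definition J1 :: "'n::finite spacetime set" where
  "J1 = cube 1 \<times> {0<..1/2}"

definition J2 :: "'n::finite spacetime set" where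
  "J2 = cube 1 \<times> {9<..10}"

definition J3 :: "'n::finite spacetime set" where
  "J3 = cube (1/2) \<times> {1/4<..1/2}"

definition Qhat :: "real \<Rightarrow> 'n::finite spacetime \<Rightarrow> 'n spacetime set" where
  "Qhat l z = (\<lambda>w. z + w) ` (cube l \<times> {- (l\<^sup>2 / 10)<..0})"

text \<open>\<open>A\<close>, \<open>\<beta>\<close>, \<open>\<epsilon>\<close> are admissible constants for drift coefficients of \<open>L\<^sup>q\<close> norm at most \<open>M\<close>.\<close>

definition weak_harnack_constants ::
  "'n::finite itself \<Rightarrow> real \<Rightarrow> real \<Rightarrow> real \<Rightarrow> real \<Rightarrow> real \<Rightarrow> real \<Rightarrow> real \<Rightarrow> real \<Rightarrow> bool" where
  "weak_harnack_constants TY lam Lam p q M A \<beta> \<epsilon> \<longleftrightarrow>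
     0 < A \<and> 0 < \<beta> \<and> 0 < \<epsilon> \<and>
     (\<forall>\<mu> f. \<forall>w :: 'n spacetime \<Rightarrow> real.
        Lp_plus q Q0 \<mu> \<and> Lp_norm q Q0 \<mu> \<le> M \<and> Lp_plus p Q0 f \<and> Lp_norm p Q0 f \<le> \<epsilon> \<and>
        (\<forall>z\<in>Q0. 0 \<le> w z) \<and>
        visc_supersolution p (cube 10) 10
          (\<lambda>z \<xi> X. pucci_plus lam Lam X + \<mu> z * norm \<xi> + f z) w \<and>
        (INF z\<in>J2. ereal (w z)) \<le> 1 \<longrightarrow>
        (\<forall>s>0. measure lebesgue {z\<in>J1. w z \<ge> s} \<le> A * s powr (- \<beta>)))"

end

theory Submission
  imports Defs
begin

text \<open>Suppose that \<open>v < \<nu>\<^sup>j\<close> on the small cylinder \<open>Qhat (l j) z0\<close>. Zooming this cylinder to \<open>Q0\<close> turns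
  \<open>(\<nu>\<^sup>j - v) / (\<nu>\<^sup>j - \<nu>\<^sup>j\<^sup>-\<^sup>1)\<close> into a nonnegative supersolution \<open>w\<close> with \<open>w (0, 10) \<le> 1\<close>; since \<open>q > n + 2\<close> and
  \<open>p > (n + 2) / 2\<close>, the norms of the rescaled drift and right-hand side do not increase. The weak
  Harnack inequality says that \<open>w\<close> is rarely large, i.e. \<open>v \<ge> \<nu>\<^sup>j / 2\<close> on more than half of the zoomed
  \<open>J1\<close> when \<open>\<nu>\<close> is close to 1. This contradicts the decay of the distribution function of \<open>v\<close> as soon as
  \<open>l j\<close> is a large multiple of \<open>\<nu>\<^sup>-\<^sup>j\<^sup>\<beta>\<^sup>/\<^sup>(\<^sup>n\<^sup>+\<^sup>2\<^sup>)\<close>, which is still summable.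

  The technical point is that a test function for \<open>w\<close> lives only on the small cylinder, up to its top,
  whereas \<open>v\<close> must be tested with functions on all of \<open>Q0\<close>. An even reflection in time followed by a
  smooth cutoff extends it within the parabolic Sobolev space.\<close>

section \<open>Smooth functions\<close>

text \<open>Put M = \<nu>^j, M' = \<nu>^(j-1), b = M - M' and \<rho> = \<open>l j / 10\<close>.
  Because values are divided by b, the rescaled source is (\<rho>^2 / b) f, and b \<ge> 1 keeps its
  norm from growing. At each point of J1 there are two possibilities: the zoomed v is at least M/2,
  or w > M/(2b). The quotient M/(2b) = \<nu>/(2(\<nu> - 1)) does not depend on j, so a single level
  K of the distribution function of w serves all j: K is taken so large that
  \<open>A_star * K powr (- beta_star)\<close> is below |J1|/2, and \<nu> is then determined by
  M/(2b) = K. The zoomed J1 has measure \<rho>^(n+2) |J1|, whereas the decay of v allows at most A0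
  (M/2)^(-\<beta>0) for the set where v \<ge> M/2; comparing the two dictates the size of
  \<open>l j\<close>.

  Even reflection suffices because the parabolic Sobolev space contains only one time derivative:
  the reflected function stays continuous across the top, and its time derivative is allowed to jump
  there.\<close>

definition smooth :: "('a::euclidean_space \<Rightarrow> real) \<Rightarrow> bool" where
  "smooth f \<longleftrightarrow> (\<forall>k. Ck k f)"

abbreviation pderiv_dir :: "'a::euclidean_space \<Rightarrow> ('a \<Rightarrow> real) \<Rightarrow> 'a \<Rightarrow> real" where
  "pderiv_dir b f \<equiv> (\<lambda>x. frechet_derivative f (at x) b)"

text \<open>Derivatives are unique, so the existential witness in \<open>Ck\<close> can be named.
  Partial derivatives then become concrete functions that can be iterated.\<close>

lemma Ck_Suc_iff:
  "Ck (Suc k) f \<longleftrightarrow> (\<forall>x. f differentiable (at x)) \<and> (\<forall>b\<in>Basis. Ck k (pderiv_dir b f))"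
proof
  assume "Ck (Suc k) f"
  then obtain f' where f': "\<And>x. (f has_derivative f' x) (at x)" "\<And>b. b\<in>Basis \<Longrightarrow> Ck k (\<lambda>x. f' x b)"
    by auto
  have "f' x = frechet_derivative f (at x)" for x
    using f'(1) by (rule frechet_derivative_at)
  with f' show "(\<forall>x. f differentiable (at x)) \<and> (\<forall>b\<in>Basis. Ck k (pderiv_dir b f))"
    by (auto simp: differentiable_def)
next
  assume "(\<forall>x. f differentiable (at x)) \<and> (\<forall>b\<in>Basis. Ck k (pderiv_dir b f))"
  then show "Ck (Suc k) f"
    by (auto simp: frechet_derivative_works intro!: exI[of _ "\<lambda>x. frechet_derivative f (at x)"])
qed

lemma Ck_SucI:
  assumes "\<And>x. (f has_derivative f' x) (at x)" "\<And>b. b \<in> Basis \<Longrightarrow> Ck k (\<lambda>x. f' x b)"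
  shows "Ck (Suc k) f"
  using assms by auto

lemma Ck_SucE:
  assumes "Ck (Suc k) f"
  obtains f' where "\<And>x. (f has_derivative f' x) (at x)" "\<And>b. b \<in> Basis \<Longrightarrow> Ck k (\<lambda>x. f' x b)"
  using assms by auto

lemma Ck_Suc_imp: "Ck (Suc k) f \<Longrightarrow> Ck k f"
proof (induction k arbitrary: f)
  case 0
  then show ?case
    by (auto simp: continuous_on_eq_continuous_at intro: has_derivative_continuous)
next
  case (Suc k)
  then show ?case unfolding Ck_Suc_iff[of "Suc k"] Ck_Suc_iff[of k f] by auto
qed

lemma Ck_add: "Ck k f \<Longrightarrow> Ck k g \<Longrightarrow> Ck k (\<lambda>x. f x + g x)"
proof (induction k arbitrary: f g)
  case 0
  then show ?case by (auto intro: continuous_intros)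
next
  case (Suc k)
  obtain f' where f': "\<And>x. (f has_derivative f' x) (at x)" "\<And>b. b\<in>Basis \<Longrightarrow> Ck k (\<lambda>x. f' x b)"
    using Suc.prems(1) by (rule Ck_SucE) blast
  obtain g' where g': "\<And>x. (g has_derivative g' x) (at x)" "\<And>b. b\<in>Basis \<Longrightarrow> Ck k (\<lambda>x. g' x b)"
    using Suc.prems(2) by (rule Ck_SucE) blast
  show ?case using f' g'
    by (intro Ck_SucI[where f' = "\<lambda>x h. f' x h + g' x h"] has_derivative_add Suc.IH)
qed

lemma Ck_mult: "Ck k f \<Longrightarrow> Ck k g \<Longrightarrow> Ck k (\<lambda>x. f x * g x)"
proof (induction k arbitrary: f g)
  case 0
  then show ?case by (auto intro: continuous_intros)
next
  case (Suc k)
  obtain f' where f': "\<And>x. (f has_derivative f' x) (at x)" "\<And>b. b\<in>Basis \<Longrightarrow> Ck k (\<lambda>x. f' x b)"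
    using Suc.prems(1) by (rule Ck_SucE) blast
  obtain g' where g': "\<And>x. (g has_derivative g' x) (at x)" "\<And>b. b\<in>Basis \<Longrightarrow> Ck k (\<lambda>x. g' x b)"
    using Suc.prems(2) by (rule Ck_SucE) blast
  have "Ck k f" "Ck k g" using Suc.prems by (auto simp del: Ck.simps intro: Ck_Suc_imp)
  with f' g' show ?case
    by (intro Ck_SucI[where f' = "\<lambda>x h. f x * g' x h + f' x h * g x"] has_derivative_mult Ck_add Suc.IH)
qed

lemma Ck_const: "Ck k (\<lambda>x. c)"
  by (induction k arbitrary: c) (auto intro!: exI[of _ "\<lambda>x h. 0"] derivative_eq_intros)

lemma Ck_inverse: "Ck k f \<Longrightarrow> (\<And>x. f x \<noteq> 0) \<Longrightarrow> Ck k (\<lambda>x. inverse (f x))"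
proof (induction k arbitrary: f)
  case 0
  then show ?case by (auto intro: continuous_intros)
next
  case (Suc k)
  obtain f' where *: "\<And>x. (f has_derivative f' x) (at x)" "\<And>b. b\<in>Basis \<Longrightarrow> Ck k (\<lambda>x. f' x b)"
    using Suc.prems(1) by (rule Ck_SucE) blast
  have "Ck k f" using Suc.prems by (auto simp del: Ck.simps intro: Ck_Suc_imp)
  then have inv: "Ck k (\<lambda>x. inverse (f x))" using Suc by auto
  show ?case
  proof (rule Ck_SucI)
    \<comment> \<open>The factor \<open>(-1)\<close> stands in for a minus sign so that closure
      under products and constants settles the derivative.\<close>
    show "((\<lambda>x. inverse (f x)) has_derivative (\<lambda>h. (-1) * (inverse (f x) * f' x h * inverse (f x)))) (at x)" for x
      using Deriv.has_derivative_inverse[OF Suc.prems(2) *(1)] by simp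
    show "Ck k (\<lambda>x. (-1) * (inverse (f x) * f' x b * inverse (f x)))" if "b \<in> Basis" for b
      by (intro Ck_mult Ck_const inv *(2) that)
  qed
qed

lemma smooth_add: "smooth f \<Longrightarrow> smooth g \<Longrightarrow> smooth (\<lambda>x. f x + g x)"
  and smooth_mult: "smooth f \<Longrightarrow> smooth g \<Longrightarrow> smooth (\<lambda>x. f x * g x)"
  and smooth_const: "smooth (\<lambda>x. c)"
  and smooth_inverse: "smooth f \<Longrightarrow> (\<And>x. f x \<noteq> 0) \<Longrightarrow> smooth (\<lambda>x. inverse (f x))"
  by (auto simp: smooth_def intro: Ck_add Ck_mult Ck_const Ck_inverse)

lemma smooth_diff: "smooth f \<Longrightarrow> smooth g \<Longrightarrow> smooth (\<lambda>x. f x - g x)"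
  using smooth_add[of f "\<lambda>x. (-1) * g x"] smooth_mult[OF smooth_const[of "-1"], of g] by simp

lemma smooth_imp_differentiable: "smooth f \<Longrightarrow> f differentiable (at x)"
  unfolding smooth_def using Ck_Suc_iff by blast

lemma smooth_has_derivative: "smooth f \<Longrightarrow> (f has_derivative frechet_derivative f (at x)) (at x)"
  using smooth_imp_differentiable frechet_derivative_works by blast

lemma smooth_pderiv_dir: "smooth f \<Longrightarrow> b \<in> Basis \<Longrightarrow> smooth (pderiv_dir b f)"
  unfolding smooth_def using Ck_Suc_iff by blast

lemma smooth_continuous_on: "smooth f \<Longrightarrow> continuous_on A f"
  unfolding smooth_def by (metis Ck.simps(1) continuous_on_subset subset_UNIV)

lemma smooth_measurable: "smooth f \<Longrightarrow> f \<in> borel_measurable borel"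
  by (simp add: borel_measurable_continuous_onI smooth_continuous_on)

lemma pderiv_dir_mult:
  assumes "smooth f" "smooth g"
  shows "pderiv_dir b (\<lambda>x. f x * g x) x = f x * pderiv_dir b g x + pderiv_dir b f x * g x"
  using frechet_derivative_at[OF has_derivative_mult[OF assms[THEN smooth_has_derivative]], of x]
  by metis

lemma pderiv_dir_add:
  assumes "smooth f" "smooth g"
  shows "pderiv_dir b (\<lambda>x. f x + g x) x = pderiv_dir b f x + pderiv_dir b g x"
  using frechet_derivative_at[OF has_derivative_add[OF assms[THEN smooth_has_derivative]], of x]
  by metis

lemma smooth_inner: "smooth (\<lambda>x. x \<bullet> c)"
proof -
  have "Ck k (\<lambda>x. x \<bullet> c)" for k
  proof (cases k)
    case (Suc m)
    then show ?thesis
      by (auto simp del: Ck.simps intro!: Ck_SucI[where f' = "\<lambda>x h. h \<bullet> c"] Ck_const derivative_eq_intros)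
  qed (auto intro: continuous_intros)
  then show ?thesis by (simp add: smooth_def)
qed

lemma smooth_sum:
  assumes "finite I" "\<And>i. i \<in> I \<Longrightarrow> smooth (f i)"
  shows "smooth (\<lambda>x. \<Sum>i\<in>I. f i x)"
  using assms by (induction I rule: finite_induct) (auto intro: smooth_const smooth_add)

lemma smooth_inner_diff: "smooth (\<lambda>x. (x - c) \<bullet> (x - c))"
proof -
  have "smooth (\<lambda>x. \<Sum>b\<in>Basis. (x \<bullet> b - c \<bullet> b) * (x \<bullet> b - c \<bullet> b))"
    by (intro smooth_sum smooth_mult smooth_diff smooth_inner smooth_const) auto
  moreover have "(\<lambda>x. (x - c) \<bullet> (x - c)) = (\<lambda>x. \<Sum>b\<in>Basis. (x \<bullet> b - c \<bullet> b) * (x \<bullet> b - c \<bullet> b))"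
    by (intro ext, subst euclidean_inner) (simp add: inner_diff_left)
  ultimately show ?thesis by simp
qed

text \<open>The functions \<open>t \<mapsto> t\<^sup>-\<^sup>k e\<^sup>-\<^sup>1\<^sup>/\<^sup>t\<close>, extended by zero, have derivatives that are again combinations
  of such functions; this gives smoothness of all of them at once.\<close>

definition flat :: "nat \<Rightarrow> real \<Rightarrow> real" where
  "flat k t = (if t > 0 then exp (- (1 / t)) / t ^ k else 0)"

text \<open>From the right, u = 1/t turns this into u^k / e^u at infinity; from the left the
  function is zero.\<close>

lemma flat_tendsto_0: "(flat k \<longlongrightarrow> 0) (at 0)"
proof -
  have "((\<lambda>t::real. (inverse t) ^ k / exp (inverse t)) \<longlongrightarrow> 0) (at_right 0)"
    by (rule filterlim_compose[OF tendsto_power_div_exp_0 filterlim_inverse_at_top_right])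
  then have "(flat k \<longlongrightarrow> 0) (at_right 0)"
    by (rule Lim_transform_eventually)
      (auto simp: eventually_at_right_field flat_def exp_minus field_simps intro: exI[of _ 1])
  moreover have "(flat k \<longlongrightarrow> 0) (at_left 0)"
    by (rule Lim_transform_eventually[OF tendsto_const])
      (auto simp: eventually_at_left_field flat_def intro: exI[of _ "-1"])
  ultimately show ?thesis by (simp add: filterlim_at_split)
qed

lemma flat_has_derivative:
  "(flat k has_real_derivative flat (k + 2) t - real k * flat (k + 1) t) (at t)"
proof (cases t "0::real" rule: linorder_cases)
  case less
  have "((\<lambda>_. 0) has_real_derivative 0) (at t)" by simp
  then have "(flat k has_real_derivative 0) (at t)"
    by (rule has_field_derivative_transform_within_open[where S = "{..<0}"])
      (use less in \<open>auto simp: flat_def\<close>)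
  then show ?thesis using less by (simp add: flat_def)
next
  case equal
  \<comment> \<open>At the origin the difference quotient is again a member of the family, with
    exponent k + 1, so the limit above gives derivative zero.\<close>
  have "flat k h / h = flat (k + 1) h" for h by (simp add: flat_def field_simps)
  then have "(flat k has_real_derivative 0) (at 0)"
    using flat_tendsto_0[of "k + 1"] by (simp add: DERIV_def flat_def[of _ 0])
  then show ?thesis using equal by (simp add: flat_def)
next
  case greater
  have "((\<lambda>t. exp (- (1 / t)) / t ^ k) has_real_derivative flat (k + 2) t - real k * flat (k + 1) t) (at t)"
    using greater
    by (auto intro!: derivative_eq_intros simp: flat_def) (cases k; simp add: field_simps power2_eq_square)
  then show ?thesis
    by (rule has_field_derivative_transform_within_open[where S = "{0<..}"])
      (use greater in \<open>auto simp: flat_def\<close>)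
qed

lemma smooth_flat_compose:
  assumes "smooth h"
  shows "smooth (\<lambda>x. flat k (h x))"
proof -
  have "Ck m (\<lambda>x. flat k (h x))" for m k
  \<comment> \<open>The exponent has to vary, since one differentiation produces the exponents k + 1
    and k + 2.\<close>
  proof (induction m arbitrary: k)
    case 0
    have "continuous_on UNIV (flat k)"
      by (simp add: continuous_on_eq_continuous_at) (metis DERIV_isCont flat_has_derivative)
    then show ?case
      using continuous_on_compose2[OF _ smooth_continuous_on[OF assms]] by auto
  next
    case (Suc m)
    let ?D = "\<lambda>x. flat (k + 2) (h x) + (- real k) * flat (k + 1) (h x)"
    show ?case
    proof (rule Ck_SucI)
      show "((\<lambda>x. flat k (h x)) has_derivative (\<lambda>v. ?D x * frechet_derivative h (at x) v)) (at x)" for x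
        using has_derivative_compose[OF smooth_has_derivative[OF assms]
            flat_has_derivative[unfolded has_field_derivative_def]]
        by simp
      show "Ck m (\<lambda>x. ?D x * frechet_derivative h (at x) b)" if "b \<in> Basis" for b
        by (intro Ck_mult Ck_add Ck_const Suc.IH) (use smooth_pderiv_dir[OF assms that] in \<open>simp add: smooth_def\<close>)
    qed
  qed
  then show ?thesis by (simp add: smooth_def)
qed

text \<open>A smooth transition from 0 on the negative half-line to 1 on [1, \<infinity>). The
  denominator never vanishes because u and 1 - u cannot both be nonpositive.\<close>

definition sstep :: "real \<Rightarrow> real" where
  "sstep u = flat 0 u * inverse (flat 0 u + flat 0 (1 - u))"

lemma flat_sum_pos: "flat 0 u + flat 0 (1 - u) > 0"
  by (cases "u > 0") (auto simp: flat_def add_pos_nonneg)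

lemma smooth_sstep_compose: "smooth h \<Longrightarrow> smooth (\<lambda>x. sstep (h x))"
  unfolding sstep_def
  by (intro smooth_mult smooth_inverse smooth_add smooth_flat_compose smooth_diff smooth_const)
    (use flat_sum_pos in \<open>auto simp: less_imp_neq[symmetric]\<close>)

lemma sstep_0: "u \<le> 0 \<Longrightarrow> sstep u = 0"
  by (simp add: sstep_def flat_def)

lemma sstep_1: "u \<ge> 1 \<Longrightarrow> sstep u = 1"
  by (simp add: sstep_def flat_def)

lemma sstep_bounds: "0 \<le> sstep u" "sstep u \<le> 1"
  using flat_sum_pos[of u] by (auto simp: sstep_def field_simps) (auto simp: flat_def)

section \<open>Diagonal affine maps\<close>

text \<open>The formula follows the shape of the affine map in
  \<open>lebesgue_affine_euclidean\<close>. One factor per basis vector allows space and time to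
  scale differently.\<close>

definition daff :: "('a::euclidean_space \<Rightarrow> real) \<Rightarrow> 'a \<Rightarrow> 'a \<Rightarrow> 'a" where
  "daff c t x = t + (\<Sum>j\<in>Basis. (c j * (x \<bullet> j)) *\<^sub>R j)"

lemma daff_inner: "b \<in> Basis \<Longrightarrow> daff c t x \<bullet> b = t \<bullet> b + c b * (x \<bullet> b)"
  by (simp add: daff_def inner_add_left)

lemma daff_has_derivative: "(daff c t has_derivative daff c 0) (at x)"
  unfolding daff_def by (auto intro!: derivative_eq_intros)

lemma daff_0_Basis: "b \<in> Basis \<Longrightarrow> daff c 0 b = c b *\<^sub>R b"
  by (rule euclidean_eqI) (simp add: daff_inner inner_Basis)

lemma continuous_on_daff: "continuous_on A (daff c t)"
  unfolding daff_def by (intro continuous_intros)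

lemma Ck_daff: "Ck k f \<Longrightarrow> Ck k (\<lambda>x. f (daff c t x))"
proof (induction k arbitrary: f)
  case 0
  then show ?case using continuous_on_compose2[of UNIV f UNIV "daff c t"] continuous_on_daff by auto
next
  case (Suc k)
  obtain f' where f': "\<And>x. (f has_derivative f' x) (at x)" "\<And>b. b \<in> Basis \<Longrightarrow> Ck k (\<lambda>x. f' x b)"
    using Suc.prems by (rule Ck_SucE) blast
  show ?case
  proof (rule Ck_SucI)
    show "((\<lambda>x. f (daff c t x)) has_derivative (\<lambda>h. f' (daff c t x) (daff c 0 h))) (at x)" for x
      by (rule has_derivative_compose[OF daff_has_derivative f'(1)])
    fix b :: 'a assume b: "b \<in> Basis"
    have "f' y (daff c 0 b) = c b * f' y b" for y
      using f'(1)[of y] b by (simp add: daff_0_Basis linear_simps has_derivative_bounded_linear)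
    then show "Ck k (\<lambda>x. f' (daff c t x) (daff c 0 b))"
      using Ck_mult[OF Ck_const Suc.IH[OF f'(2)[OF b]]] by simp
  qed
qed

lemma smooth_daff: "smooth f \<Longrightarrow> smooth (\<lambda>x. f (daff c t x))"
  by (simp add: smooth_def Ck_daff)

lemma pderiv_dir_daff:
  assumes "smooth f" "b \<in> Basis"
  shows "pderiv_dir b (\<lambda>x. f (daff c t x)) x = c b * pderiv_dir b f (daff c t x)"
proof -
  note * = smooth_has_derivative[OF assms(1), of "daff c t x"]
  have "frechet_derivative (\<lambda>x. f (daff c t x)) (at x) =
      (\<lambda>h. frechet_derivative f (at (daff c t x)) (daff c 0 h))"
    by (rule frechet_derivative_at[symmetric, OF has_derivative_compose[OF daff_has_derivative *]])
  then show ?thesis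
    using has_derivative_bounded_linear[OF *] assms(2) by (simp add: daff_0_Basis linear_simps)
qed

lemma test_function_iff:
  "test_function U \<psi> \<longleftrightarrow> smooth \<psi> \<and> bounded {z. \<psi> z \<noteq> 0} \<and> closure {z. \<psi> z \<noteq> 0} \<subseteq> U"
  by (simp add: test_function_def smooth_def)

text \<open>One change of variables formula for three maps: the parabolic zoom, its inverse and the
  reflection in time.\<close>

locale diag_affine =
  fixes c :: "'a::euclidean_space \<Rightarrow> real" and t :: 'a
  assumes c_nonzero: "\<And>j. j \<in> Basis \<Longrightarrow> c j \<noteq> 0"
begin

definition T :: "'a \<Rightarrow> 'a" where "T = daff c t"

definition T' :: "'a \<Rightarrow> 'a" where "T' = daff (\<lambda>j. 1 / c j) (- (\<Sum>j\<in>Basis. (t \<bullet> j / c j) *\<^sub>R j))"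

definition J :: real where "J = (\<Prod>j\<in>Basis. \<bar>c j\<bar>)"

lemma J_pos: "J > 0"
  using c_nonzero by (auto simp: J_def intro: prod_pos)

lemma T'_inner: "b \<in> Basis \<Longrightarrow> T' x \<bullet> b = (x \<bullet> b - t \<bullet> b) / c b"
  by (simp add: T'_def daff_inner diff_divide_distrib)

lemma T'_T [simp]: "T' (T x) = x"
  by (rule euclidean_eqI) (use c_nonzero in \<open>simp add: T'_inner\<close>, simp add: T_def daff_inner)

lemma T_T' [simp]: "T (T' x) = x"
  by (rule euclidean_eqI) (use c_nonzero in \<open>simp add: T_def daff_inner T'_inner\<close>)

lemma inverse_diag_affine: "diag_affine (\<lambda>j. 1 / c j)"
  by standard (use c_nonzero in auto)

lemma measurable_T: "T \<in> lebesgue \<rightarrow>\<^sub>M lebesgue"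
  using lebesgue_affine_measurable[of c t, OF c_nonzero] by (simp add: T_def daff_def[abs_def])

lemma measurable_T': "T' \<in> lebesgue \<rightarrow>\<^sub>M lebesgue"
proof -
  interpret inv: diag_affine "\<lambda>j. 1 / c j" "- (\<Sum>j\<in>Basis. (t \<bullet> j / c j) *\<^sub>R j)"
    by (rule inverse_diag_affine)
  show ?thesis using inv.measurable_T by (simp add: inv.T_def T'_def)
qed

lemma lebesgue_T: "lebesgue = density (distr lebesgue lebesgue T) (\<lambda>_. ennreal J)"
proof -
  have "T = (\<lambda>x. t + (\<Sum>j\<in>Basis. (c j * (x \<bullet> j)) *\<^sub>R j))"
    by (simp add: T_def daff_def[abs_def])
  then show ?thesis
    using lebesgue_affine_euclidean[of c t, OF c_nonzero] unfolding J_def by metis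
qed

lemma T_vimage_sets: "S \<in> sets lebesgue \<Longrightarrow> T -` S \<in> sets lebesgue"
  using measurable_sets[OF measurable_T, of S] by simp

section \<open>Change of variables for integrals, null sets and weak derivatives\<close>

lemma borel_measurable_T_iff:
  fixes f :: "'a \<Rightarrow> 'b::topological_space"
  shows "(\<lambda>x. f (T x)) \<in> borel_measurable lebesgue \<longleftrightarrow> f \<in> borel_measurable lebesgue"
proof
  assume "(\<lambda>x. f (T x)) \<in> borel_measurable lebesgue"
  from measurable_compose[OF measurable_T' this] show "f \<in> borel_measurable lebesgue" by simp
next
  assume "f \<in> borel_measurable lebesgue"
  from measurable_compose[OF measurable_T this] show "(\<lambda>x. f (T x)) \<in> borel_measurable lebesgue" .
qed

lemma integrable_T_iff:
  fixes f :: "'a \<Rightarrow> real"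
  shows "integrable lebesgue (\<lambda>x. f (T x)) \<longleftrightarrow> integrable lebesgue f"
proof (cases "f \<in> borel_measurable lebesgue")
  case True
  have "integrable (density (distr lebesgue lebesgue T) (\<lambda>_. ennreal J)) f
      \<longleftrightarrow> integrable (distr lebesgue lebesgue T) (\<lambda>x. J *\<^sub>R f x)"
    by (rule integrable_density) (use True J_pos in auto)
  also have "\<dots> \<longleftrightarrow> integrable lebesgue (\<lambda>x. f (T x))"
    using True J_pos measurable_T by (simp add: integrable_distr_eq)
  finally show ?thesis unfolding lebesgue_T[symmetric] by simp
next
  \<comment> \<open>Composition with \<open>T\<close> or \<open>T'\<close> preserves measurability,
    so a non-measurable f makes both sides false.\<close>
  case False
  then show ?thesis using borel_measurable_T_iff[of f] borel_measurable_integrable by blast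
qed

lemma integral_T:
  fixes f :: "'a \<Rightarrow> real"
  shows "integral\<^sup>L lebesgue f = J * integral\<^sup>L lebesgue (\<lambda>x. f (T x))"
proof (cases "f \<in> borel_measurable lebesgue")
  case True
  have "integral\<^sup>L (density (distr lebesgue lebesgue T) (\<lambda>_. ennreal J)) f
      = integral\<^sup>L (distr lebesgue lebesgue T) (\<lambda>x. J *\<^sub>R f x)"
    by (rule integral_density) (use True J_pos in auto)
  also have "\<dots> = J * integral\<^sup>L lebesgue (\<lambda>x. f (T x))"
    using True measurable_T by (simp add: integral_distr)
  finally show ?thesis unfolding lebesgue_T[symmetric] .
next
  case False
  \<comment> \<open>Both integrals take the default value 0.\<close>
  then have "\<not> integrable lebesgue f" "\<not> integrable lebesgue (\<lambda>x. f (T x))"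
    using borel_measurable_T_iff[of f] borel_measurable_integrable by blast+
  then show ?thesis by (simp add: not_integrable_integral_eq)
qed

lemma AE_T:
  assumes "AE x in lebesgue. P x"
  shows "AE x in lebesgue. P (T x)"
proof -
  have "AE x in density (distr lebesgue lebesgue T) (\<lambda>_. ennreal J). P x"
    using assms unfolding lebesgue_T[symmetric] .
  then have "AE x in distr lebesgue lebesgue T. P x"
    using J_pos by (subst (asm) AE_density) auto
  then show ?thesis by (rule AE_distrD[OF measurable_T])
qed

lemma borel_measurable_on_T:
  fixes f :: "'a \<Rightarrow> real"
  assumes "S \<in> sets lebesgue"
  shows "(\<lambda>x. f (T x)) \<in> borel_measurable (lebesgue_on (T -` S)) \<longleftrightarrow> f \<in> borel_measurable (lebesgue_on S)"
  using borel_measurable_T_iff[of "\<lambda>x. indicator S x *\<^sub>R f x"] assms T_vimage_sets[OF assms]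
  by (simp add: borel_measurable_restrict_space_iff indicator_vimage)

lemma integrable_on_T:
  fixes f :: "'a \<Rightarrow> real"
  assumes "S \<in> sets lebesgue"
  shows "integrable (lebesgue_on (T -` S)) (\<lambda>x. f (T x)) \<longleftrightarrow> integrable (lebesgue_on S) f"
  using integrable_T_iff[of "\<lambda>x. indicator S x *\<^sub>R f x"] assms T_vimage_sets[OF assms]
  by (simp add: integrable_restrict_space indicator_vimage)

lemma integral_on_T:
  fixes f :: "'a \<Rightarrow> real"
  assumes "S \<in> sets lebesgue"
  shows "integral\<^sup>L (lebesgue_on S) f = J * integral\<^sup>L (lebesgue_on (T -` S)) (\<lambda>x. f (T x))"
  using integral_T[of "\<lambda>x. indicator S x *\<^sub>R f x"] assms T_vimage_sets[OF assms]
  by (simp add: integral_restrict_space indicator_vimage)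

lemma AE_on_T:
  assumes "S \<in> sets lebesgue" "AE x in lebesgue_on S. P x"
  shows "AE x in lebesgue_on (T -` S). P (T x)"
  using AE_T[of "\<lambda>x. x \<in> S \<longrightarrow> P x"] assms T_vimage_sets[OF assms(1)]
  by (simp add: AE_restrict_space_iff)

lemma measure_T:
  assumes "S \<in> sets lebesgue"
  shows "measure lebesgue S = J * measure lebesgue (T -` S)"
proof -
  have "(\<lambda>x. indicator S (T x) :: real) = indicator (T -` S)" by (simp add: fun_eq_iff indicator_vimage)
  then show ?thesis using integral_T[of "indicator S"] by simp
qed

lemma test_function_T':
  assumes "test_function UNIV \<theta>"
  shows "test_function UNIV (\<lambda>z. \<theta> (T' z))"
proof -
  have "bounded (T ` closure {z. \<theta> z \<noteq> 0})"
    using assms by (intro compact_imp_bounded compact_continuous_image)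
      (auto simp: test_function_def T_def continuous_on_daff)
  moreover have "{z. \<theta> (T' z) \<noteq> 0} \<subseteq> T ` closure {z. \<theta> z \<noteq> 0}"
    using closure_subset by (force intro: image_eqI[of _ T "T' _"])
  ultimately show ?thesis
    using assms by (auto simp: test_function_iff T'_def smooth_daff intro: bounded_subset)
qed

text \<open>Chain rule in weak form. The identity for f and g is tested with \<open>\<theta>\<close>
  composed with \<open>T'\<close>, whose derivative in direction b carries the factor 1 / c b;
  changing variables on both sides produces the same Jacobian, which cancels.\<close>

lemma weak_partial_T:
  assumes "weak_partial UNIV b f g" "b \<in> Basis"
  shows "weak_partial UNIV b (\<lambda>z. f (T z)) (\<lambda>z. c b * g (T z))"
  unfolding weak_partial_def lebesgue_on_UNIV_eq
proof (intro allI impI)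
  fix \<theta> :: "'a \<Rightarrow> real" assume "test_function (interior UNIV) \<theta>"
  then have \<theta>: "test_function UNIV \<theta>" by simp
  then have "smooth \<theta>" by (simp add: test_function_iff)
  let ?\<psi> = "\<lambda>z. \<theta> (T' z)"
  have *: "integral\<^sup>L lebesgue (\<lambda>z. f z * pderiv_dir b ?\<psi> z) = - integral\<^sup>L lebesgue (\<lambda>z. g z * ?\<psi> z)"
    using assms(1) test_function_T'[OF \<theta>] by (simp add: weak_partial_def lebesgue_on_UNIV_eq)
  have "pderiv_dir b ?\<psi> (T z) = 1 / c b * pderiv_dir b \<theta> (T' (T z))" for z
    unfolding T'_def by (rule pderiv_dir_daff[OF \<open>smooth \<theta>\<close> assms(2)])
  then have "J * integral\<^sup>L lebesgue (\<lambda>z. f (T z) * pderiv_dir b \<theta> z) / c b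
      = integral\<^sup>L lebesgue (\<lambda>z. f z * pderiv_dir b ?\<psi> z)"
    using integral_T[of "\<lambda>z. f z * pderiv_dir b ?\<psi> z"] by simp
  also have "\<dots> = - (J * integral\<^sup>L lebesgue (\<lambda>z. g (T z) * \<theta> z))"
    unfolding * using integral_T[of "\<lambda>z. g z * ?\<psi> z"] by simp
  finally have "J * integral\<^sup>L lebesgue (\<lambda>z. f (T z) * pderiv_dir b \<theta> z)
      = J * - (c b * integral\<^sup>L lebesgue (\<lambda>z. g (T z) * \<theta> z))"
    using c_nonzero[OF assms(2)] by (simp add: field_simps)
  then show "integral\<^sup>L lebesgue (\<lambda>z. f (T z) * pderiv_dir b \<theta> z) =
      - integral\<^sup>L lebesgue (\<lambda>z. c b * g (T z) * \<theta> z)"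
    using J_pos by (subst (asm) mult_left_cancel) (simp_all add: mult.assoc)
qed

end

section \<open>Lebesgue spaces and weak derivatives\<close>

lemma integrable_lebesgue_zero_outside:
  fixes h :: "'a::euclidean_space \<Rightarrow> real"
  assumes "U \<in> sets lebesgue" "\<And>z. z \<notin> U \<Longrightarrow> h z = 0"
  shows "integrable lebesgue h \<longleftrightarrow> integrable (lebesgue_on U) h"
    and "integral\<^sup>L lebesgue h = integral\<^sup>L (lebesgue_on U) h"
    and "h \<in> borel_measurable lebesgue \<longleftrightarrow> h \<in> borel_measurable (lebesgue_on U)"
proof -
  have eq: "h = (\<lambda>z. indicator U z *\<^sub>R h z)"
    using assms(2) by (auto simp: fun_eq_iff indicator_def)
  have "U \<inter> space lebesgue \<in> sets lebesgue" using assms(1) by simp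
  note r = integrable_restrict_space[OF this, of h] integral_restrict_space[OF this, of h]
    borel_measurable_restrict_space_iff[OF this, of h]
  show "integrable lebesgue h \<longleftrightarrow> integrable (lebesgue_on U) h"
    "integral\<^sup>L lebesgue h = integral\<^sup>L (lebesgue_on U) h"
    "h \<in> borel_measurable lebesgue \<longleftrightarrow> h \<in> borel_measurable (lebesgue_on U)"
    unfolding r eq[symmetric] by (rule refl)+
qed

lemma integrable_lebesgue_on_subset:
  fixes h :: "'a::euclidean_space \<Rightarrow> real"
  assumes "integrable (lebesgue_on U) h" "V \<subseteq> U" "U \<in> sets lebesgue" "V \<in> sets lebesgue"
  shows "integrable (lebesgue_on V) h"
proof -
  have "integrable lebesgue (\<lambda>z. indicator U z *\<^sub>R h z)"
    using assms(1,3) by (simp add: integrable_restrict_space)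
  then have "integrable lebesgue (\<lambda>z. indicator V z *\<^sub>R (indicator U z *\<^sub>R h z))"
    by (rule integrable_mult_indicator[OF assms(4)])
  moreover have "(\<lambda>z. indicator V z *\<^sub>R (indicator U z *\<^sub>R h z)) = (\<lambda>z. indicator V z *\<^sub>R h z)"
    using assms(2) by (auto simp: fun_eq_iff indicator_def)
  ultimately show ?thesis using assms(4) by (simp add: integrable_restrict_space)
qed

lemma borel_measurable_lebesgue_on:
  "h \<in> borel_measurable borel \<Longrightarrow> h \<in> borel_measurable (lebesgue_on S)"
  by (simp add: measurable_completion measurable_restrict_space1)

lemma integrable_mult_bounded:
  fixes f :: "'a::euclidean_space \<Rightarrow> real"
  assumes "integrable (lebesgue_on S) f" "h \<in> borel_measurable borel" "\<And>z. \<bar>h z\<bar> \<le> C"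
  shows "integrable (lebesgue_on S) (\<lambda>z. f z * h z)"
proof (rule Bochner_Integration.integrable_bound)
  show "integrable (lebesgue_on S) (\<lambda>z. C * f z)" using assms(1) by simp
  show "(\<lambda>z. f z * h z) \<in> borel_measurable (lebesgue_on S)"
    using borel_measurable_times[OF borel_measurable_integrable[OF assms(1)] borel_measurable_lebesgue_on[OF assms(2)]] .
  show "AE z in lebesgue_on S. norm (f z * h z) \<le> norm (C * f z)"
  proof (intro AE_I2)
    fix z
    have "\<bar>h z\<bar> \<le> \<bar>C\<bar>" using assms(3)[of z] by linarith
    then show "norm (f z * h z) \<le> norm (C * f z)"
      using mult_left_mono[of "\<bar>h z\<bar>" "\<bar>C\<bar>" "\<bar>f z\<bar>"] by (simp add: abs_mult mult.commute)
  qed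
qed

text \<open>On a set of finite measure the bound |f| \<le> 1 + |f|^p is enough.\<close>

lemma Lp_imp_integrable:
  assumes "Lp p S f" "p \<ge> 1" "S \<in> lmeasurable"
  shows "integrable (lebesgue_on S) f"
proof (rule Bochner_Integration.integrable_bound)
  interpret finite_measure "lebesgue_on S" using assms(3) by (rule finite_measure_lebesgue_on)
  show "integrable (lebesgue_on S) (\<lambda>z. 1 + \<bar>f z\<bar> powr p)"
    using assms(1) by (simp add: Lp_def)
  show "f \<in> borel_measurable (lebesgue_on S)" using assms(1) by (simp add: Lp_def)
  show "AE z in lebesgue_on S. norm (f z) \<le> norm (1 + \<bar>f z\<bar> powr p)"
  proof (intro AE_I2)
    fix z
    show "norm (f z) \<le> norm (1 + \<bar>f z\<bar> powr p)"
    proof (cases "\<bar>f z\<bar> \<le> 1")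
      case False
      then show ?thesis using powr_mono[of 1 p "\<bar>f z\<bar>"] assms(2) by simp
    next
      case True
      then have "\<bar>f z\<bar> \<le> 1 + \<bar>f z\<bar> powr p" by (rule order_trans) simp
      then show ?thesis by simp
    qed
  qed
qed

text \<open>Nothing is known about f outside U; the vanishing of h there is what makes the product a
  function on the whole space.\<close>

lemma Lp_mult_bounded:
  assumes "Lp p U f" "U \<in> sets lebesgue" "h \<in> borel_measurable borel" "\<And>z. \<bar>h z\<bar> \<le> C"
    "\<And>z. z \<notin> U \<Longrightarrow> h z = 0" "p > 0"
  shows "Lp p UNIV (\<lambda>z. f z * h z)"
proof -
  have m: "(\<lambda>z. \<bar>h z\<bar> powr p) \<in> borel_measurable borel" using assms(3) by simp
  have b: "\<bar>\<bar>h z\<bar> powr p\<bar> \<le> C powr p" for z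
    using assms(4,6) by (auto intro!: powr_mono2)
  have "integrable (lebesgue_on U) (\<lambda>z. \<bar>f z\<bar> powr p * (\<bar>h z\<bar> powr p))"
    using assms(1) m b by (intro integrable_mult_bounded) (auto simp: Lp_def)
  then have "integrable lebesgue (\<lambda>z. \<bar>f z * h z\<bar> powr p)"
    using assms(2,5) by (subst integrable_lebesgue_zero_outside(1)[of U]) (auto simp: abs_mult powr_mult)
  moreover have "(\<lambda>z. f z * h z) \<in> borel_measurable lebesgue"
    using assms by (subst integrable_lebesgue_zero_outside(3)[of U])
      (auto simp: Lp_def intro!: borel_measurable_times borel_measurable_lebesgue_on[of h])
  ultimately show ?thesis by (simp add: Lp_def lebesgue_on_UNIV_eq)
qed

lemma Lp_add:
  assumes "Lp p S f" "Lp p S g" "p > 0"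
  shows "Lp p S (\<lambda>z. f z + g z)"
proof -
  have m: "f \<in> borel_measurable (lebesgue_on S)" "g \<in> borel_measurable (lebesgue_on S)"
    using assms by (auto simp: Lp_def)
  have "integrable (lebesgue_on S) (\<lambda>z. \<bar>f z + g z\<bar> powr p)"
  proof (rule Bochner_Integration.integrable_bound)
    show "integrable (lebesgue_on S) (\<lambda>z. 2 powr p * (\<bar>f z\<bar> powr p + \<bar>g z\<bar> powr p))"
      using assms(1,2) by (auto simp: Lp_def)
    show "(\<lambda>z. \<bar>f z + g z\<bar> powr p) \<in> borel_measurable (lebesgue_on S)" using m by simp
    show "AE z in lebesgue_on S. norm (\<bar>f z + g z\<bar> powr p) \<le> norm (2 powr p * (\<bar>f z\<bar> powr p + \<bar>g z\<bar> powr p))"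
    proof (intro AE_I2)
      fix z
      let ?m = "max \<bar>f z\<bar> \<bar>g z\<bar>"
      have "\<bar>f z + g z\<bar> powr p \<le> (2 * ?m) powr p"
        using assms(3) by (intro powr_mono2) auto
      also have "\<dots> = 2 powr p * ?m powr p" by (simp add: powr_mult)
      also have "\<dots> \<le> 2 powr p * (\<bar>f z\<bar> powr p + \<bar>g z\<bar> powr p)"
        by (intro mult_left_mono) (auto simp: max_def)
      finally show "norm (\<bar>f z + g z\<bar> powr p) \<le> norm (2 powr p * (\<bar>f z\<bar> powr p + \<bar>g z\<bar> powr p))"
        by simp
    qed
  qed
  then show ?thesis using m by (simp add: Lp_def)
qed

lemma Lp_cmult: "Lp p S f \<Longrightarrow> Lp p S (\<lambda>z. k * f z)"
  by (auto simp: Lp_def abs_mult powr_mult)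

lemma Lp_subset:
  assumes "Lp p UNIV f" "S \<in> sets lebesgue"
  shows "Lp p S f"
  using assms integrable_lebesgue_on_subset[of UNIV "\<lambda>z. \<bar>f z\<bar> powr p" S]
  by (auto simp: Lp_def lebesgue_on_UNIV_eq intro: measurable_restrict_space1)

lemma (in diag_affine) Lp_T: "Lp p UNIV f \<Longrightarrow> Lp p UNIV (\<lambda>z. f (T z))"
  using borel_measurable_T_iff[of f] integrable_T_iff[of "\<lambda>z. \<bar>f z\<bar> powr p"]
  by (simp add: Lp_def lebesgue_on_UNIV_eq)

section \<open>Supports and multiplication by smooth cutoffs\<close>

lemma continuous_bounded_support_bound:
  fixes h :: "'a::euclidean_space \<Rightarrow> real"
  assumes "continuous_on UNIV h" "bounded {z. h z \<noteq> 0}"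
  obtains C where "C \<ge> 0" "\<And>z. \<bar>h z\<bar> \<le> C"
proof -
  have "compact (h ` closure {z. h z \<noteq> 0})"
    using assms by (intro compact_continuous_image) (auto intro: continuous_on_subset)
  then obtain C where C: "\<And>z. z \<in> closure {z. h z \<noteq> 0} \<Longrightarrow> \<bar>h z\<bar> \<le> C"
    by (fastforce dest!: compact_imp_bounded simp: bounded_iff)
  have "\<bar>h z\<bar> \<le> max C 0" for z
    using C[of z] closure_subset[of "{z. h z \<noteq> 0}"] by (cases "h z = 0") auto
  then show ?thesis by (intro that[of "max C 0"]) auto
qed

lemma pderiv_dir_support:
  assumes "pderiv_dir b f z \<noteq> 0"
  shows "z \<in> closure {z. f z \<noteq> 0}"
proof (rule ccontr)
  assume z: "z \<notin> closure {z. f z \<noteq> 0}"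
  have "((\<lambda>_. 0) has_derivative (\<lambda>_. 0)) (at z)" by simp
  then have "(f has_derivative (\<lambda>_. 0)) (at z)"
    by (rule has_derivative_transform_within_open[where s = "- closure {z. f z \<noteq> 0}"])
      (use z closure_subset[of "{z. f z \<noteq> 0}"] in auto)
  then have "frechet_derivative f (at z) = (\<lambda>_. 0)" by (metis frechet_derivative_at)
  then show False using assms by simp
qed

lemma closure_support_pderiv_dir: "closure {z. pderiv_dir b f z \<noteq> 0} \<subseteq> closure {z. f z \<noteq> 0}"
  using pderiv_dir_support by (intro closure_minimal) auto

lemma smooth_bounded_support:
  assumes "smooth h" "bounded {z. h z \<noteq> 0}"
  obtains C where "C \<ge> 0" "\<And>z. \<bar>h z\<bar> \<le> C"
  by (rule continuous_bounded_support_bound[OF smooth_continuous_on[OF assms(1)] assms(2)]) (rule that)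

lemma integrable_mult_smooth:
  assumes "integrable (lebesgue_on S) f" "smooth h" "bounded {z. h z \<noteq> 0}"
  shows "integrable (lebesgue_on S) (\<lambda>z. f z * h z)"
proof -
  obtain C where "\<And>z. \<bar>h z\<bar> \<le> C" using smooth_bounded_support[OF assms(2,3)] by blast
  then show ?thesis by (rule integrable_mult_bounded[OF assms(1) smooth_measurable[OF assms(2)]])
qed

lemma bounded_support_pderiv_dir:
  "bounded {z. h z \<noteq> 0} \<Longrightarrow> bounded {z. pderiv_dir b h z \<noteq> 0}"
  by (rule bounded_subset[OF bounded_closure]) (auto dest: pderiv_dir_support)

lemma bounded_support_mult:
  "bounded {z. h z \<noteq> 0} \<Longrightarrow> bounded {z. h z * k z \<noteq> (0::real)}"
  by (rule bounded_subset) auto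

text \<open>Leibniz rule. For an arbitrary test function \<open>\<theta>\<close> on the whole space,
  \<open>\<eta> * \<theta>\<close> is a test function on U; the term in which the derivative falls
  on \<open>\<eta>\<close> is moved to the other side. This converts weak derivatives on U into
  global ones.\<close>

lemma weak_partial_cutoff:
  assumes "open U" "integrable (lebesgue_on U) f" "integrable (lebesgue_on U) g" "weak_partial U b f g"
    "smooth \<eta>" "bounded {z. \<eta> z \<noteq> 0}" "closure {z. \<eta> z \<noteq> 0} \<subseteq> U" "b \<in> Basis"
  shows "weak_partial UNIV b (\<lambda>z. f z * \<eta> z) (\<lambda>z. g z * \<eta> z + f z * pderiv_dir b \<eta> z)"
  unfolding weak_partial_def lebesgue_on_UNIV_eq
proof (intro allI impI)
  fix \<theta> :: "'a \<Rightarrow> real" assume "test_function (interior UNIV) \<theta>"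
  then have \<theta>: "smooth \<theta>" by (simp add: test_function_iff)
  have U: "U \<in> sets lebesgue" using assms(1) by simp
  note d\<eta> = smooth_pderiv_dir[OF assms(5,8)] and d\<theta> = smooth_pderiv_dir[OF \<theta> assms(8)]
  have \<eta>0: "\<eta> z = 0" "pderiv_dir b \<eta> z = 0" if "z \<notin> U" for z
    using that assms(7) closure_subset[of "{z. \<eta> z \<noteq> 0}"] pderiv_dir_support[of \<eta> z b] by auto
  have "closure {z. \<eta> z * \<theta> z \<noteq> 0} \<subseteq> closure {z. \<eta> z \<noteq> 0}" by (rule closure_mono) auto
  then have "test_function (interior U) (\<lambda>z. \<eta> z * \<theta> z)"
    unfolding test_function_iff interior_open[OF assms(1)]
    using assms(7) by (intro conjI smooth_mult bounded_support_mult assms \<theta>) auto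
  then have E: "integral\<^sup>L (lebesgue_on U) (\<lambda>z. f z * pderiv_dir b (\<lambda>z. \<eta> z * \<theta> z) z)
      = - integral\<^sup>L (lebesgue_on U) (\<lambda>z. g z * (\<eta> z * \<theta> z))"
    using assms(4) by (simp add: weak_partial_def)
  have i: "integrable (lebesgue_on U) (\<lambda>z. f z * (\<eta> z * pderiv_dir b \<theta> z))"
    "integrable (lebesgue_on U) (\<lambda>z. f z * (pderiv_dir b \<eta> z * \<theta> z))"
    "integrable (lebesgue_on U) (\<lambda>z. g z * (\<eta> z * \<theta> z))"
    by (intro integrable_mult_smooth smooth_mult assms d\<theta> d\<eta> \<theta> bounded_support_mult bounded_support_pderiv_dir)+
  have "integral\<^sup>L lebesgue (\<lambda>z. f z * \<eta> z * pderiv_dir b \<theta> z)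
      = integral\<^sup>L (lebesgue_on U) (\<lambda>z. f z * (\<eta> z * pderiv_dir b \<theta> z))"
    using \<eta>0 U by (subst integrable_lebesgue_zero_outside(2)[of U]) (auto simp: mult.assoc)
  also have "\<dots> = integral\<^sup>L (lebesgue_on U) (\<lambda>z. f z * pderiv_dir b (\<lambda>z. \<eta> z * \<theta> z) z)
      - integral\<^sup>L (lebesgue_on U) (\<lambda>z. f z * (pderiv_dir b \<eta> z * \<theta> z))"
    using i by (simp add: pderiv_dir_mult[OF assms(5) \<theta>] ring_distribs)
  also have "\<dots> = - integral\<^sup>L (lebesgue_on U) (\<lambda>z. (g z * \<eta> z + f z * pderiv_dir b \<eta> z) * \<theta> z)"
    unfolding E using i by (simp add: ring_distribs mult.assoc)
  also have "\<dots> = - integral\<^sup>L lebesgue (\<lambda>z. (g z * \<eta> z + f z * pderiv_dir b \<eta> z) * \<theta> z)"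
    using \<eta>0 U by (subst integrable_lebesgue_zero_outside(2)[of U]) auto
  finally show "integral\<^sup>L lebesgue (\<lambda>z. f z * \<eta> z * pderiv_dir b \<theta> z)
      = - integral\<^sup>L lebesgue (\<lambda>z. (g z * \<eta> z + f z * pderiv_dir b \<eta> z) * \<theta> z)" .
qed

lemma weak_partial_add:
  assumes "weak_partial UNIV b f1 g1" "weak_partial UNIV b f2 g2" "b \<in> Basis"
    "integrable lebesgue f1" "integrable lebesgue f2" "integrable lebesgue g1" "integrable lebesgue g2"
  shows "weak_partial UNIV b (\<lambda>z. f1 z + f2 z) (\<lambda>z. g1 z + g2 z)"
  unfolding weak_partial_def lebesgue_on_UNIV_eq
proof (intro allI impI)
  fix \<theta> :: "'a \<Rightarrow> real" assume t: "test_function (interior UNIV) \<theta>"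
  then have \<theta>: "smooth \<theta>" "bounded {z. \<theta> z \<noteq> 0}" by (auto simp: test_function_iff)
  note d = smooth_pderiv_dir[OF \<theta>(1) assms(3)] bounded_support_pderiv_dir[OF \<theta>(2)]
  note i = integrable_mult_smooth[where S = UNIV, unfolded lebesgue_on_UNIV_eq]
  show "integral\<^sup>L lebesgue (\<lambda>z. (f1 z + f2 z) * pderiv_dir b \<theta> z)
      = - integral\<^sup>L lebesgue (\<lambda>z. (g1 z + g2 z) * \<theta> z)"
    using assms(1,2) t i[OF assms(4) d] i[OF assms(5) d] i[OF assms(6) \<theta>] i[OF assms(7) \<theta>]
    by (simp add: weak_partial_def lebesgue_on_UNIV_eq ring_distribs)
qed

lemma weak_partial_cmult:
  assumes "weak_partial S b f g"
  shows "weak_partial S b (\<lambda>z. k * f z) (\<lambda>z. k * g z)"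
  using assms by (auto simp: weak_partial_def mult.assoc)

lemma weak_partial_subset:
  assumes "weak_partial UNIV b f g" "S \<in> sets lebesgue"
  shows "weak_partial S b f g"
  unfolding weak_partial_def
proof (intro allI impI)
  fix \<theta> :: "'a \<Rightarrow> real" assume t: "test_function (interior S) \<theta>"
  have z: "\<theta> z = 0" "pderiv_dir b \<theta> z = 0" if "z \<notin> S" for z
    using that t closure_subset[of "{z. \<theta> z \<noteq> 0}"] pderiv_dir_support[of \<theta> z b] interior_subset[of S]
    by (auto simp: test_function_iff)
  have "test_function UNIV \<theta>" using t by (auto simp: test_function_iff)
  then have "integral\<^sup>L lebesgue (\<lambda>z. f z * pderiv_dir b \<theta> z) = - integral\<^sup>L lebesgue (\<lambda>z. g z * \<theta> z)"
    using assms(1) by (simp add: weak_partial_def lebesgue_on_UNIV_eq)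
  then show "integral\<^sup>L (lebesgue_on S) (\<lambda>z. f z * pderiv_dir b \<theta> z) = - integral\<^sup>L (lebesgue_on S) (\<lambda>z. g z * \<theta> z)"
    using z assms(2) by (simp add: integrable_lebesgue_zero_outside(2)[of S])
qed

lemma time_dir_Basis [simp]: "time_dir \<in> Basis"
  by (simp add: time_dir_def Basis_prod_def)

lemma space_dir_Basis [simp]: "space_dir k \<in> Basis"
  by (auto simp: space_dir_def Basis_prod_def simp: axis_in_Basis_iff)

lemma space_dir_neq_time_dir [simp]: "space_dir k \<noteq> time_dir"
  by (simp add: space_dir_def time_dir_def)

lemma W21_subset:
  assumes "W21 p UNIV f ft Df D2f" "S \<in> sets lebesgue"
  shows "W21 p S f ft Df D2f"
  using assms unfolding W21_def by (blast intro: Lp_subset weak_partial_subset)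

text \<open>The Hessian is bracketed as it arises: the first pair comes from applying the cutoff
  rule to \<open>Df z $ k * \<eta> z\<close>, the second from applying it to
  \<open>f z * dk k z\<close>, where the cutoff is now a derivative of
  \<open>\<eta>\<close>.\<close>

lemma W21_cutoff:
  fixes f :: "'n::finite spacetime \<Rightarrow> real"
  assumes "W21 p U f ft Df D2f" "open U" "bounded U" "p \<ge> 1"
    "smooth \<eta>" "bounded {z. \<eta> z \<noteq> 0}" "closure {z. \<eta> z \<noteq> 0} \<subseteq> U"
  defines "dk \<equiv> \<lambda>k. pderiv_dir (space_dir k) \<eta>"
  shows "W21 p UNIV (\<lambda>z. f z * \<eta> z) (\<lambda>z. ft z * \<eta> z + f z * pderiv_dir time_dir \<eta> z)
    (\<lambda>z. \<chi> k. Df z $ k * \<eta> z + f z * dk k z)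
    (\<lambda>z. \<chi> k l. (D2f z $ k $ l * \<eta> z + Df z $ k * dk l z) +
       (Df z $ l * dk k z + f z * pderiv_dir (space_dir l) (dk k) z))"
proof -
  have U: "U \<in> sets lebesgue" "U \<in> lmeasurable"
    using assms(2,3) by (auto intro: lmeasurable_open)
  have p: "p > 0" using assms(4) by simp
  have dk: "smooth (dk k)" "bounded {z. dk k z \<noteq> 0}" "closure {z. dk k z \<noteq> 0} \<subseteq> U" for k
    unfolding dk_def
    using assms closure_support_pderiv_dir[of \<eta> "space_dir k"]
    by (auto intro: smooth_pderiv_dir bounded_support_pderiv_dir)
  have W: "Lp p U f" "Lp p U ft" "\<And>k. Lp p U (\<lambda>z. Df z $ k)" "\<And>k l. Lp p U (\<lambda>z. D2f z $ k $ l)"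
    "weak_partial U time_dir f ft" "\<And>k. weak_partial U (space_dir k) f (\<lambda>z. Df z $ k)"
    "\<And>k l. weak_partial U (space_dir l) (\<lambda>z. Df z $ k) (\<lambda>z. D2f z $ k $ l)"
    using assms(1) by (auto simp: W21_def)
  have L: "Lp p UNIV (\<lambda>z. g z * h z)" "integrable lebesgue (\<lambda>z. g z * h z)"
    if gh: "Lp p U g" "smooth h" "bounded {z. h z \<noteq> 0}" "closure {z. h z \<noteq> 0} \<subseteq> U" for g h
  proof -
    obtain C where C: "\<And>z. \<bar>h z\<bar> \<le> C" using smooth_bounded_support[OF gh(2,3)] by blast
    have z: "h z = 0" if "z \<notin> U" for z
      using that gh(4) closure_subset[of "{z. h z \<noteq> 0}"] by auto
    show "Lp p UNIV (\<lambda>z. g z * h z)"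
      using gh C z U p by (intro Lp_mult_bounded[of p U g h C]) (auto intro: smooth_measurable)
    show "integrable lebesgue (\<lambda>z. g z * h z)"
      using z U integrable_mult_smooth[OF Lp_imp_integrable[OF gh(1) assms(4) U(2)] gh(2,3)]
      by (subst integrable_lebesgue_zero_outside(1)[of U]) auto
  qed
  note I = Lp_imp_integrable[OF _ assms(4) U(2)]
  have d: "smooth (pderiv_dir b h)" "bounded {z. pderiv_dir b h z \<noteq> 0}"
      "closure {z. pderiv_dir b h z \<noteq> 0} \<subseteq> U"
    if "smooth h" "bounded {z. h z \<noteq> 0}" "closure {z. h z \<noteq> 0} \<subseteq> U" "b \<in> Basis" for b h
    using that closure_support_pderiv_dir[of h b]
    by (auto intro: smooth_pderiv_dir bounded_support_pderiv_dir)
  have d2: "smooth (pderiv_dir (space_dir l) (dk k))" "bounded {z. pderiv_dir (space_dir l) (dk k) z \<noteq> 0}"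
      "closure {z. pderiv_dir (space_dir l) (dk k) z \<noteq> 0} \<subseteq> U" for k l
    using d[OF dk] by auto
  note dt = d[OF assms(5,6,7) time_dir_Basis]
  have 1: "weak_partial UNIV (space_dir k) (\<lambda>z. f z * \<eta> z) (\<lambda>z. Df z $ k * \<eta> z + f z * dk k z)" for k
    unfolding dk_def by (intro weak_partial_cutoff[OF assms(2)] I W assms) simp_all
  have 2: "weak_partial UNIV time_dir (\<lambda>z. f z * \<eta> z) (\<lambda>z. ft z * \<eta> z + f z * pderiv_dir time_dir \<eta> z)"
    by (intro weak_partial_cutoff[OF assms(2)] I W assms) simp_all
  have 3: "weak_partial UNIV (space_dir l) (\<lambda>z. Df z $ k * \<eta> z + f z * dk k z)
      (\<lambda>z. (D2f z $ k $ l * \<eta> z + Df z $ k * dk l z) +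
       (Df z $ l * dk k z + f z * pderiv_dir (space_dir l) (dk k) z))" for k l
  proof (rule weak_partial_add)
    show "weak_partial UNIV (space_dir l) (\<lambda>z. Df z $ k * \<eta> z) (\<lambda>z. D2f z $ k $ l * \<eta> z + Df z $ k * dk l z)"
      unfolding dk_def by (intro weak_partial_cutoff[OF assms(2)] I W assms) simp_all
    show "weak_partial UNIV (space_dir l) (\<lambda>z. f z * dk k z)
        (\<lambda>z. Df z $ l * dk k z + f z * pderiv_dir (space_dir l) (dk k) z)"
      by (intro weak_partial_cutoff[OF assms(2)] I W dk) simp_all
  qed (simp, (intro Bochner_Integration.integrable_add L(2) W assms dk d2)+)
  show ?thesis
    unfolding W21_def using 1 2 3
    by (simp add: L Lp_add p W assms(5-7) dk d2 dt)
qed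

section \<open>Parabolic scaling and reflection in time\<close>

text \<open>The pair \<open>(\<rho>, \<rho>\<^sup>2)\<close> gives the parabolic zoom and
  \<open>(1, -1)\<close> the reflection in time; in the latter case the coefficient is also the sign
  picked up by a derivative.\<close>

definition st_coeff :: "real \<Rightarrow> real \<Rightarrow> 'n::finite spacetime \<Rightarrow> real" where
  "st_coeff a d j = (if j = time_dir then d else a)"

lemma diag_affine_st_coeff: "a \<noteq> 0 \<Longrightarrow> d \<noteq> 0 \<Longrightarrow> diag_affine (st_coeff a d)"
  by standard (simp add: st_coeff_def)

lemma daff_st_coeff:
  fixes z :: "'n::finite spacetime"
  shows "daff (st_coeff a d) (x0, t0) z = (x0 + a *\<^sub>R fst z, t0 + d * snd z)"
proof (rule euclidean_eqI)
  fix b :: "'n spacetime" assume b: "b \<in> Basis"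
  then consider u where "b = (u, 0)" "u \<in> Basis" | "b = (0, 1)" by (auto simp: Basis_prod_def)
  then show "daff (st_coeff a d) (x0, t0) z \<bullet> b = (x0 + a *\<^sub>R fst z, t0 + d * snd z) \<bullet> b"
    unfolding daff_inner[OF b]
    by cases (auto simp: st_coeff_def time_dir_def inner_prod_def inner_add_left)
qed

lemma prod_st_coeff: "(\<Prod>j\<in>Basis. \<bar>st_coeff a d (j :: 'n::finite spacetime)\<bar>) = \<bar>a\<bar> ^ CARD('n) * \<bar>d\<bar>"
proof -
  have B: "(Basis :: 'n spacetime set) = insert time_dir ((\<lambda>u. (u, 0)) ` Basis)"
    by (auto simp: Basis_prod_def time_dir_def)
  have "(\<Prod>j\<in>(\<lambda>u. (u, 0)) ` Basis. \<bar>st_coeff a d (j :: 'n spacetime)\<bar>) = (\<Prod>j\<in>(\<lambda>u. (u :: real^'n, 0 :: real)) ` Basis. \<bar>a\<bar>)"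
    by (intro prod.cong) (auto simp: st_coeff_def time_dir_def)
  also have "\<dots> = \<bar>a\<bar> ^ CARD('n)"
    by (simp add: card_image inj_on_def)
  finally show ?thesis
    by (subst B, subst prod.insert) (auto simp: time_dir_def st_coeff_def)
qed

text \<open>The factor K rescales values. It is applied with K = -b and the coefficients of
  \<open>unzoom\<close>, to turn a test function from below into one from above.\<close>

lemma W21_scale:
  fixes f :: "'n::finite spacetime \<Rightarrow> real" and t :: "'n spacetime"
  assumes "W21 p UNIV f ft Df D2f" "d \<noteq> 0" "a \<noteq> 0"
  defines "S \<equiv> daff (st_coeff a d) t"
  shows "W21 p UNIV (\<lambda>z. K * f (S z)) (\<lambda>z. K * (d * ft (S z))) (\<lambda>z. (K * a) *\<^sub>R Df (S z))
    (\<lambda>z. (K * a\<^sup>2) *\<^sub>R D2f (S z))"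
proof -
  interpret diag_affine "st_coeff a d :: 'n spacetime \<Rightarrow> real" t
    using assms by (intro diag_affine_st_coeff)
  have S: "S = T" by (simp add: S_def T_def)
  have W: "Lp p UNIV f" "Lp p UNIV ft" "\<And>k. Lp p UNIV (\<lambda>z. Df z $ k)" "\<And>k l. Lp p UNIV (\<lambda>z. D2f z $ k $ l)"
    "weak_partial UNIV time_dir f ft" "\<And>k. weak_partial UNIV (space_dir k) f (\<lambda>z. Df z $ k)"
    "\<And>k l. weak_partial UNIV (space_dir l) (\<lambda>z. Df z $ k) (\<lambda>z. D2f z $ k $ l)"
    using assms(1) by (auto simp: W21_def)
  have c: "st_coeff a d time_dir = d" "st_coeff a d (space_dir k) = a" for k :: 'n
    by (simp_all add: st_coeff_def)
  have 1: "weak_partial UNIV time_dir (\<lambda>z. K * f (T z)) (\<lambda>z. K * (d * ft (T z)))"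
    using weak_partial_cmult[OF weak_partial_T[OF W(5)]] by (simp add: c)
  have 2: "weak_partial UNIV (space_dir k) (\<lambda>z. K * f (T z)) (\<lambda>z. K * a * Df (T z) $ k)" for k
    using weak_partial_cmult[OF weak_partial_T[OF W(6)]] by (simp add: c mult.assoc)
  have 3: "weak_partial UNIV (space_dir l) (\<lambda>z. K * a * Df (T z) $ k) (\<lambda>z. K * a\<^sup>2 * D2f (T z) $ k $ l)" for k l
    using weak_partial_cmult[OF weak_partial_T[OF W(7)], where k = "K * a"]
    by (simp add: c mult.assoc power2_eq_square)
  show ?thesis
    unfolding W21_def S using 1 2 3 W(1-4) by (auto intro!: Lp_cmult Lp_T)
qed

section \<open>Cutoff in time and even reflection across the top of a cylinder\<close>

lemma sstep_derivative:
  obtains D B where "\<And>u. (sstep has_real_derivative D u) (at u)" "\<And>u. \<bar>D u\<bar> \<le> B" "B \<ge> 0"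
    "\<And>u. u < 0 \<or> u > 1 \<Longrightarrow> D u = 0"
proof -
  have "smooth (\<lambda>x::real. x)" using smooth_inner[of "1::real"] by simp
  then have s: "smooth sstep" using smooth_sstep_compose by blast
  define D where "D = pderiv_dir 1 sstep"
  have D: "(sstep has_real_derivative D u) (at u)" for u
  proof -
    have d: "(sstep has_derivative frechet_derivative sstep (at u)) (at u)"
      by (rule smooth_has_derivative[OF s])
    have "frechet_derivative sstep (at u) h = D u * h" for h
      using linear_cmul[OF has_derivative_linear[OF d], of h 1] by (simp add: D_def mult.commute)
    then have "frechet_derivative sstep (at u) = (*) (D u)" by auto
    then show ?thesis using d by (simp add: has_field_derivative_def)
  qed
  have D0: "D u = 0" if "u < 0 \<or> u > 1" for u
  proof -
    have "(sstep has_real_derivative 0) (at u)"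
    proof (cases "u < 0")
      case True
      have "((\<lambda>_. 0) has_real_derivative 0) (at u)" by simp
      then show ?thesis
        by (rule has_field_derivative_transform_within_open[where S = "{..<0}"])
          (use True in \<open>auto simp: sstep_0\<close>)
    next
      case False
      have "((\<lambda>_. 1) has_real_derivative 0) (at u)" by simp
      then show ?thesis
        by (rule has_field_derivative_transform_within_open[where S = "{1<..}"])
          (use False that in \<open>auto simp: sstep_1\<close>)
    qed
    with D[of u] show ?thesis by (rule DERIV_unique)
  qed
  have "{u. D u \<noteq> 0} \<subseteq> {0..1}" using D0 by (auto simp: not_less[symmetric])
  then have "bounded {u. D u \<noteq> 0}" by (rule bounded_subset[rotated]) simp
  moreover have "smooth D" unfolding D_def by (rule smooth_pderiv_dir[OF s]) simp
  ultimately obtain B where "B \<ge> 0" "\<And>u. \<bar>D u\<bar> \<le> B"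
    using smooth_bounded_support[of D] by blast
  with D D0 show ?thesis by (intro that[of D B]) auto
qed

lemma snd_eq_inner_time_dir: "snd z = z \<bullet> time_dir"
  by (simp add: time_dir_def inner_prod_def)

lemma AE_snd_neq: "AE z in lebesgue. snd (z :: 'n::finite spacetime) \<noteq> \<tau>"
proof -
  have "negligible {z :: 'n spacetime. z \<bullet> time_dir = \<tau>}"
    by (rule negligible_standard_hyperplane) simp
  then have "{z :: 'n spacetime. snd z = \<tau>} \<in> null_sets lebesgue"
    by (simp add: negligible_iff_null_sets flip: snd_eq_inner_time_dir)
  then show ?thesis by (rule AE_I') auto
qed

lemma cylinder_sets_borel: "open \<Omega> \<Longrightarrow> \<Omega> \<times> {a<..\<tau>::real} \<in> sets borel"
  by (intro borel_Times) auto

text \<open>Mean value inequality along vertical lines; the time derivative of X is bounded because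
  X has bounded support.\<close>

lemma vanishing_at_time_bound:
  fixes X :: "'n::finite spacetime \<Rightarrow> real"
  assumes "smooth X" "bounded {z. X z \<noteq> 0}" "\<And>y. X (y, \<tau>) = 0"
  obtains L where "L \<ge> 0" "\<And>z. \<bar>X z\<bar> \<le> L * \<bar>\<tau> - snd z\<bar>"
proof -
  obtain L where L: "L \<ge> 0" "\<And>z. \<bar>pderiv_dir time_dir X z\<bar> \<le> L"
    using smooth_bounded_support[OF smooth_pderiv_dir[OF assms(1) time_dir_Basis] bounded_support_pderiv_dir[OF assms(2)]]
    by blast
  have "\<bar>X (y, s)\<bar> \<le> L * \<bar>\<tau> - s\<bar>" for y s
  proof -
    have d: "((\<lambda>s. X (y, s)) has_real_derivative pderiv_dir time_dir X (y, s)) (at s)" for s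
    proof -
      note dX = smooth_has_derivative[OF assms(1), of "(y, s)"]
      have 1: "((\<lambda>s. X (y, s)) has_derivative (\<lambda>h. frechet_derivative X (at (y, s)) (0, h))) (at s)"
        by (rule has_derivative_compose[where f = "\<lambda>s. (y, s)", OF _ dX]) (auto intro!: derivative_eq_intros)
      have "frechet_derivative X (at (y, s)) (0, h) = pderiv_dir time_dir X (y, s) * h" for h
        using linear_cmul[OF has_derivative_linear[OF dX], of h time_dir] by (simp add: time_dir_def mult.commute)
      then show ?thesis using 1 by (simp add: has_field_derivative_def)
    qed
    have "norm (X (y, s) - X (y, \<tau>)) \<le> L * norm (s - \<tau>)"
      by (rule field_differentiable_bound[of UNIV "\<lambda>s. X (y, s)"]) (use d L in auto)
    then show ?thesis using assms(3) by (simp add: abs_minus_commute)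
  qed
  then show ?thesis using L(1) by (intro that[of L]) (auto simp: split_paired_all)
qed

text \<open>Test functions need not vanish near the top of a cylinder: multiply them by
  \<open>sstep (m (\<tau> - s) - 1)\<close> and let \<open>m\<close> tend to infinity. For the time derivative the derivative of the
  cutoff, of size \<open>m\<close>, is compensated by \<open>X = O(\<tau> - s)\<close>.\<close>

lemma weak_partial_up_to_top:
  fixes X :: "'n::finite spacetime \<Rightarrow> real"
  assumes \<Omega>: "open \<Omega>" and a: "a < \<tau>" and w: "weak_partial (\<Omega> \<times> {a<..\<tau>}) b f g"
    and f: "integrable (lebesgue_on (\<Omega> \<times> {a<..\<tau>})) f" and g: "integrable (lebesgue_on (\<Omega> \<times> {a<..\<tau>})) g"
    and b: "b \<in> Basis" and X: "smooth X" "bounded {z. X z \<noteq> 0}" "closure {z. X z \<noteq> 0} \<subseteq> \<Omega> \<times> {a<..}"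
    and X0: "snd b = 0 \<or> (\<forall>y. X (y, \<tau>) = 0)"
  shows "integral\<^sup>L (lebesgue_on (\<Omega> \<times> {a<..\<tau>})) (\<lambda>z. f z * pderiv_dir b X z)
    = - integral\<^sup>L (lebesgue_on (\<Omega> \<times> {a<..\<tau>})) (\<lambda>z. g z * X z)"
proof -
  let ?Q = "\<Omega> \<times> {a<..\<tau>}"
  let ?M = "lebesgue_on ?Q"
  obtain D B where D: "\<And>u. (sstep has_real_derivative D u) (at u)" "\<And>u. \<bar>D u\<bar> \<le> B" "B \<ge> 0"
    "\<And>u. u < 0 \<or> u > 1 \<Longrightarrow> D u = 0"
    using sstep_derivative by blast
  \<comment> \<open>The shift by 1 makes the cutoff vanish for times later than \<tau> - 1/(m + 1),
    so its product with X is supported strictly below the top. Using \<open>Suc m\<close> keeps the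
    slope positive.\<close>
  define \<theta> where "\<theta> m z = sstep (real (Suc m) * (\<tau> - snd z) - 1)" for m and z :: "'n spacetime"
  define \<theta>' where "\<theta>' m z = D (real (Suc m) * (\<tau> - snd z) - 1) * (- real (Suc m) * snd b)" for m and z :: "'n spacetime"
  have s\<theta>: "smooth (\<theta> m)" for m
    unfolding \<theta>_def snd_eq_inner_time_dir
    by (intro smooth_sstep_compose smooth_diff smooth_mult smooth_const smooth_inner)
  have d\<theta>: "pderiv_dir b (\<theta> m) z = \<theta>' m z" for m z
  proof -
    have "((\<lambda>z. real (Suc m) * (\<tau> - snd z) - 1) has_derivative (\<lambda>h. - real (Suc m) * snd h)) (at z)"
      by (auto intro!: derivative_eq_intros simp del: of_nat_Suc)
    from has_derivative_compose[OF this D(1)[unfolded has_field_derivative_def]]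
    have "(\<theta> m has_derivative (\<lambda>h. D (real (Suc m) * (\<tau> - snd z) - 1) * (- real (Suc m) * snd h))) (at z)"
      by (simp add: \<theta>_def[abs_def])
    from frechet_derivative_at[OF this] show ?thesis by (metis \<theta>'_def)
  qed
  \<comment> \<open>A bound uniform in m. In a space direction \<open>\<theta>' m\<close> is zero.
    In the time direction it has size m + 1, but is nonzero only where (m + 1)(\<tau> - s) lies
    between 1 and 2, and there X is at most L |\<tau> - s|.\<close>
  obtain K where K: "K \<ge> 0" "\<And>m z. \<bar>X z * \<theta>' m z\<bar> \<le> K"
  proof (cases "snd b = 0")
    case True
    then show ?thesis by (intro that[of 0]) (auto simp: \<theta>'_def)
  next
    case False
    then obtain L where L: "L \<ge> 0" "\<And>z. \<bar>X z\<bar> \<le> L * \<bar>\<tau> - snd z\<bar>"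
      using vanishing_at_time_bound[OF X(1,2)] X0 by blast
    show ?thesis
    proof (rule that[of "L * B * 2 * \<bar>snd b\<bar>"])
      show "L * B * 2 * \<bar>snd b\<bar> \<ge> 0" using L D by simp
      fix m and z :: "'n spacetime"
      let ?v = "real (Suc m) * (\<tau> - snd z)"
      show "\<bar>X z * \<theta>' m z\<bar> \<le> L * B * 2 * \<bar>snd b\<bar>"
      proof (cases "?v - 1 < 0 \<or> ?v - 1 > 1")
        case True
        then show ?thesis using D(4) L D(3) by (simp add: \<theta>'_def del: of_nat_Suc)
      next
        case False
        then have v: "\<bar>?v\<bar> \<le> 2" by auto
        have "\<bar>X z * \<theta>' m z\<bar> = \<bar>X z\<bar> * (\<bar>D (?v - 1)\<bar> * (real (Suc m) * \<bar>snd b\<bar>))"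
          by (simp add: \<theta>'_def abs_mult del: of_nat_Suc)
        also have "\<dots> \<le> (L * \<bar>\<tau> - snd z\<bar>) * (B * (real (Suc m) * \<bar>snd b\<bar>))"
          by (intro mult_mono L D mult_nonneg_nonneg order_refl) auto
        also have "\<dots> = L * B * \<bar>?v\<bar> * \<bar>snd b\<bar>"
          by (simp add: abs_mult del: of_nat_Suc)
        also have "\<dots> \<le> L * B * 2 * \<bar>snd b\<bar>"
          using v L(1) D(3) by (intro mult_mono mult_nonneg_nonneg order_refl) auto
        finally show ?thesis .
      qed
    qed
  qed
  have bX: "bounded {z. pderiv_dir b X z \<noteq> 0}" by (rule bounded_support_pderiv_dir[OF X(2)])
  have sX: "smooth (pderiv_dir b X)" by (rule smooth_pderiv_dir[OF X(1) b])
  obtain C where C: "C \<ge> 0" "\<And>z. \<bar>X z\<bar> \<le> C" using smooth_bounded_support[OF X(1,2)] by blast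
  obtain C' where C': "C' \<ge> 0" "\<And>z. \<bar>pderiv_dir b X z\<bar> \<le> C'" using smooth_bounded_support[OF sX bX] by blast
  have test: "test_function (interior ?Q) (\<lambda>z. X z * \<theta> m z)" for m
  proof -
    have "closed {z :: 'n spacetime. snd z \<le> \<tau> - 1 / real (Suc m)}"
      by (intro closed_Collect_le continuous_intros)
    moreover have "{z. X z * \<theta> m z \<noteq> 0} \<subseteq> closure {z. X z \<noteq> 0} \<inter> {z. snd z \<le> \<tau> - 1 / real (Suc m)}"
    proof
      fix z assume z: "z \<in> {z. X z * \<theta> m z \<noteq> 0}"
      then have "\<not> real (Suc m) * (\<tau> - snd z) - 1 \<le> 0" by (auto simp: \<theta>_def sstep_0)
      then have "snd z \<le> \<tau> - 1 / real (Suc m)" by (simp add: field_simps)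
      then show "z \<in> closure {z. X z \<noteq> 0} \<inter> {z. snd z \<le> \<tau> - 1 / real (Suc m)}"
        using z closure_subset[of "{z. X z \<noteq> 0}"] by auto
    qed
    ultimately have "closure {z. X z * \<theta> m z \<noteq> 0} \<subseteq> closure {z. X z \<noteq> 0} \<inter> {z. snd z \<le> \<tau> - 1 / real (Suc m)}"
      by (intro closure_minimal closed_Int closed_closure)
    also have "\<dots> \<subseteq> \<Omega> \<times> {a<..<\<tau>}"
    proof
      fix z assume z: "z \<in> closure {z. X z \<noteq> 0} \<inter> {z. snd z \<le> \<tau> - 1 / real (Suc m)}"
      have "1 / real (Suc m) > 0" by simp
      moreover have "snd z \<le> \<tau> - 1 / real (Suc m)" using z by blast
      ultimately have "snd z < \<tau>" by linarith
      then show "z \<in> \<Omega> \<times> {a<..<\<tau>}" using z X(3) by (cases z) auto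
    qed
    also have "\<dots> \<subseteq> interior ?Q"
      using \<Omega> by (intro interior_maximal open_Times) auto
    finally show ?thesis
      unfolding test_function_iff by (intro conjI smooth_mult bounded_support_mult X s\<theta>)
  qed
  have E: "integral\<^sup>L ?M (\<lambda>z. f z * (X z * \<theta>' m z + pderiv_dir b X z * \<theta> m z))
      = - integral\<^sup>L ?M (\<lambda>z. g z * (X z * \<theta> m z))" for m
    using w[unfolded weak_partial_def, rule_format, OF test[of m]]
    unfolding pderiv_dir_mult[OF X(1) s\<theta>] d\<theta> .
  \<comment> \<open>At a fixed time below \<tau> the cutoff is eventually 1 with derivative 0. The
    top itself is a null set, so this gives the almost everywhere convergence required for dominated
    convergence.\<close>
  have ev: "\<forall>\<^sub>F m in sequentially. \<theta> m z = 1 \<and> \<theta>' m z = 0" if z: "snd z < \<tau>" for z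
  proof -
    obtain N :: nat where N: "2 < real N * (\<tau> - snd z)"
      using ex_less_of_nat_mult[of "\<tau> - snd z" 2] z by auto
    have "\<theta> m z = 1 \<and> \<theta>' m z = 0" if "m \<ge> N" for m
    proof -
      have "real N * (\<tau> - snd z) \<le> real (Suc m) * (\<tau> - snd z)"
        using that z by (intro mult_right_mono) auto
      then have "real (Suc m) * (\<tau> - snd z) - 1 > 1" using N by linarith
      then show ?thesis using D(4) by (simp add: \<theta>_def \<theta>'_def sstep_1 del: of_nat_Suc)
    qed
    then show ?thesis by (auto simp: eventually_sequentially)
  qed
  have "?Q \<in> sets lebesgue" using cylinder_sets_borel[OF \<Omega>] by simp
  then have AE: "AE z in ?M. snd z < \<tau>"
    using AE_snd_neq[of \<tau>] by (auto simp: AE_restrict_space_iff elim!: eventually_mono)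
  have m\<theta>: "\<theta> m \<in> borel_measurable ?M" "\<theta>' m \<in> borel_measurable ?M" for m
    using smooth_measurable[OF s\<theta>] smooth_measurable[OF smooth_pderiv_dir[OF s\<theta> b], of m]
    by (auto intro!: borel_measurable_lebesgue_on simp: d\<theta>)
  have mX: "X \<in> borel_measurable ?M" "pderiv_dir b X \<in> borel_measurable ?M"
    using smooth_measurable[OF X(1)] smooth_measurable[OF sX] by (auto intro!: borel_measurable_lebesgue_on)
  have mfg: "f \<in> borel_measurable ?M" "g \<in> borel_measurable ?M" using f g by auto
  note [measurable] = m\<theta> mX mfg
  have l1: "(\<lambda>m. integral\<^sup>L ?M (\<lambda>z. f z * (X z * \<theta>' m z + pderiv_dir b X z * \<theta> m z)))
      \<longlonglongrightarrow> integral\<^sup>L ?M (\<lambda>z. f z * pderiv_dir b X z)"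
  proof (rule integral_dominated_convergence[where w = "\<lambda>z. \<bar>f z\<bar> * (K + C')"])
    show "integrable ?M (\<lambda>z. \<bar>f z\<bar> * (K + C'))" using f by simp
    show "AE z in ?M. (\<lambda>m. f z * (X z * \<theta>' m z + pderiv_dir b X z * \<theta> m z)) \<longlonglongrightarrow> f z * pderiv_dir b X z"
      using AE
    proof (rule eventually_mono)
      fix z :: "'n spacetime" assume "snd z < \<tau>"
      from ev[OF this] have "\<forall>\<^sub>F m in sequentially. f z * (X z * \<theta>' m z + pderiv_dir b X z * \<theta> m z) = f z * pderiv_dir b X z"
        by (rule eventually_mono) simp
      then show "(\<lambda>m. f z * (X z * \<theta>' m z + pderiv_dir b X z * \<theta> m z)) \<longlonglongrightarrow> f z * pderiv_dir b X z" by (rule tendsto_eventually)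
    qed
    fix m
    have "norm (f z * (X z * \<theta>' m z + pderiv_dir b X z * \<theta> m z)) \<le> \<bar>f z\<bar> * (K + C')" for z
    proof -
      have "\<bar>pderiv_dir b X z * \<theta> m z\<bar> \<le> C' * 1"
        unfolding abs_mult using C' sstep_bounds by (intro mult_mono) (auto simp: \<theta>_def)
      then have "\<bar>X z * \<theta>' m z + pderiv_dir b X z * \<theta> m z\<bar> \<le> K + C'"
        using K(2)[of z m] by linarith
      then show ?thesis by (simp add: abs_mult mult_left_mono)
    qed
    then show "AE z in ?M. norm (f z * (X z * \<theta>' m z + pderiv_dir b X z * \<theta> m z)) \<le> \<bar>f z\<bar> * (K + C')"
      by simp
  qed (measurable)
  have l2: "(\<lambda>m. integral\<^sup>L ?M (\<lambda>z. g z * (X z * \<theta> m z))) \<longlonglongrightarrow> integral\<^sup>L ?M (\<lambda>z. g z * X z)"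
  proof (rule integral_dominated_convergence[where w = "\<lambda>z. \<bar>g z\<bar> * C"])
    show "integrable ?M (\<lambda>z. \<bar>g z\<bar> * C)" using g by simp
    show "AE z in ?M. (\<lambda>m. g z * (X z * \<theta> m z)) \<longlonglongrightarrow> g z * X z"
      using AE
    proof (rule eventually_mono)
      fix z :: "'n spacetime" assume "snd z < \<tau>"
      from ev[OF this] have "\<forall>\<^sub>F m in sequentially. g z * (X z * \<theta> m z) = g z * X z"
        by (rule eventually_mono) simp
      then show "(\<lambda>m. g z * (X z * \<theta> m z)) \<longlonglongrightarrow> g z * X z" by (rule tendsto_eventually)
    qed
    fix m
    have "norm (g z * (X z * \<theta> m z)) \<le> \<bar>g z\<bar> * C" for z
    proof -
      have "\<bar>X z * \<theta> m z\<bar> \<le> C * 1"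
        unfolding abs_mult using C sstep_bounds by (intro mult_mono) (auto simp: \<theta>_def)
      then show ?thesis using mult_left_mono[of "\<bar>X z * \<theta> m z\<bar>" C "\<bar>g z\<bar>"] by (simp add: abs_mult)
    qed
    then show "AE z in ?M. norm (g z * (X z * \<theta> m z)) \<le> \<bar>g z\<bar> * C" by simp
  qed (measurable)
  have "(\<lambda>m. - integral\<^sup>L ?M (\<lambda>z. g z * (X z * \<theta> m z))) \<longlonglongrightarrow> integral\<^sup>L ?M (\<lambda>z. f z * pderiv_dir b X z)"
    using l1 unfolding E .
  from LIMSEQ_unique[OF this tendsto_minus[OF l2]] show ?thesis .
qed

definition time_refl :: "real \<Rightarrow> 'n::finite spacetime \<Rightarrow> 'n spacetime" where
  "time_refl \<tau> z = (fst z, 2 * \<tau> - snd z)"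

lemma time_refl_simps [simp]: "fst (time_refl \<tau> z) = fst z" "snd (time_refl \<tau> z) = 2 * \<tau> - snd z"
  "time_refl \<tau> (time_refl \<tau> z) = z"
  by (simp_all add: time_refl_def)

lemma time_refl_daff: "time_refl \<tau> = daff (st_coeff 1 (-1)) (0, 2 * \<tau>)"
  by (simp add: fun_eq_iff daff_st_coeff time_refl_def)

text \<open>The factor k is the parity of the extension: 1 for the function and its space
  derivatives, -1 for the time derivative. The general value type serves scalars, gradients and
  Hessians alike.\<close>

definition glue :: "real \<Rightarrow> real \<Rightarrow> ('n::finite spacetime \<Rightarrow> 'a::real_vector) \<Rightarrow> 'n spacetime \<Rightarrow> 'a" where
  "glue \<tau> k f z = (if snd z \<le> \<tau> then f z else k *\<^sub>R f (time_refl \<tau> z))"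

text \<open>Folding the upper half back onto the lower one has Jacobian 1. The integrands h1 and h2
  are kept separate because the test function in the application is not symmetric.\<close>

lemma integral_reflect:
  fixes h1 h2 :: "'n::finite spacetime \<Rightarrow> real"
  assumes \<Omega>: "open \<Omega>" and a: "a < \<tau>"
    and h1: "integrable (lebesgue_on (\<Omega> \<times> {a<..\<tau>})) h1" and h2: "integrable (lebesgue_on (\<Omega> \<times> {a<..\<tau>})) h2"
  defines "H \<equiv> \<lambda>z. if snd z \<le> \<tau> then h1 z else h2 (time_refl \<tau> z)"
  shows "integrable (lebesgue_on (\<Omega> \<times> {a<..<2 * \<tau> - a})) H"
    and "integral\<^sup>L (lebesgue_on (\<Omega> \<times> {a<..<2 * \<tau> - a})) H
      = integral\<^sup>L (lebesgue_on (\<Omega> \<times> {a<..\<tau>})) h1 + integral\<^sup>L (lebesgue_on (\<Omega> \<times> {a<..\<tau>})) h2"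
proof -
  let ?Q = "\<Omega> \<times> {a<..\<tau>}" and ?Q' = "\<Omega> \<times> {a<..<\<tau>}" and ?R = "\<Omega> \<times> {a<..<2 * \<tau> - a}"
  interpret diag_affine "st_coeff 1 (-1) :: 'n spacetime \<Rightarrow> real" "(0, 2 * \<tau>)"
    by (intro diag_affine_st_coeff) auto
  have T: "T = time_refl \<tau>" by (simp add: T_def time_refl_daff)
  have J: "J = 1" by (simp add: J_def prod_st_coeff)
  have Q: "?Q \<in> sets lebesgue" using cylinder_sets_borel[OF \<Omega>] by simp
  have Q': "?Q' \<in> sets lebesgue" "?R \<in> sets lebesgue"
    by (rule lebesgue_openin[of UNIV]; use \<Omega> in \<open>simp add: open_Times\<close>)+
  have i2: "integrable (lebesgue_on ?Q') h2"
    by (rule integrable_lebesgue_on_subset[OF h2 _ Q Q'(1)]) auto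
  \<comment> \<open>The second piece omits the top, which \<open>H\<close> assigns to the lower
    half; otherwise it would be counted twice pointwise. The omitted set is null.\<close>
  let ?f1 = "\<lambda>z. indicator ?Q z *\<^sub>R h1 z" and ?f2 = "\<lambda>z. indicator ?Q' z *\<^sub>R h2 z"
  have f1: "integrable lebesgue ?f1" using h1 Q by (simp add: integrable_restrict_space)
  have f2: "integrable lebesgue ?f2" using i2 Q' by (simp add: integrable_restrict_space)
  have f2T: "integrable lebesgue (\<lambda>z. ?f2 (time_refl \<tau> z))"
    using f2 integrable_T_iff[of ?f2] unfolding T by blast
  have eq: "(\<lambda>z. indicator ?R z *\<^sub>R H z) = (\<lambda>z. ?f1 z + ?f2 (time_refl \<tau> z))"
  proof
    fix z
    show "indicator ?R z *\<^sub>R H z = ?f1 z + ?f2 (time_refl \<tau> z)"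
      using a by (cases z) (auto simp: H_def indicator_def time_refl_def)
  qed
  show "integrable (lebesgue_on ?R) H"
  proof -
    have "integrable lebesgue (\<lambda>z. indicator ?R z *\<^sub>R H z)"
      unfolding eq using f1 f2T by (rule Bochner_Integration.integrable_add)
    then show ?thesis using Q'(2) by (simp add: integrable_restrict_space)
  qed
  have "integral\<^sup>L (lebesgue_on ?R) H = integral\<^sup>L lebesgue (\<lambda>z. indicator ?R z *\<^sub>R H z)"
    using Q'(2) by (simp add: integral_restrict_space)
  also have "\<dots> = integral\<^sup>L lebesgue ?f1 + integral\<^sup>L lebesgue (\<lambda>z. ?f2 (time_refl \<tau> z))"
    unfolding eq using f1 f2T by (rule Bochner_Integration.integral_add)
  also have "integral\<^sup>L lebesgue (\<lambda>z. ?f2 (time_refl \<tau> z)) = integral\<^sup>L lebesgue ?f2"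
    using integral_T[of ?f2] unfolding T J by simp
  also have "integral\<^sup>L lebesgue ?f2 = integral\<^sup>L lebesgue (\<lambda>z. indicator ?Q z *\<^sub>R h2 z)"
  proof (rule integral_cong_AE)
    show "?f2 \<in> borel_measurable lebesgue" using f2 by simp
    have "integrable lebesgue (\<lambda>z. indicator ?Q z *\<^sub>R h2 z)" using h2 Q by (simp add: integrable_restrict_space)
    then show "(\<lambda>z. indicator ?Q z *\<^sub>R h2 z) \<in> borel_measurable lebesgue" by simp
    show "AE z in lebesgue. ?f2 z = indicator ?Q z *\<^sub>R h2 z"
      using AE_snd_neq[of \<tau>] by (rule eventually_mono) (auto simp: indicator_def)
  qed
  finally show "integral\<^sup>L (lebesgue_on ?R) H = integral\<^sup>L (lebesgue_on ?Q) h1 + integral\<^sup>L (lebesgue_on ?Q) h2"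
    using Q by (simp add: integral_restrict_space)
qed

lemma weak_partial_reflect:
  fixes f :: "'n::finite spacetime \<Rightarrow> real"
  assumes \<Omega>: "open \<Omega>" and a: "a < \<tau>" and w: "weak_partial (\<Omega> \<times> {a<..\<tau>}) b f g"
    and f: "integrable (lebesgue_on (\<Omega> \<times> {a<..\<tau>})) f" and g: "integrable (lebesgue_on (\<Omega> \<times> {a<..\<tau>})) g"
    and b: "b \<in> Basis"
  shows "weak_partial (\<Omega> \<times> {a<..<2 * \<tau> - a}) b (glue \<tau> 1 f) (glue \<tau> (st_coeff 1 (-1) b) g)"
  unfolding weak_partial_def
proof (intro allI impI)
  let ?Q = "\<Omega> \<times> {a<..\<tau>}" and ?R = "\<Omega> \<times> {a<..<2 * \<tau> - a}"
  let ?k = "st_coeff 1 (-1) b"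
  fix \<theta> :: "'n spacetime \<Rightarrow> real" assume "test_function (interior ?R) \<theta>"
  then have \<theta>: "smooth \<theta>" "bounded {z. \<theta> z \<noteq> 0}" "closure {z. \<theta> z \<noteq> 0} \<subseteq> ?R"
    using interior_subset[of ?R] by (auto simp: test_function_iff)
  define \<theta>r where "\<theta>r z = \<theta> (time_refl \<tau> z)" for z
  define X where "X z = \<theta> z + ?k * \<theta>r z" for z
  have k2: "?k * ?k = 1" by (simp add: st_coeff_def)
  have s\<theta>r: "smooth \<theta>r" unfolding \<theta>r_def time_refl_daff by (rule smooth_daff[OF \<theta>(1)])
  have d\<theta>r: "pderiv_dir b \<theta>r z = ?k * pderiv_dir b \<theta> (time_refl \<tau> z)" for z
    unfolding \<theta>r_def[abs_def] time_refl_daff by (rule pderiv_dir_daff[OF \<theta>(1) b])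
  have sk: "smooth (\<lambda>z. ?k * \<theta>r z)" by (intro smooth_mult smooth_const s\<theta>r)
  have X: "smooth X" unfolding X_def by (intro smooth_add \<theta> sk)
  have dX: "pderiv_dir b X z = pderiv_dir b \<theta> z + pderiv_dir b \<theta> (time_refl \<tau> z)" for z
  proof -
    have "pderiv_dir b (\<lambda>z. ?k) z = 0" by (simp add: frechet_derivative_const)
    then have "pderiv_dir b (\<lambda>z. ?k * \<theta>r z) z = ?k * pderiv_dir b \<theta>r z"
      by (simp add: pderiv_dir_mult[OF smooth_const s\<theta>r])
    then show ?thesis
      using k2 unfolding X_def[abs_def] by (simp add: pderiv_dir_add[OF \<theta>(1) sk] d\<theta>r flip: mult.assoc)
  qed
  let ?K = "closure {z. \<theta> z \<noteq> 0} \<union> time_refl \<tau> ` closure {z. \<theta> z \<noteq> 0}"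
  have K: "compact ?K"
    using \<theta>(2) unfolding time_refl_daff
    by (intro compact_Un compact_continuous_image continuous_on_daff) auto
  have "{z. X z \<noteq> 0} \<subseteq> ?K"
  proof
    fix z assume "z \<in> {z. X z \<noteq> 0}"
    then have "\<theta> z \<noteq> 0 \<or> \<theta> (time_refl \<tau> z) \<noteq> 0" by (auto simp: X_def \<theta>r_def)
    then have "z \<in> closure {z. \<theta> z \<noteq> 0} \<or> time_refl \<tau> z \<in> closure {z. \<theta> z \<noteq> 0}"
      using closure_subset[of "{z. \<theta> z \<noteq> 0}"] by auto
    then have "z \<in> closure {z. \<theta> z \<noteq> 0} \<or> time_refl \<tau> (time_refl \<tau> z) \<in> time_refl \<tau> ` closure {z. \<theta> z \<noteq> 0}"
      by blast
    then show "z \<in> ?K" by simp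
  qed
  then have bX: "bounded {z. X z \<noteq> 0}" and "closure {z. X z \<noteq> 0} \<subseteq> ?K"
    using bounded_subset[OF compact_imp_bounded[OF K]] closure_minimal[OF _ compact_imp_closed[OF K]] by blast+
  moreover have "?K \<subseteq> \<Omega> \<times> {a<..}"
  proof
    fix z assume "z \<in> ?K"
    then have "z \<in> ?R \<or> time_refl \<tau> z \<in> ?R" using \<theta>(3) by auto
    then show "z \<in> \<Omega> \<times> {a<..}" by (cases z) (auto simp: time_refl_def)
  qed
  ultimately have cX: "closure {z. X z \<noteq> 0} \<subseteq> \<Omega> \<times> {a<..}" by blast
  have X0: "snd b = 0 \<or> (\<forall>y. X (y, \<tau>) = 0)"
  proof (cases "b = time_dir")
    case True
    then show ?thesis by (auto simp: X_def \<theta>r_def st_coeff_def time_refl_def)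
  next
    case False
    then show ?thesis using b by (auto simp: Basis_prod_def time_dir_def)
  qed
  note d\<theta> = smooth_pderiv_dir[OF \<theta>(1) b] bounded_support_pderiv_dir[OF \<theta>(2)]
  have sd: "smooth (\<lambda>z. pderiv_dir b \<theta> (time_refl \<tau> z))"
    unfolding time_refl_daff by (rule smooth_daff[OF d\<theta>(1)])
  have br: "bounded {z. h (time_refl \<tau> z) \<noteq> 0}" if "bounded {z. h z \<noteq> (0::real)}" for h
  proof -
    have "bounded (time_refl \<tau> ` closure {z. h z \<noteq> 0})"
      using that unfolding time_refl_daff
      by (intro compact_imp_bounded compact_continuous_image continuous_on_daff) auto
    moreover have "{z. h (time_refl \<tau> z) \<noteq> 0} \<subseteq> time_refl \<tau> ` closure {z. h z \<noteq> 0}"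
    proof
      fix z assume "z \<in> {z. h (time_refl \<tau> z) \<noteq> 0}"
      then have "time_refl \<tau> z \<in> closure {z. h z \<noteq> 0}" using closure_subset[of "{z. h z \<noteq> 0}"] by auto
      then have "time_refl \<tau> (time_refl \<tau> z) \<in> time_refl \<tau> ` closure {z. h z \<noteq> 0}" by (rule imageI)
      then show "z \<in> time_refl \<tau> ` closure {z. h z \<noteq> 0}" by simp
    qed
    ultimately show ?thesis by (rule bounded_subset)
  qed
  have i: "integrable (lebesgue_on ?Q) (\<lambda>z. f z * pderiv_dir b \<theta> z)"
    "integrable (lebesgue_on ?Q) (\<lambda>z. f z * pderiv_dir b \<theta> (time_refl \<tau> z))"
    "integrable (lebesgue_on ?Q) (\<lambda>z. g z * \<theta> z)"
    "integrable (lebesgue_on ?Q) (\<lambda>z. ?k * (g z * \<theta>r z))"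
    using integrable_mult_smooth[OF f d\<theta>] integrable_mult_smooth[OF f sd br[OF d\<theta>(2)]]
      integrable_mult_smooth[OF g \<theta>(1,2)] integrable_mult_smooth[OF g s\<theta>r, unfolded \<theta>r_def, OF br[OF \<theta>(2)]]
    by (auto simp: \<theta>r_def)
  have "integral\<^sup>L (lebesgue_on ?R) (\<lambda>z. glue \<tau> 1 f z * pderiv_dir b \<theta> z)
      = integral\<^sup>L (lebesgue_on ?R) (\<lambda>z. if snd z \<le> \<tau> then f z * pderiv_dir b \<theta> z
          else f (time_refl \<tau> z) * pderiv_dir b \<theta> (time_refl \<tau> (time_refl \<tau> z)))"
    by (intro Bochner_Integration.integral_cong) (auto simp: glue_def)
  also have "\<dots> = integral\<^sup>L (lebesgue_on ?Q) (\<lambda>z. f z * pderiv_dir b X z)"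
    using i by (subst integral_reflect(2)[OF \<Omega> a i(1,2)]) (simp add: dX distrib_left)
  also have "\<dots> = - integral\<^sup>L (lebesgue_on ?Q) (\<lambda>z. g z * X z)"
    by (rule weak_partial_up_to_top[OF \<Omega> a w f g b X bX cX X0])
  also have "integral\<^sup>L (lebesgue_on ?Q) (\<lambda>z. g z * X z)
    = integral\<^sup>L (lebesgue_on ?R) (\<lambda>z. if snd z \<le> \<tau> then g z * \<theta> z
          else ?k * (g (time_refl \<tau> z) * \<theta>r (time_refl \<tau> z)))"
    using i by (subst integral_reflect(2)[OF \<Omega> a i(3,4)]) (simp add: X_def algebra_simps)
  also have "\<dots> = integral\<^sup>L (lebesgue_on ?R) (\<lambda>z. glue \<tau> ?k g z * \<theta> z)"
    by (intro Bochner_Integration.integral_cong) (auto simp: glue_def \<theta>r_def)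
  finally show "integral\<^sup>L (lebesgue_on ?R) (\<lambda>z. glue \<tau> 1 f z * pderiv_dir b \<theta> z)
      = - integral\<^sup>L (lebesgue_on ?R) (\<lambda>z. glue \<tau> ?k g z * \<theta> z)" .
qed

text \<open>Integrability of f is assumed because the measurability of the glued function is read
  off from its integrability.\<close>

lemma Lp_reflect:
  fixes f :: "'n::finite spacetime \<Rightarrow> real"
  assumes "open \<Omega>" "a < \<tau>" "Lp p (\<Omega> \<times> {a<..\<tau>}) f" "integrable (lebesgue_on (\<Omega> \<times> {a<..\<tau>})) f"
    "\<bar>k\<bar> = 1"
  shows "Lp p (\<Omega> \<times> {a<..<2 * \<tau> - a}) (glue \<tau> k f)"
proof -
  have "integrable (lebesgue_on (\<Omega> \<times> {a<..<2 * \<tau> - a})) (glue \<tau> k f)"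
    using integral_reflect(1)[OF assms(1,2,4), of "\<lambda>z. k * f z"] assms(4)
    unfolding glue_def[abs_def] real_scaleR_def by simp
  moreover have "integrable (lebesgue_on (\<Omega> \<times> {a<..<2 * \<tau> - a})) (\<lambda>z. \<bar>glue \<tau> k f z\<bar> powr p)"
  proof -
    have "(\<lambda>z. \<bar>glue \<tau> k f z\<bar> powr p) = (\<lambda>z. if snd z \<le> \<tau> then \<bar>f z\<bar> powr p else \<bar>f (time_refl \<tau> z)\<bar> powr p)"
      using assms(5) by (auto simp: fun_eq_iff glue_def abs_mult)
    then show ?thesis
      using integral_reflect(1)[OF assms(1,2), of "\<lambda>z. \<bar>f z\<bar> powr p" "\<lambda>z. \<bar>f z\<bar> powr p"] assms(3)
      by (simp add: Lp_def)
  qed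
  ultimately show ?thesis by (auto simp: Lp_def)
qed

lemma W21_reflect:
  fixes f :: "'n::finite spacetime \<Rightarrow> real"
  assumes "W21 p (\<Omega> \<times> {a<..\<tau>}) f ft Df D2f" "open \<Omega>" "bounded \<Omega>" "a < \<tau>" "p \<ge> 1"
  shows "W21 p (\<Omega> \<times> {a<..<2 * \<tau> - a}) (glue \<tau> 1 f) (glue \<tau> (-1) ft) (glue \<tau> 1 Df) (glue \<tau> 1 D2f)"
proof -
  let ?Q = "\<Omega> \<times> {a<..\<tau>}"
  have "bounded ?Q" using assms(3) by (simp add: bounded_Times)
  then have Q: "?Q \<in> lmeasurable"
    using cylinder_sets_borel[OF assms(2), of a \<tau>] by (intro bounded_set_imp_lmeasurable) auto
  have W: "Lp p ?Q f" "Lp p ?Q ft" "\<And>k. Lp p ?Q (\<lambda>z. Df z $ k)" "\<And>k l. Lp p ?Q (\<lambda>z. D2f z $ k $ l)"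
    "weak_partial ?Q time_dir f ft" "\<And>k. weak_partial ?Q (space_dir k) f (\<lambda>z. Df z $ k)"
    "\<And>k l. weak_partial ?Q (space_dir l) (\<lambda>z. Df z $ k) (\<lambda>z. D2f z $ k $ l)"
    using assms(1) by (auto simp: W21_def)
  note I = W(1-4)[THEN Lp_imp_integrable[OF _ assms(5) Q]]
  have g: "glue \<tau> 1 Df z $ k = glue \<tau> 1 (\<lambda>z. Df z $ k) z"
    "glue \<tau> 1 D2f z $ k $ l = glue \<tau> 1 (\<lambda>z. D2f z $ k $ l) z" for z k l
    by (auto simp: glue_def)
  have c: "st_coeff 1 (-1) time_dir = -1" "st_coeff 1 (-1) (space_dir k) = 1" for k :: 'n
    by (simp_all add: st_coeff_def)
  have L: "Lp p (\<Omega> \<times> {a<..<2 * \<tau> - a}) (glue \<tau> 1 f)" "Lp p (\<Omega> \<times> {a<..<2 * \<tau> - a}) (glue \<tau> (-1) ft)"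
    "\<And>k. Lp p (\<Omega> \<times> {a<..<2 * \<tau> - a}) (glue \<tau> 1 (\<lambda>z. Df z $ k))"
    "\<And>k l. Lp p (\<Omega> \<times> {a<..<2 * \<tau> - a}) (glue \<tau> 1 (\<lambda>z. D2f z $ k $ l))"
    by (intro Lp_reflect assms W I; simp)+
  note R = weak_partial_reflect[OF assms(2,4)]
  show ?thesis
    unfolding W21_def g
    using L R[OF W(5) I(1,2) time_dir_Basis, unfolded c] R[OF W(6) I(1,3) space_dir_Basis, unfolded c]
      R[OF W(7) I(3,4) space_dir_Basis, unfolded c]
    by blast
qed

section \<open>Cylinders\<close>

lemma open_cube: "open (cube r :: (real^'n::finite) set)"
proof -
  have "cube r = (\<Inter>i. {x :: real^'n. \<bar>x $ i\<bar> < r})" by (auto simp: cube_def)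
  also have "open \<dots>"
    by (intro open_INT) (auto intro!: open_Collect_less continuous_intros)
  finally show ?thesis .
qed

lemma bounded_cube: "bounded (cube r :: (real^'n::finite) set)"
proof (rule boundedI)
  fix x :: "real^'n" assume "x \<in> cube r"
  then have "(\<Sum>i\<in>UNIV. \<bar>x $ i\<bar>) \<le> (\<Sum>i\<in>(UNIV::'n set). r)"
    by (intro sum_mono) (auto simp: cube_def less_imp_le)
  then show "norm x \<le> (\<Sum>i\<in>(UNIV::'n set). r)" using norm_le_l1_cart[of x] by linarith
qed

lemma in_Qr_iff:
  "w \<in> Qr r z \<longleftrightarrow> (\<forall>i. \<bar>fst w $ i - fst z $ i\<bar> < r) \<and> snd z - r\<^sup>2 < snd w \<and> snd w \<le> snd z"
proof
  assume "w \<in> Qr r z"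
  then show "(\<forall>i. \<bar>fst w $ i - fst z $ i\<bar> < r) \<and> snd z - r\<^sup>2 < snd w \<and> snd w \<le> snd z"
    by (auto simp: Qr_def cube_def)
next
  assume "(\<forall>i. \<bar>fst w $ i - fst z $ i\<bar> < r) \<and> snd z - r\<^sup>2 < snd w \<and> snd w \<le> snd z"
  then show "w \<in> Qr r z"
    unfolding Qr_def by (intro image_eqI[of _ _ "w - z"]) (auto simp: cube_def mem_Times_iff)
qed

lemma in_Qhat_iff:
  "w \<in> Qhat l z \<longleftrightarrow> (\<forall>i. \<bar>fst w $ i - fst z $ i\<bar> < l) \<and> snd z - l\<^sup>2 / 10 < snd w \<and> snd w \<le> snd z"
proof
  assume "w \<in> Qhat l z"
  then show "(\<forall>i. \<bar>fst w $ i - fst z $ i\<bar> < l) \<and> snd z - l\<^sup>2 / 10 < snd w \<and> snd w \<le> snd z"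
    by (auto simp: Qhat_def cube_def)
next
  assume "(\<forall>i. \<bar>fst w $ i - fst z $ i\<bar> < l) \<and> snd z - l\<^sup>2 / 10 < snd w \<and> snd w \<le> snd z"
  then show "w \<in> Qhat l z"
    unfolding Qhat_def by (intro image_eqI[of _ _ "w - z"]) (auto simp: cube_def mem_Times_iff)
qed

lemma in_cyl_cube_iff: "z \<in> cyl (cube r) T \<longleftrightarrow> (\<forall>i. \<bar>fst z $ i\<bar> < r) \<and> 0 < snd z \<and> snd z \<le> T"
  by (cases z) (auto simp: cyl_def cube_def)

lemma Qr_mono:
  assumes "0 < r" "r \<le> s"
  shows "Qr r z \<subseteq> Qr s z"
proof
  fix w assume "w \<in> Qr r z"
  moreover have "r\<^sup>2 \<le> s\<^sup>2" using assms by (intro power_mono) auto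
  ultimately show "w \<in> Qr s z" using assms(2) by (auto simp: in_Qr_iff intro: less_le_trans)
qed

lemma Qr_sets: "Qr r (z :: 'n::finite spacetime) \<in> sets lebesgue"
proof -
  have "open ((\<lambda>x. x - fst z) -` cube r)"
    by (intro continuous_open_vimage open_cube) (auto intro: continuous_intros)
  moreover have "Qr r z = ((\<lambda>x. x - fst z) -` cube r) \<times> {snd z - r\<^sup>2<..snd z}"
    by (auto simp: in_Qr_iff cube_def)
  ultimately show ?thesis using cylinder_sets_borel[of "(\<lambda>x. x - fst z) -` cube r"] by simp
qed

lemma Qr_subset_ball:
  assumes "r > 0"
  obtains \<delta> where "\<delta> > 0" "Qr \<delta> (z :: 'n::finite spacetime) \<subseteq> ball z r"
proof
  \<comment> \<open>The space part contributes at most n \<delta> through the l1 norm, the time part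
    at most \<delta>^2 \<le> \<delta>; the total (n + 1) \<delta> stays strictly below r.\<close>
  define \<delta> where "\<delta> = min 1 (r / (real CARD('n) + 2))"
  show \<delta>: "\<delta> > 0" using assms by (simp add: \<delta>_def)
  show "Qr \<delta> z \<subseteq> ball z r"
  proof
    fix w assume w: "w \<in> Qr \<delta> z"
    have "(\<Sum>i\<in>UNIV. \<bar>(fst w - fst z) $ i\<bar>) \<le> (\<Sum>i\<in>(UNIV::'n set). \<delta>)"
      using w by (intro sum_mono) (auto simp: in_Qr_iff less_imp_le)
    then have 1: "norm (fst w - fst z) \<le> real CARD('n) * \<delta>"
      using norm_le_l1_cart[of "fst w - fst z"] by simp
    have "\<delta> \<le> 1" by (simp add: \<delta>_def)
    then have "\<delta>\<^sup>2 \<le> \<delta>" using \<delta> by (simp add: power2_eq_square mult_left_le)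
    then have 2: "norm (snd w - snd z) \<le> \<delta>" using w by (auto simp: in_Qr_iff)
    have "norm (w - z) \<le> norm (fst w - fst z) + norm (snd w - snd z)"
      using norm_Pair_le[of "fst w - fst z" "snd w - snd z"] by (simp add: minus_prod_def)
    also have "\<dots> \<le> (real CARD('n) + 1) * \<delta>" using 1 2 by (simp add: algebra_simps)
    also have "\<dots> < (real CARD('n) + 2) * \<delta>" using \<delta> by simp
    also have "\<dots> \<le> r"
    proof -
      have "(real CARD('n) + 2) * \<delta> \<le> (real CARD('n) + 2) * (r / (real CARD('n) + 2))"
        by (intro mult_left_mono) (auto simp: \<delta>_def)
      also have "\<dots> = r" by (simp add: add_nonneg_eq_0_iff)
      finally show ?thesis .
    qed
    finally show "w \<in> ball z r" by (simp add: dist_norm norm_minus_commute)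
  qed
qed

text \<open>The cylinder may reach the top t = 10, since the top is not part of the parabolic
  boundary. The distance is at least \<open>sqrt d\<close> to the bottom and at least d to the
  lateral part.\<close>

lemma par_inside_cube:
  assumes "0 < d" "d < 10"
  shows "par_inside (cube (10 - d) \<times> {d<..10}) (cube 10 :: (real^'n::finite) set) 10"
proof -
  let ?Q = "cube (10 - d) \<times> {d<..10} :: 'n spacetime set"
  let ?B = "par_boundary (cube 10) 10 :: 'n spacetime set"
  have "(0 :: real^'n) \<in> cube (10 - d)" using assms by (simp add: cube_def)
  then have ne: "cube (10 - d) \<noteq> ({} :: (real^'n) set)" by blast
  have "?Q \<subseteq> cyl (cube 10) 10"
  proof
    fix z assume "z \<in> ?Q"
    then have z: "\<forall>i. \<bar>fst z $ i\<bar> < 10 - d" "d < snd z" "snd z \<le> 10" by (auto simp: cube_def)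
    have "\<forall>i. \<bar>fst z $ i\<bar> < 10"
    proof
      show "\<bar>fst z $ i\<bar> < 10" for i using z(1)[rule_format, of i] assms by linarith
    qed
    then show "z \<in> cyl (cube 10) 10" using assms z(2,3) by (simp add: in_cyl_cube_iff)
  qed
  moreover have "min (sqrt d) d \<le> par_setdist ?Q (?B)"
    unfolding par_setdist_def
  proof (rule cINF_greatest)
    have "(0 :: real^'n, 10) \<in> ?Q" "(0 :: real^'n, 0) \<in> ?B"
      using assms by (auto simp: cube_def par_boundary_def)
    then have "((0, 10), (0, 0)) \<in> ?Q \<times> ?B" by (rule SigmaI)
    then show "?Q \<times> ?B \<noteq> {}" by (metis empty_iff)
    fix q assume "q \<in> ?Q \<times> ?B"
    then obtain z w where q: "q = (z, w)" "z \<in> ?Q" "w \<in> ?B"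
      by (rule SigmaE)
    from q(3) consider "snd w = 0" | "fst w \<in> frontier (cube 10)"
      by (auto simp: par_boundary_def)
    then have "min (sqrt d) d \<le> par_dist z w"
    proof cases
      case 1
      then have "sqrt d \<le> par_dist z w"
      proof -
        have "d \<le> \<bar>snd z - snd w\<bar>" using 1 q(2) by auto
        also have "\<dots> \<le> (norm (fst z - fst w))\<^sup>2 + \<bar>snd z - snd w\<bar>" by simp
        finally show ?thesis unfolding par_dist_def by (rule real_sqrt_le_mono)
      qed
      then show ?thesis by simp
    next
      case 2
      then have "fst w \<notin> cube 10" by (simp add: frontier_def interior_open open_cube)
      then obtain i where "\<bar>fst w $ i\<bar> \<ge> 10" by (auto simp: cube_def not_less)
      moreover have "\<bar>fst z $ i\<bar> < 10 - d" using q(2) by (auto simp: cube_def)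
      ultimately have "d \<le> \<bar>(fst z - fst w) $ i\<bar>" by auto
      also have "\<dots> \<le> norm (fst z - fst w)" by (rule component_le_norm_cart)
      also have "\<dots> = sqrt ((norm (fst z - fst w))\<^sup>2)" by simp
      also have "\<dots> \<le> par_dist z w" unfolding par_dist_def by (intro real_sqrt_le_mono) auto
      finally show ?thesis by simp
    qed
    then show "min (sqrt d) d \<le> (case q of (z, w) \<Rightarrow> par_dist z w)" by (simp add: q(1))
  qed
  moreover have "min (sqrt d) d > 0" using assms by simp
  ultimately have "?Q \<subseteq> cyl (cube 10) 10" "par_setdist ?Q (?B) > 0"
    by (assumption | linarith)+
  moreover have "\<exists>\<Omega>' a b. open \<Omega>' \<and> \<Omega>' \<noteq> {} \<and> a < b \<and> ?Q = \<Omega>' \<times> {a<..b}"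
    by (intro exI[of _ "cube (10 - d)"] exI[of _ d] exI[of _ 10] conjI open_cube ne assms(2) refl)
  ultimately show ?thesis unfolding par_inside_def by (intro conjI)
qed

lemma par_inside_sets:
  assumes "par_inside Q \<Omega> T"
  shows "Q \<in> sets lebesgue"
proof -
  obtain \<Omega>' a b where "open \<Omega>'" "Q = \<Omega>' \<times> {a<..b}" using assms by (auto simp: par_inside_def)
  then show ?thesis using cylinder_sets_borel[of \<Omega>' a b] by simp
qed

section \<open>Extending test functions\<close>

lemma smooth_bump:
  assumes "r > 0"
  obtains \<eta> :: "'a::euclidean_space \<Rightarrow> real" where "smooth \<eta>" "\<And>w. w \<in> ball z r \<Longrightarrow> \<eta> w = 1"
    "closure {w. \<eta> w \<noteq> 0} \<subseteq> cball z (2 * r)"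
proof
  \<comment> \<open>The argument is (4 r^2 - D^2) / (3 r^2) with D the distance to z: at least 1 for
    D \<le> r and at most 0 for D \<ge> 2 r.\<close>
  define \<eta> where "\<eta> w = sstep ((4 * r\<^sup>2 - (w - z) \<bullet> (w - z)) * (1 / (3 * r\<^sup>2)))" for w
  have n: "(w - z) \<bullet> (w - z) = (dist z w)\<^sup>2" for w
    by (simp add: dist_norm power2_norm_eq_inner norm_minus_commute)
  show "smooth \<eta>" unfolding \<eta>_def
    by (intro smooth_sstep_compose smooth_mult smooth_diff smooth_inner_diff smooth_const)
  show "\<eta> w = 1" if "w \<in> ball z r" for w
  proof -
    have "(dist z w)\<^sup>2 \<le> r\<^sup>2" using that by (intro power_mono) auto
    then show ?thesis unfolding \<eta>_def n using assms by (intro sstep_1) (simp add: field_simps)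
  qed
  have "{w. \<eta> w \<noteq> 0} \<subseteq> cball z (2 * r)"
  proof
    fix w assume "w \<in> {w. \<eta> w \<noteq> 0}"
    then have "\<not> (4 * r\<^sup>2 - (dist z w)\<^sup>2) * (1 / (3 * r\<^sup>2)) \<le> 0"
      unfolding \<eta>_def n by (auto simp: sstep_0)
    then have "(dist z w)\<^sup>2 \<le> (2 * r)\<^sup>2" using assms by (simp add: field_simps not_le power_mult_distrib)
    then show "w \<in> cball z (2 * r)" using assms power2_le_imp_le[of "dist z w" "2 * r"] by simp
  qed
  then show "closure {w. \<eta> w \<noteq> 0} \<subseteq> cball z (2 * r)" by (intro closure_minimal) auto
qed

lemma pderiv_dir_locally_const:
  assumes "open S" "z \<in> S" "\<And>w. w \<in> S \<Longrightarrow> f w = c"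
  shows "pderiv_dir b f z = 0"
proof -
  have "((\<lambda>_. c) has_derivative (\<lambda>_. 0)) (at z)" by simp
  then have "(f has_derivative (\<lambda>_. 0)) (at z)"
    by (rule has_derivative_transform_within_open[OF _ assms(1,2)]) (simp add: assms(3))
  then have "frechet_derivative f (at z) = (\<lambda>_. 0)" by (metis frechet_derivative_at)
  then show ?thesis by simp
qed

text \<open>A test function near a point of the top \<open>t = 10\<close> is reflected across the top, so that it can
  be cut off and used in a larger cylinder.\<close>

lemma W21_loc_extension:
  fixes z :: "'n::finite spacetime"
  assumes c: "continuous_on (cyl (cube 10) 10) \<phi>" and W: "W21_loc p (cube 10) 10 \<phi> \<phi>t D\<phi> D2\<phi>"
    and z: "z \<in> cyl (cube 10) 10" and p: "p \<ge> 1"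
  obtains \<delta> \<psi> \<psi>t D\<psi> D2\<psi> where "\<delta> > 0" "W21 p UNIV \<psi> \<psi>t D\<psi> D2\<psi>" "continuous_on UNIV \<psi>"
    "\<And>w. w \<in> Qr \<delta> z \<Longrightarrow> \<psi> w = \<phi> w \<and> \<psi>t w = \<phi>t w \<and> D\<psi> w = D\<phi> w \<and> D2\<psi> w = D2\<phi> w"
proof -
  define m where "m = Max (range (\<lambda>i. \<bar>fst z $ i\<bar>))"
  have "m \<in> range (\<lambda>i. \<bar>fst z $ i\<bar>)" unfolding m_def by (intro Max_in) auto
  then have m10: "m < 10" and m0: "m \<ge> 0" using z by (auto simp: in_cyl_cube_iff)
  have m: "\<bar>fst z $ i\<bar> \<le> m" for i unfolding m_def by (intro Max_ge) auto
  \<comment> \<open>A quarter of the distance of z from the lateral boundary, in the maximum norm,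
    and from the bottom. The closed ball of radius d around z then fits into the reflected cylinder
    \<open>?U\<close>, however close z is to the top.\<close>
  define d where "d = min (10 - m) (snd z) / 4"
  have s: "0 < snd z" "snd z \<le> 10" using z by (auto simp: in_cyl_cube_iff)
  have d: "d > 0" "d \<le> 5 / 2" "m + 4 * d \<le> 10" "4 * d \<le> snd z" using m10 m0 s by (auto simp: d_def)
  let ?U = "cube (10 - d) \<times> {d<..<2 * 10 - d} :: 'n spacetime set"
  have "W21 p (cube (10 - d) \<times> {d<..10}) \<phi> \<phi>t D\<phi> D2\<phi>"
    using W par_inside_cube[of d] d unfolding W21_loc_def by auto
  then have WU: "W21 p ?U (glue 10 1 \<phi>) (glue 10 (-1) \<phi>t) (glue 10 1 D\<phi>) (glue 10 1 D2\<phi>)"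
    by (rule W21_reflect[OF _ open_cube bounded_cube _ p]) (use d in auto)
  obtain \<eta> :: "'n spacetime \<Rightarrow> real" where \<eta>: "smooth \<eta>" "\<And>w. w \<in> ball z (d / 2) \<Longrightarrow> \<eta> w = 1"
    "closure {w. \<eta> w \<noteq> 0} \<subseteq> cball z (2 * (d / 2))"
    using smooth_bump[of "d / 2" z] d(1) by auto
  have sub: "cball z (2 * (d / 2)) \<subseteq> ?U"
  proof
    fix w assume "w \<in> cball z (2 * (d / 2))"
    then have w: "norm (w - z) \<le> d" by (simp add: dist_norm norm_minus_commute)
    have "\<bar>fst w $ i\<bar> < 10 - d" for i
    proof -
      have "\<bar>(fst w - fst z) $ i\<bar> \<le> norm (fst w - fst z)" by (rule component_le_norm_cart)
      also have "\<dots> \<le> norm (w - z)" using norm_fst_le[of "fst (w - z)" "snd (w - z)"] unfolding prod.collapse by simp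
      finally have "\<bar>fst w $ i - fst z $ i\<bar> \<le> d" using w by simp
      then show ?thesis using m[of i] d by linarith
    qed
    moreover have "\<bar>snd w - snd z\<bar> \<le> d"
      using w norm_snd_le[of "snd (w - z)" "fst (w - z)"] unfolding prod.collapse by simp
    ultimately show "w \<in> ?U" using d s by (cases w) (auto simp: cube_def)
  qed
  have U: "open ?U" "bounded ?U"
  proof -
    show "open ?U" by (intro open_Times open_cube) simp
    have "bounded {d<..<2 * 10 - d}" by (rule bounded_subset[of "{d..2 * 10 - d}"]) auto
    then show "bounded ?U" by (intro bounded_Times bounded_cube)
  qed
  have supp: "closure {w. \<eta> w \<noteq> 0} \<subseteq> ?U" using \<eta>(3) sub by blast
  have "bounded (closure {w. \<eta> w \<noteq> 0})" using \<eta>(3) bounded_cball bounded_subset by blast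
  then have bdd: "bounded {w. \<eta> w \<noteq> 0}" using bounded_subset closure_subset by blast
  note WC = W21_cutoff[OF WU U p \<eta>(1) bdd supp]
  obtain \<delta> where \<delta>: "\<delta> > 0" "Qr \<delta> z \<subseteq> ball z (d / 2)" using Qr_subset_ball[of "d / 2" z] d(1) by auto
  show ?thesis
  proof (rule that[OF \<delta>(1) WC])
    let ?\<psi> = "\<lambda>w. glue 10 1 \<phi> w * \<eta> w"
    \<comment> \<open>Even reflection is composition with the continuous folding of time s \<mapsto>
      10 - |s - 10|, which makes continuity across the top immediate.\<close>
    have fold: "glue 10 1 \<phi> w = \<phi> (fst w, 10 - \<bar>snd w - 10\<bar>)" for w
      by (cases w) (auto simp: glue_def time_refl_def abs_if)
    have "continuous_on ?U (\<lambda>w. \<phi> (fst w, 10 - \<bar>snd w - 10\<bar>))"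
    proof (rule continuous_on_compose2[OF c])
      show "continuous_on ?U (\<lambda>w. (fst w, 10 - \<bar>snd w - 10\<bar>))" by (intro continuous_intros)
      show "(\<lambda>w. (fst w, 10 - \<bar>snd w - 10\<bar>)) ` ?U \<subseteq> cyl (cube 10) 10"
      proof (rule image_subsetI)
        fix w assume "w \<in> ?U"
        then have w: "\<And>i. \<bar>fst w $ i\<bar> < 10 - d" "d < snd w" "snd w < 20 - d" by (auto simp: cube_def)
        have "\<bar>fst w $ i\<bar> < 10" for i using w(1)[of i] d(1) by linarith
        moreover have "0 < 10 - \<bar>snd w - 10\<bar>" using w(2,3) d(1) by linarith
        ultimately show "(fst w, 10 - \<bar>snd w - 10\<bar>) \<in> cyl (cube 10) 10"
          by (simp add: in_cyl_cube_iff)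
      qed
    qed
    then have "continuous_on ?U ?\<psi>"
      unfolding fold by (intro continuous_on_mult smooth_continuous_on[OF \<eta>(1)])
    \<comment> \<open>Off the support of the cutoff the product is 0, whatever the glued function is
      there; this open set and \<open>?U\<close> cover the whole space.\<close>
    moreover have "continuous_on (- closure {w. \<eta> w \<noteq> 0}) ?\<psi>"
    proof (rule continuous_on_eq[of _ "\<lambda>_. 0"])
      show "0 = ?\<psi> w" if "w \<in> - closure {w. \<eta> w \<noteq> 0}" for w
        using that closure_subset[of "{w. \<eta> w \<noteq> 0}"] by auto
    qed simp
    ultimately have "continuous_on (?U \<union> - closure {w. \<eta> w \<noteq> 0}) ?\<psi>"
      using U(1) by (intro continuous_on_open_Un) auto
    moreover have "?U \<union> - closure {w. \<eta> w \<noteq> 0} = UNIV" using supp by blast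
    ultimately show "continuous_on UNIV ?\<psi>" by simp
    fix w assume w: "w \<in> Qr \<delta> z"
    then have wb: "w \<in> ball z (d / 2)" using \<delta>(2) by blast
    \<comment> \<open>Cylinders \<open>Qr\<close> extend only backwards in time, so the reflected
      half is never met. As the cutoff is 1 on the ball, its derivatives vanish and the agreement
      holds at every point, not merely almost everywhere.\<close>
    have "snd w \<le> 10" using w s by (auto simp: in_Qr_iff)
    then have g: "glue 10 k h w = h w" for k and h :: "'n spacetime \<Rightarrow> 'b::real_vector"
      by (simp add: glue_def)
    have d1: "pderiv_dir b \<eta> y = 0" if "y \<in> ball z (d / 2)" for b y
      by (rule pderiv_dir_locally_const[OF open_ball that \<eta>(2)])
    have d2: "pderiv_dir b' (pderiv_dir b \<eta>) w = 0" for b b'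
      by (rule pderiv_dir_locally_const[OF open_ball wb d1])
    show "glue 10 1 \<phi> w * \<eta> w = \<phi> w \<and>
        glue 10 (-1) \<phi>t w * \<eta> w + glue 10 1 \<phi> w * pderiv_dir time_dir \<eta> w = \<phi>t w \<and>
        (\<chi> k. glue 10 1 D\<phi> w $ k * \<eta> w + glue 10 1 \<phi> w * pderiv_dir (space_dir k) \<eta> w) = D\<phi> w \<and>
        (\<chi> k l. (glue 10 1 D2\<phi> w $ k $ l * \<eta> w + glue 10 1 D\<phi> w $ k * pderiv_dir (space_dir l) \<eta> w) +
          (glue 10 1 D\<phi> w $ l * pderiv_dir (space_dir k) \<eta> w +
           glue 10 1 \<phi> w * pderiv_dir (space_dir l) (pderiv_dir (space_dir k) \<eta>) w)) = D2\<phi> w"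
      by (simp add: g d1[OF wb] d2 \<eta>(2)[OF wb] vec_eq_iff)
  qed
qed

section \<open>Essential suprema and Pucci operators\<close>

text \<open>Identifying the limit in the viscosity definitions with an infimum, and below with a
  supremum, lets the sign conditions be checked one radius at a time.\<close>

lemma Lim_at_right_mono:
  fixes L :: "real \<Rightarrow> ereal"
  assumes "\<And>a b. 0 < a \<Longrightarrow> a \<le> b \<Longrightarrow> L a \<le> L b"
  shows "Lim (at_right 0) L = (INF a\<in>{0<..}. L a)"
proof (rule tendsto_Lim)
  show "(L \<longlongrightarrow> (INF a\<in>{0<..}. L a)) (at_right 0)"
  proof (rule order_tendstoI)
    fix x assume "x < (INF a\<in>{0<..}. L a)"
    then have "x < L a" if "a > 0" for a using that by (auto dest: less_INF_D)
    then show "\<forall>\<^sub>F a in at_right 0. x < L a"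
      by (auto simp: eventually_at_right_field intro: exI[of _ 1])
  next
    fix x assume "(INF a\<in>{0<..}. L a) < x"
    then obtain b where "b > 0" "L b < x" by (auto simp: INF_less_iff)
    then show "\<forall>\<^sub>F a in at_right 0. L a < x"
      using assms[of _ b]
      by (auto simp: eventually_at_right_field intro!: exI[of _ b]) (meson le_less_trans less_imp_le)
  qed
qed simp

lemma Lim_at_right_antimono:
  fixes L :: "real \<Rightarrow> ereal"
  assumes "\<And>a b. 0 < a \<Longrightarrow> a \<le> b \<Longrightarrow> L b \<le> L a"
  shows "Lim (at_right 0) L = (SUP a\<in>{0<..}. L a)"
proof (rule tendsto_Lim)
  show "(L \<longlongrightarrow> (SUP a\<in>{0<..}. L a)) (at_right 0)"
  proof (rule order_tendstoI)
    fix x assume "(SUP a\<in>{0<..}. L a) < x"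
    then have "L a < x" if "a > 0" for a using that by (auto dest: SUP_lessD)
    then show "\<forall>\<^sub>F a in at_right 0. L a < x"
      by (auto simp: eventually_at_right_field intro: exI[of _ 1])
  next
    fix x assume "x < (SUP a\<in>{0<..}. L a)"
    then obtain b where "b > 0" "x < L b" by (auto simp: less_SUP_iff)
    then show "\<forall>\<^sub>F a in at_right 0. x < L a"
      using assms[of _ b]
      by (auto simp: eventually_at_right_field intro!: exI[of _ b]) (meson less_le_trans less_imp_le)
  qed
qed simp

text \<open>The library value of the essential supremum of a non-measurable function is \<open>\<infinity>\<close>.\<close>

lemma ess_sup_on_less_top:
  assumes "ess_sup_on S g < \<infinity>"
  shows "g \<in> borel_measurable (lebesgue_on S)"
proof (rule ccontr)
  assume "g \<notin> borel_measurable (lebesgue_on S)"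
  then have "(\<lambda>z. ereal (g z)) \<notin> borel_measurable (lebesgue_on S)"
    using borel_measurable_ereal_iff by blast
  then show False using assms esssup_non_measurable[of "\<lambda>z. ereal (g z)"] by (simp add: ess_sup_on_def top_ereal_def)
qed

text \<open>If g is not measurable on B, the right-hand side is \<infinity>. Otherwise g is
  measurable on A too, and the almost everywhere bound passes to the subset.\<close>

lemma ess_sup_on_mono:
  assumes "A \<subseteq> B" "A \<in> sets lebesgue" "B \<in> sets lebesgue"
  shows "ess_sup_on A g \<le> ess_sup_on B g"
proof (cases "ess_sup_on B g = \<infinity>")
  case False
  then have "g \<in> borel_measurable (lebesgue_on B)" by (intro ess_sup_on_less_top) (simp add: less_top)
  then have m: "g \<in> borel_measurable (lebesgue_on A)" using assms(1) by (rule measurable_restrict_mono)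
  have "AE z in lebesgue_on B. ereal (g z) \<le> ess_sup_on B g"
    unfolding ess_sup_on_def by (rule esssup_AE)
  then have "AE z in lebesgue_on A. ereal (g z) \<le> ess_sup_on B g"
    using assms by (auto simp: AE_restrict_space_iff elim!: eventually_mono)
  then show ?thesis unfolding ess_sup_on_def[of A] using m by (intro esssup_I) auto
qed simp

lemma ess_inf_on_eq: "ess_inf_on S g = - ess_sup_on S (\<lambda>z. - g z)"
  by (simp add: ess_inf_on_def ess_sup_on_def)

section \<open>Pucci operators under negative multiples\<close>

lemma cSUP_cmult:
  fixes f :: "'a \<Rightarrow> real"
  assumes "E \<noteq> {}" "bdd_above (f ` E)" "k > 0"
  shows "(SUP x\<in>E. k * f x) = k * (SUP x\<in>E. f x)"
proof (rule cSup_eq_non_empty)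
  show "(\<lambda>x. k * f x) ` E \<noteq> {}" using assms(1) by simp
  show "x \<le> k * (SUP x\<in>E. f x)" if "x \<in> (\<lambda>x. k * f x) ` E" for x
    using that assms by (auto intro!: mult_left_mono cSUP_upper)
  show "k * (SUP x\<in>E. f x) \<le> y" if "\<And>x. x \<in> (\<lambda>x. k * f x) ` E \<Longrightarrow> x \<le> y" for y
  proof -
    have "(SUP x\<in>E. f x) \<le> y / k"
      using that assms by (intro cSUP_least) (auto simp: field_simps)
    then show ?thesis using assms(3) by (simp add: field_simps)
  qed
qed

lemma mat_vector_mult: "mat k *v x = k *\<^sub>R (x :: real^'n)"
  by (simp add: vec_eq_iff matrix_vector_mult_def mat_def if_distrib[of "\<lambda>c. c * _"] cong: if_cong)

text \<open>Polarisation: unit vectors control the diagonal entries, and the sum of two unit vectors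
  then controls the off-diagonal ones. The bound makes the set of traces bounded, so that the
  supremum of reals in \<open>pucci_plus\<close> is a genuine one.\<close>

lemma elliptic_matrices_entry_bound:
  fixes A :: "real^'n^'n"
  assumes "A \<in> elliptic_matrices lam Lam"
  shows "\<bar>A $ i $ j\<bar> \<le> \<bar>lam\<bar> + \<bar>Lam\<bar>"
proof -
  have q: "lam * (x \<bullet> x) \<le> x \<bullet> (A *v x)" "x \<bullet> (A *v x) \<le> Lam * (x \<bullet> x)" for x
    using assms by (auto simp: elliptic_matrices_def loewner_le_def mat_vector_mult)
  have sym: "A $ j $ i = A $ i $ j"
    using assms by (auto simp: elliptic_matrices_def transpose_def vec_eq_iff)
  have e: "axis k 1 \<bullet> (A *v axis l 1) = A $ k $ l" for k l
    by (simp add: inner_axis' matrix_vector_mult_basis column_def)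
  have d: "lam \<le> A $ k $ k" "A $ k $ k \<le> Lam" for k
    using q[of "axis k 1"] by (simp_all add: e inner_axis_axis)
  show ?thesis
  proof (cases "i = j")
    case True
    then show ?thesis using d[of i] by auto
  next
    case False
    let ?x = "axis i 1 + axis j 1 :: real^'n"
    have "?x \<bullet> ?x = 2" using False by (simp add: inner_add_left inner_add_right inner_axis_axis)
    moreover have "?x \<bullet> (A *v ?x) = A $ i $ i + A $ j $ j + 2 * A $ i $ j"
      by (simp add: matrix_vector_right_distrib inner_add_left inner_add_right e sym)
    ultimately show ?thesis using q[of ?x] d[of i] d[of j] by auto
  qed
qed

text \<open>A change of sign exchanges minimum and maximum. The positive factor k will be b /
  \<rho>^2, coming from the rescaling of values and of second derivatives.\<close>

lemma pucci_minus_neg: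
  fixes X :: "real^'n^'n"
  assumes "lam \<le> Lam" "k > 0"
  shows "pucci_minus lam Lam ((- k) *\<^sub>R X) = - (k * pucci_plus lam Lam X)"
proof -
  let ?E = "elliptic_matrices lam Lam :: (real^'n^'n) set"
  have "mat lam \<in> ?E"
    using assms(1)
    by (auto simp: elliptic_matrices_def loewner_le_def mat_vector_mult transpose_mat intro!: mult_right_mono)
  then have ne: "?E \<noteq> {}" by blast
  have tr: "trace (A ** Y) = (\<Sum>i\<in>UNIV. \<Sum>j\<in>UNIV. A $ i $ j * Y $ j $ i)" for A Y :: "real^'n^'n"
    by (simp add: trace_def matrix_matrix_mult_def)
  have "bdd_above ((\<lambda>A. - trace (A ** X)) ` ?E)"
  proof (rule bdd_aboveI2)
    fix A assume A: "A \<in> ?E"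
    have "- trace (A ** X) \<le> \<bar>trace (A ** X)\<bar>" by simp
    also have "\<dots> \<le> (\<Sum>i\<in>UNIV. \<Sum>j\<in>UNIV. \<bar>A $ i $ j * X $ j $ i\<bar>)"
      unfolding tr by (intro order_trans[OF sum_abs] sum_mono sum_abs)
    also have "\<dots> \<le> (\<Sum>i\<in>UNIV. \<Sum>j\<in>UNIV. (\<bar>lam\<bar> + \<bar>Lam\<bar>) * \<bar>X $ j $ i\<bar>)"
      unfolding abs_mult by (intro sum_mono mult_right_mono elliptic_matrices_entry_bound[OF A]) auto
    finally show "- trace (A ** X) \<le> (\<Sum>i\<in>UNIV. \<Sum>j\<in>UNIV. (\<bar>lam\<bar> + \<bar>Lam\<bar>) * \<bar>X $ j $ i\<bar>)" .
  qed
  from cSUP_cmult[OF ne this assms(2)]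
  have *: "(SUP A\<in>?E. k * - trace (A ** X)) = k * pucci_plus lam Lam X" by (simp add: pucci_plus_def)
  have "trace (A ** ((- k) *\<^sub>R X)) = k * - trace (A ** X)" for A
    unfolding tr by (simp add: sum_distrib_left sum_negf mult.left_commute)
  then have "uminus ` (\<lambda>A. - trace (A ** ((- k) *\<^sub>R X))) ` ?E = (\<lambda>A. k * - trace (A ** X)) ` ?E"
    by (simp add: image_image)
  \<comment> \<open>The real infimum is minus the supremum of the negated set, and that set has just
    been computed.\<close>
  then show ?thesis
    unfolding pucci_minus_def Inf_real_def using * by simp
qed

section \<open>Zooming into a small cylinder\<close>

text \<open>\<open>zoom (l / 10) z\<close> maps the cylinder \<open>Q0\<close> onto \<open>Qhat l z\<close>, sending \<open>(0, 10)\<close> to \<open>z\<close>.\<close>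

definition zoom :: "real \<Rightarrow> 'n::finite spacetime \<Rightarrow> 'n spacetime \<Rightarrow> 'n spacetime" where
  "zoom \<rho> z0 z = (fst z0 + \<rho> *\<^sub>R fst z, snd z0 + \<rho>\<^sup>2 * (snd z - 10))"

definition unzoom :: "real \<Rightarrow> 'n::finite spacetime \<Rightarrow> 'n spacetime \<Rightarrow> 'n spacetime" where
  "unzoom \<rho> z0 w = ((1 / \<rho>) *\<^sub>R (fst w - fst z0), 10 + (snd w - snd z0) / \<rho>\<^sup>2)"

lemma zoom_daff: "zoom \<rho> z0 = daff (st_coeff \<rho> (\<rho>\<^sup>2)) (fst z0, snd z0 - 10 * \<rho>\<^sup>2)"
  by (simp add: fun_eq_iff zoom_def daff_st_coeff algebra_simps)

lemma unzoom_daff: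
  "unzoom \<rho> z0 = daff (st_coeff (1 / \<rho>) (1 / \<rho>\<^sup>2)) (- ((1 / \<rho>) *\<^sub>R fst z0), 10 - snd z0 / \<rho>\<^sup>2)"
  by (simp add: fun_eq_iff unzoom_def daff_st_coeff algebra_simps diff_divide_distrib)

lemma zoom_unzoom: "\<rho> \<noteq> 0 \<Longrightarrow> zoom \<rho> z0 (unzoom \<rho> z0 w) = w"
  and unzoom_zoom: "\<rho> \<noteq> 0 \<Longrightarrow> unzoom \<rho> z0 (zoom \<rho> z0 w) = w"
  by (auto simp: zoom_def unzoom_def prod_eq_iff)

lemma continuous_on_zoom: "continuous_on A (zoom \<rho> z0)"
  unfolding zoom_daff by (rule continuous_on_daff)

text \<open>Time scales by \<rho>^2 and space by \<rho>, so parabolic cylinders correspond to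
  parabolic cylinders and the essential bounds on small cylinders can be transported.\<close>

lemma unzoom_in_Qr_iff:
  assumes "\<rho> > 0"
  shows "unzoom \<rho> z0 w \<in> Qr r z \<longleftrightarrow> w \<in> Qr (\<rho> * r) (zoom \<rho> z0 z)"
proof -
  define w' where "w' = unzoom \<rho> z0 w"
  have w: "w = zoom \<rho> z0 w'" unfolding w'_def using zoom_unzoom[of \<rho> z0 w] assms by simp
  have 1: "\<bar>fst w $ i - fst (zoom \<rho> z0 z) $ i\<bar> = \<rho> * \<bar>fst w' $ i - fst z $ i\<bar>" for i
  proof -
    have "fst w $ i - fst (zoom \<rho> z0 z) $ i = \<rho> * (fst w' $ i - fst z $ i)"
      by (simp add: w zoom_def algebra_simps)
    then show ?thesis using assms by (simp add: abs_mult)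
  qed
  have 2: "snd w - snd (zoom \<rho> z0 z) = \<rho>\<^sup>2 * (snd w' - snd z)"
    by (simp add: w zoom_def algebra_simps)
  have "snd (zoom \<rho> z0 z) - (\<rho> * r)\<^sup>2 < snd w \<longleftrightarrow> \<rho>\<^sup>2 * (- (r\<^sup>2)) < \<rho>\<^sup>2 * (snd w' - snd z)"
    using 2 by (auto simp: power_mult_distrib)
  also have "\<dots> \<longleftrightarrow> snd z - r\<^sup>2 < snd w'" using assms by (subst mult_less_cancel_left_pos) auto
  finally have 3: "snd (zoom \<rho> z0 z) - (\<rho> * r)\<^sup>2 < snd w \<longleftrightarrow> snd z - r\<^sup>2 < snd w'" .
  have "snd w \<le> snd (zoom \<rho> z0 z) \<longleftrightarrow> \<rho>\<^sup>2 * (snd w' - snd z) \<le> \<rho>\<^sup>2 * 0"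
    using 2 by auto
  also have "\<dots> \<longleftrightarrow> snd w' \<le> snd z" using assms by (subst mult_le_cancel_left_pos) auto
  finally have 4: "snd w \<le> snd (zoom \<rho> z0 z) \<longleftrightarrow> snd w' \<le> snd z" .
  show ?thesis
    unfolding in_Qr_iff 1 3 4 using assms by (simp add: w unzoom_zoom)
qed

text \<open>If \<open>\<phi>\<close> touches the rescaled function from below at z, then -b
  \<open>\<phi>\<close> in the unzoomed variable touches v from above at the image of z, up to a
  constant. The expression tested for v equals - b / \<rho>^2 times the expression tested for
  \<open>\<phi>\<close>, so a nonpositive essential infimum becomes a nonnegative essential
  supremum. The extension \<open>\<psi>\<close> replaces \<open>\<phi>\<close> because the test
  function for v has to live on all of Q0.\<close>

lemma visc_supersolution_zoom:
  fixes v :: "'n::finite spacetime \<Rightarrow> real"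
  assumes sub: "visc_subsolution p (cube 10) 10 (\<lambda>z \<xi> X. pucci_minus lam Lam X - \<mu> z * norm \<xi> - f z) v"
    and \<rho>: "\<rho> > 0" and b: "b > 0" and p: "p \<ge> 1" and lam: "lam \<le> Lam"
    and into: "\<And>z. z \<in> cyl (cube 10) 10 \<Longrightarrow> zoom \<rho> z0 z \<in> cyl (cube 10) 10"
  shows "visc_supersolution p (cube 10) 10
    (\<lambda>z \<xi> X. pucci_plus lam Lam X + (\<rho> * \<mu> (zoom \<rho> z0 z)) * norm \<xi> + \<rho>\<^sup>2 / b * f (zoom \<rho> z0 z))
    (\<lambda>z. (a - v (zoom \<rho> z0 z)) / b)"
  unfolding visc_supersolution_def
proof (intro conjI allI ballI impI)
  let ?C = "cyl (cube 10) 10 :: 'n spacetime set"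
  let ?\<Phi> = "zoom \<rho> z0" and ?S = "unzoom \<rho> z0"
  have \<rho>0: "\<rho> \<noteq> 0" using \<rho> by simp
  have v: "continuous_on ?C v" using sub by (simp add: visc_subsolution_def)
  have "continuous_on ?C (\<lambda>z. v (?\<Phi> z))"
    by (rule continuous_on_compose2[OF v continuous_on_zoom]) (use into in auto)
  then show "continuous_on ?C (\<lambda>z. (a - v (?\<Phi> z)) / b)"
    using b by (intro continuous_intros) auto
  fix \<phi> \<phi>t :: "'n spacetime \<Rightarrow> real" and D\<phi> D2\<phi> z
  assume z: "z \<in> ?C"
  assume "continuous_on ?C \<phi> \<and> W21_loc p (cube 10) 10 \<phi> \<phi>t D\<phi> D2\<phi> \<and>
    (\<exists>r>0. Qr r z \<subseteq> ?C \<and> (\<forall>w\<in>Qr r z. (a - v (?\<Phi> z)) / b - \<phi> z \<le> (a - v (?\<Phi> w)) / b - \<phi> w))"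
  then obtain r where \<phi>: "continuous_on ?C \<phi>" "W21_loc p (cube 10) 10 \<phi> \<phi>t D\<phi> D2\<phi>"
    and r: "r > 0" "Qr r z \<subseteq> ?C"
    and touch: "\<And>w. w \<in> Qr r z \<Longrightarrow> (a - v (?\<Phi> z)) / b - \<phi> z \<le> (a - v (?\<Phi> w)) / b - \<phi> w"
    by blast
  obtain \<delta> \<psi> \<psi>t D\<psi> D2\<psi> where \<delta>: "\<delta> > 0" and W: "W21 p UNIV \<psi> \<psi>t D\<psi> D2\<psi>" and c\<psi>: "continuous_on UNIV \<psi>"
    and eq: "\<And>w. w \<in> Qr \<delta> z \<Longrightarrow> \<psi> w = \<phi> w \<and> \<psi>t w = \<phi>t w \<and> D\<psi> w = D\<phi> w \<and> D2\<psi> w = D2\<phi> w"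
    using W21_loc_extension[OF \<phi> z p] by metis
  define k where "k = b / \<rho>\<^sup>2"
  have k: "k > 0" using b \<rho> by (simp add: k_def)
  let ?F = "\<lambda>w. - b * \<psi> (?S w)" and ?Ft = "\<lambda>w. - b * (1 / \<rho>\<^sup>2 * \<psi>t (?S w))"
    and ?DF = "\<lambda>w. (- b * (1 / \<rho>)) *\<^sub>R D\<psi> (?S w)" and ?D2F = "\<lambda>w. (- b * (1 / \<rho>)\<^sup>2) *\<^sub>R D2\<psi> (?S w)"
  let ?G = "\<lambda>w. ?Ft w + (pucci_minus lam Lam (?D2F w) - \<mu> w * norm (?DF w) - f w)"
  let ?g = "\<lambda>w. \<phi>t w + (pucci_plus lam Lam (D2\<phi> w) + (\<rho> * \<mu> (?\<Phi> w)) * norm (D\<phi> w) + \<rho>\<^sup>2 / b * f (?\<Phi> w))"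
  have "W21 p UNIV ?F ?Ft ?DF ?D2F"
    unfolding unzoom_daff by (rule W21_scale[OF W]) (use \<rho>0 in auto)
  then have WF: "W21_loc p (cube 10) 10 ?F ?Ft ?DF ?D2F"
    unfolding W21_loc_def using W21_subset par_inside_sets by blast
  have "continuous_on UNIV (\<lambda>w. \<psi> (?S w))"
    unfolding unzoom_daff by (rule continuous_on_compose2[OF c\<psi> continuous_on_daff]) auto
  then have cF: "continuous_on ?C ?F"
    by (intro continuous_on_mult continuous_on_const) (rule continuous_on_subset, auto)
  have zz: "?\<Phi> z \<in> ?C" by (rule into[OF z])
  have Sz: "?S (?\<Phi> z) = z" by (rule unzoom_zoom[OF \<rho>0])
  have z\<delta>: "z \<in> Qr \<delta> z" using \<delta> by (simp add: in_Qr_iff)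
  \<comment> \<open>Small enough both for the touching condition and for \<open>\<psi>\<close> to
    agree with \<open>\<phi>\<close>.\<close>
  let ?r = "min r \<delta>"
  have sub1: "?S w \<in> Qr r z \<and> ?S w \<in> Qr \<delta> z" if "w \<in> Qr (\<rho> * ?r) (?\<Phi> z)" for w
  proof -
    have "?S w \<in> Qr ?r z" using that unzoom_in_Qr_iff[OF \<rho>] by blast
    then show ?thesis using Qr_mono[of ?r r z] Qr_mono[of ?r \<delta> z] r(1) \<delta> by auto
  qed
  have touchF: "\<exists>r>0. Qr r (?\<Phi> z) \<subseteq> ?C \<and> (\<forall>w\<in>Qr r (?\<Phi> z). v w - ?F w \<le> v (?\<Phi> z) - ?F (?\<Phi> z))"
  proof (intro exI[of _ "\<rho> * ?r"] conjI ballI subsetI)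
    show "\<rho> * ?r > 0" using \<rho> r \<delta> by simp
    fix w assume "w \<in> Qr (\<rho> * ?r) (?\<Phi> z)"
    from sub1[OF this] have w: "?S w \<in> Qr r z" "?S w \<in> Qr \<delta> z" by auto
    have \<Phi>w: "?\<Phi> (?S w) = w" by (rule zoom_unzoom[OF \<rho>0])
    show "w \<in> ?C" using into[of "?S w"] w(1) r(2) \<Phi>w by auto
    have "(a - v (?\<Phi> z)) / b - \<phi> z \<le> (a - v w) / b - \<phi> (?S w)" using touch[OF w(1)] \<Phi>w by simp
    then have "b * ((a - v (?\<Phi> z)) / b - \<phi> z) \<le> b * ((a - v w) / b - \<phi> (?S w))"
      using b by (intro mult_left_mono) auto
    moreover have "b * (x / b - y) = x - b * y" for x y using b by (simp add: field_simps)
    ultimately have "v w + b * \<phi> (?S w) \<le> v (?\<Phi> z) + b * \<phi> z" by simp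
    then show "v w - ?F w \<le> v (?\<Phi> z) - ?F (?\<Phi> z)" using eq[OF w(2)] eq[OF z\<delta>] by (simp add: Sz)
  qed
  have "Lim (at_right 0) (\<lambda>\<epsilon>. ess_inf_on (Qr \<epsilon> (?\<Phi> z)) ?G) \<le> 0"
    using sub[unfolded visc_subsolution_def, THEN conjunct2, rule_format, OF zz conjI[OF cF conjI[OF WF touchF]]] .
  moreover have "Lim (at_right 0) (\<lambda>\<epsilon>. ess_inf_on (Qr \<epsilon> (?\<Phi> z)) ?G) = (SUP \<epsilon>\<in>{0<..}. ess_inf_on (Qr \<epsilon> (?\<Phi> z)) ?G)"
    by (rule Lim_at_right_antimono, unfold ess_inf_on_eq ereal_minus_le_minus)
      (intro ess_sup_on_mono Qr_mono Qr_sets)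
  ultimately have SUP0: "(SUP \<epsilon>\<in>{0<..}. ess_inf_on (Qr \<epsilon> (?\<Phi> z)) ?G) \<le> 0" by simp
  have G: "0 \<le> ess_sup_on (Qr \<epsilon> (?\<Phi> z)) (\<lambda>w. - ?G w)" if "\<epsilon> > 0" for \<epsilon>
  proof -
    have "\<epsilon> \<in> {0<..}" using that by simp
    from order_trans[OF SUP_upper[OF this] SUP0]
    have "- ess_sup_on (Qr \<epsilon> (?\<Phi> z)) (\<lambda>w. - ?G w) \<le> - 0" unfolding ess_inf_on_eq by simp
    then show ?thesis unfolding ereal_minus_le_minus .
  qed
  have "0 \<le> ess_sup_on (Qr \<epsilon> z) ?g" if \<epsilon>: "\<epsilon> > 0" for \<epsilon>
  proof (rule ccontr)
    let ?e = "min \<epsilon> \<delta>"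
    assume "\<not> 0 \<le> ess_sup_on (Qr \<epsilon> z) ?g"
    moreover have "ess_sup_on (Qr ?e z) ?g \<le> ess_sup_on (Qr \<epsilon> z) ?g"
      using \<epsilon> \<delta> by (intro ess_sup_on_mono Qr_mono Qr_sets) auto
    ultimately have neg: "ess_sup_on (Qr ?e z) ?g < 0" by auto
    \<comment> \<open>A real number in between makes the multiplication by k below an operation on
      reals.\<close>
    then obtain e :: real where e: "ess_sup_on (Qr ?e z) ?g < ereal e" "ereal e < 0"
      using ereal_dense2 by blast
    \<comment> \<open>A negative essential supremum is in particular not \<infinity>, which
      certifies measurability; \<open>esssup_I\<close> needs it for the zoomed function.\<close>
    have mg: "?g \<in> borel_measurable (lebesgue_on (Qr ?e z))"
      using neg by (intro ess_sup_on_less_top) (auto intro: less_trans)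
    have "AE w in lebesgue_on (Qr ?e z). ereal (?g w) \<le> ess_sup_on (Qr ?e z) ?g"
      unfolding ess_sup_on_def by (rule esssup_AE)
    then have AEg: "AE w in lebesgue_on (Qr ?e z). ?g w \<le> e"
    proof (rule eventually_mono)
      fix w
      assume "ereal (?g w) \<le> ess_sup_on (Qr ?e z) ?g"
      also have "\<dots> \<le> ereal e" using e(1) by (rule less_imp_le)
      finally show "?g w \<le> e" unfolding ereal_less_eq(3) .
    qed
    interpret S: diag_affine "st_coeff (1 / \<rho>) (1 / \<rho>\<^sup>2) :: 'n spacetime \<Rightarrow> real"
        "(- ((1 / \<rho>) *\<^sub>R fst z0), 10 - snd z0 / \<rho>\<^sup>2)"
      using \<rho>0 by (intro diag_affine_st_coeff) auto
    have ST: "S.T = ?S" by (simp add: S.T_def unzoom_daff)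
    let ?B = "Qr (\<rho> * ?e) (?\<Phi> z)"
    have B: "?S -` Qr ?e z = ?B" by (rule set_eqI) (simp only: vimage_eq unzoom_in_Qr_iff[OF \<rho>])
    have mS: "(\<lambda>w. ?g (?S w)) \<in> borel_measurable (lebesgue_on ?B)"
      using S.borel_measurable_on_T[OF Qr_sets, of ?g ?e z] mg unfolding ST B by blast
    have AES: "AE w in lebesgue_on ?B. ?g (?S w) \<le> e"
      using S.AE_on_T[OF Qr_sets AEg] unfolding ST B .
    have Gg: "- ?G w = k * ?g (?S w)" if "w \<in> ?B" for w
    proof -
      have "?S w \<in> Qr ?e z" using that by (simp only: unzoom_in_Qr_iff[OF \<rho>])
      then have "?S w \<in> Qr \<delta> z" using Qr_mono[of ?e \<delta> z] \<epsilon> \<delta> by auto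
      note E = eq[OF this]
      have \<Phi>w: "?\<Phi> (?S w) = w" by (rule zoom_unzoom[OF \<rho>0])
      have P: "pucci_minus lam Lam (?D2F w) = - (k * pucci_plus lam Lam (D2\<phi> (?S w)))"
        using pucci_minus_neg[OF lam k, of "D2\<phi> (?S w)"] E by (simp add: k_def power_divide)
      have N: "norm (?DF w) = b / \<rho> * norm (D\<phi> (?S w))" using E b \<rho> by simp
      show ?thesis
        unfolding P N \<Phi>w using E b \<rho> by (simp add: k_def field_simps power2_eq_square)
    qed
    have "AE w in lebesgue_on ?B. ereal (- ?G w) \<le> ereal (k * e)"
    proof -
      have "AE w in lebesgue_on ?B. w \<in> ?B" by (rule AE_I2) simp
      with AES show ?thesis
        by eventually_elim (use Gg k in \<open>simp add: mult_left_mono del: mult_minus_left\<close>)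
    qed
    moreover have "(\<lambda>w. - ?G w) \<in> borel_measurable (lebesgue_on ?B)"
    proof -
      have "(\<lambda>w. - ?G w) \<in> borel_measurable (lebesgue_on ?B) \<longleftrightarrow>
          (\<lambda>w. k * ?g (?S w)) \<in> borel_measurable (lebesgue_on ?B)"
        by (rule measurable_cong) (use Gg in simp)
      then show ?thesis using mS by (simp add: borel_measurable_times)
    qed
    ultimately have ub: "ess_sup_on ?B (\<lambda>w. - ?G w) \<le> ereal (k * e)"
      unfolding ess_sup_on_def by (intro esssup_I borel_measurable_ereal)
    have "0 \<le> ess_sup_on ?B (\<lambda>w. - ?G w)" by (rule G) (use \<rho> \<epsilon> \<delta> in simp)
    from order_trans[OF this ub] have "0 \<le> k * e" by simp
    moreover have "k * e < 0" using e(2) k by (simp add: mult_pos_neg)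
    ultimately show False by simp
  qed
  then have "0 \<le> (INF \<epsilon>\<in>{0<..}. ess_sup_on (Qr \<epsilon> z) ?g)" by (intro INF_greatest) auto
  moreover have "Lim (at_right 0) (\<lambda>\<epsilon>. ess_sup_on (Qr \<epsilon> z) ?g) = (INF \<epsilon>\<in>{0<..}. ess_sup_on (Qr \<epsilon> z) ?g)"
    by (rule Lim_at_right_mono) (intro ess_sup_on_mono Qr_mono Qr_sets)
  ultimately show "0 \<le> Lim (at_right 0) (\<lambda>\<epsilon>. ess_sup_on (Qr \<epsilon> z) ?g)" by simp
qed

lemma Q0_sets: "(Q0 :: 'n::finite spacetime set) \<in> sets lebesgue"
  unfolding Q0_def cyl_def by (simp add: cylinder_sets_borel open_cube)

text \<open>The integral of |k f|^p after zooming is k^p \<rho>^(-(n+2)) times the integral of |f|^p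
  over the small cylinder, which lies in Q0. The condition on k says that this factor is at most
  1.\<close>

lemma Lp_plus_zoom:
  fixes f :: "'n::finite spacetime \<Rightarrow> real"
  assumes f: "Lp_plus p Q0 f" and \<rho>: "\<rho> > 0" and p: "p > 0" and k: "k \<ge> 0" "k powr p \<le> \<rho> ^ (CARD('n) + 2)"
    and into: "\<And>z. z \<in> Q0 \<Longrightarrow> zoom \<rho> z0 z \<in> Q0"
  shows "Lp_plus p Q0 (\<lambda>z. k * f (zoom \<rho> z0 z))"
    and "Lp_norm p Q0 (\<lambda>z. k * f (zoom \<rho> z0 z)) \<le> Lp_norm p Q0 f"
proof -
  interpret Z: diag_affine "st_coeff \<rho> (\<rho>\<^sup>2) :: 'n spacetime \<Rightarrow> real" "(fst z0, snd z0 - 10 * \<rho>\<^sup>2)"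
    using \<rho> by (intro diag_affine_st_coeff) auto
  have T: "Z.T = zoom \<rho> z0" by (simp add: Z.T_def zoom_daff)
  have J: "Z.J = \<rho> ^ (CARD('n) + 2)" using \<rho> by (simp add: Z.J_def prod_st_coeff power_add) (simp add: power2_eq_square)
  \<comment> \<open>The image of Q0 under the zoom, written as a preimage under the inverse map so
    that measurability is immediate.\<close>
  define V :: "'n spacetime set" where "V = Z.T' -` Q0"
  have VT: "zoom \<rho> z0 -` V = Q0" unfolding V_def T[symmetric] vimage_def by simp
  have V: "V \<in> sets lebesgue"
    unfolding V_def using measurable_sets[OF Z.measurable_T' Q0_sets] by simp
  have VQ: "V \<subseteq> Q0"
  proof
    fix w assume "w \<in> V"
    then have "zoom \<rho> z0 (Z.T' w) \<in> Q0" using into by (simp add: V_def)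
    then show "w \<in> Q0" unfolding T[symmetric] by simp
  qed
  have fm: "f \<in> borel_measurable (lebesgue_on Q0)" and fi: "integrable (lebesgue_on Q0) (\<lambda>z. \<bar>f z\<bar> powr p)"
    and f0: "AE z in lebesgue_on Q0. 0 \<le> f z"
    using f by (auto simp: Lp_plus_def Lp_def)
  have fmV: "f \<in> borel_measurable (lebesgue_on V)" using fm VQ by (rule measurable_restrict_mono)
  have fiV: "integrable (lebesgue_on V) (\<lambda>z. \<bar>f z\<bar> powr p)"
    using fi VQ Q0_sets V by (rule integrable_lebesgue_on_subset)
  have f0V: "AE z in lebesgue_on V. 0 \<le> f z"
    using f0 VQ V by (auto simp: AE_restrict_space_iff Q0_sets elim!: eventually_mono)
  have gm: "(\<lambda>z. f (zoom \<rho> z0 z)) \<in> borel_measurable (lebesgue_on Q0)"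
    using Z.borel_measurable_on_T[OF V, of f] fmV unfolding T VT by blast
  have gi: "integrable (lebesgue_on Q0) (\<lambda>z. \<bar>f (zoom \<rho> z0 z)\<bar> powr p)"
    using Z.integrable_on_T[OF V, of "\<lambda>z. \<bar>f z\<bar> powr p"] fiV unfolding T VT by blast
  have g0: "AE z in lebesgue_on Q0. 0 \<le> f (zoom \<rho> z0 z)"
    using Z.AE_on_T[OF V f0V] unfolding T VT .
  have kp: "\<bar>k * y\<bar> powr p = k powr p * \<bar>y\<bar> powr p" for y using k by (simp add: abs_mult powr_mult)
  show "Lp_plus p Q0 (\<lambda>z. k * f (zoom \<rho> z0 z))"
    unfolding Lp_plus_def Lp_def kp using gm gi g0 k(1) by (auto elim!: eventually_mono)
  have nn: "0 \<le> integral\<^sup>L (lebesgue_on S) (\<lambda>z. \<bar>h z\<bar> powr p)" for S and h :: "'n spacetime \<Rightarrow> real"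
    by (rule integral_nonneg_AE) simp
  have "integral\<^sup>L (lebesgue_on Q0) (\<lambda>z. \<bar>k * f (zoom \<rho> z0 z)\<bar> powr p)
      = k powr p * integral\<^sup>L (lebesgue_on Q0) (\<lambda>z. \<bar>f (zoom \<rho> z0 z)\<bar> powr p)"
    unfolding kp by simp
  also have "\<dots> \<le> Z.J * integral\<^sup>L (lebesgue_on Q0) (\<lambda>z. \<bar>f (zoom \<rho> z0 z)\<bar> powr p)"
    unfolding J using k(2) by (rule mult_right_mono) (rule nn)
  also have "\<dots> = integral\<^sup>L (lebesgue_on V) (\<lambda>z. \<bar>f z\<bar> powr p)"
    using Z.integral_on_T[OF V, of "\<lambda>z. \<bar>f z\<bar> powr p"] unfolding T VT by simp
  also have "\<dots> \<le> integral\<^sup>L (lebesgue_on Q0) (\<lambda>z. \<bar>f z\<bar> powr p)"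
  proof -
    have "integral\<^sup>L lebesgue (\<lambda>z. indicator V z *\<^sub>R (\<bar>f z\<bar> powr p))
        \<le> integral\<^sup>L lebesgue (\<lambda>z. indicator Q0 z *\<^sub>R (\<bar>f z\<bar> powr p))"
    proof (rule integral_mono)
      show "integrable lebesgue (\<lambda>z. indicator V z *\<^sub>R (\<bar>f z\<bar> powr p))"
        using fiV V by (simp add: integrable_restrict_space)
      show "integrable lebesgue (\<lambda>z. indicator Q0 z *\<^sub>R (\<bar>f z\<bar> powr p))"
        using fi by (simp add: integrable_restrict_space Q0_sets)
      show "indicator V z *\<^sub>R (\<bar>f z\<bar> powr p) \<le> indicator Q0 z *\<^sub>R (\<bar>f z\<bar> powr p)" for z
        using VQ by (auto simp: indicator_def)
    qed
    then show ?thesis using V by (simp add: integral_restrict_space Q0_sets)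
  qed
  finally show "Lp_norm p Q0 (\<lambda>z. k * f (zoom \<rho> z0 z)) \<le> Lp_norm p Q0 f"
    unfolding Lp_norm_def using p nn by (intro powr_mono2) auto
qed

section \<open>The growth lemma\<close>

lemma continuous_superlevel_borel:
  fixes g :: "'a::euclidean_space \<Rightarrow> real"
  assumes "continuous_on A g" "A \<in> sets borel"
  shows "{z \<in> A. g z \<ge> s} \<in> sets borel"
proof -
  have "g \<in> borel_measurable (restrict_space borel A)"
    using assms(1) by (rule borel_measurable_continuous_on_restrict)
  then have "{z \<in> space (restrict_space borel A). s \<le> g z} \<in> sets (restrict_space borel A)"
    by (simp add: borel_measurable_iff_ge)
  then show ?thesis using assms(2) by (simp add: space_restrict_space sets_restrict_space_iff)
qed

lemma J1_borel: "(J1 :: 'n::finite spacetime set) \<in> sets borel"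
  unfolding J1_def by (simp add: cylinder_sets_borel open_cube)

lemma bounded_J1: "bounded (J1 :: 'n::finite spacetime set)"
  unfolding J1_def by (simp add: bounded_Times bounded_cube)

lemma J1_measure_pos: "measure lebesgue (J1 :: 'n::finite spacetime set) > 0"
proof -
  have "open (cube 1 \<times> {0<..<1/2} :: 'n spacetime set)" by (intro open_Times open_cube) simp
  moreover have "(0, 1/4) \<in> (cube 1 \<times> {0<..<1/2} :: 'n spacetime set)" by (simp add: cube_def)
  ultimately have "\<not> negligible (cube 1 \<times> {0<..<1/2} :: 'n spacetime set)"
    using open_not_negligible by blast
  moreover have "cube 1 \<times> {0<..<1/2} \<subseteq> (J1 :: 'n spacetime set)" by (auto simp: J1_def)
  ultimately have "\<not> negligible (J1 :: 'n spacetime set)" using negligible_subset by blast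
  moreover have "(J1 :: 'n spacetime set) \<in> lmeasurable"
    by (intro bounded_set_imp_lmeasurable bounded_J1) (simp add: J1_borel)
  ultimately show ?thesis
    using negligible_iff_measure measure_nonneg[of lebesgue "J1 :: 'n spacetime set"] by (metis less_le)
qed

lemma closure_J3D:
  assumes "z \<in> closure (J3 :: 'n::finite spacetime set)"
  shows "\<bar>fst z $ i\<bar> \<le> 1/2" "1/4 \<le> snd z" "snd z \<le> 1/2"
proof -
  let ?C = "{z :: 'n spacetime. \<bar>fst z $ i\<bar> \<le> 1/2} \<inter> {z. 1/4 \<le> snd z} \<inter> {z. snd z \<le> 1/2}"
  have "closed ?C" by (intro closed_Int closed_Collect_le continuous_intros)
  moreover have "J3 \<subseteq> ?C" by (auto simp: J3_def cube_def less_imp_le)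
  ultimately have "z \<in> ?C" using assms closure_minimal by blast
  then show "\<bar>fst z $ i\<bar> \<le> 1/2" "1/4 \<le> snd z" "snd z \<le> 1/2" by auto
qed

text \<open>One growth step, with M and M' in the roles of \<nu>^j and \<nu>^(j-1). The smallness
  hypotheses make each of two sets covering J1 smaller than half of J1: \<open>small1\<close> the
  set where w \<ge> K, \<open>small2\<close> the set where the zoomed v is at least M/2.\<close>

lemma sup_growth_on_Qhat:
  fixes v :: "'n::finite spacetime \<Rightarrow> real"
  assumes lam: "lam \<le> Lam" and p: "p \<ge> 1" "real CARD('n) + 2 \<le> 2 * p" and q: "real CARD('n) + 2 \<le> q"
    and f: "Lp_plus p Q0 f" "Lp_norm p Q0 f \<le> eps1" and \<mu>: "Lp_plus q Q0 \<mu>"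
    and whc: "weak_harnack_constants TYPE('n) lam Lam p q (Lp_norm q Q0 \<mu>) A_star beta_star eps1"
    and sub: "visc_subsolution p (cube 10) 10 (\<lambda>z \<xi> X. pucci_minus lam Lam X - \<mu> z * norm \<xi> - f z) v"
    and decay: "\<forall>s\<ge>1. measure lebesgue {z\<in>J1. v z \<ge> s} \<le> A0 * s powr (- beta0)"
    and l: "0 < l" "l < 1" and z0: "z0 \<in> closure J3" and vz0: "v z0 \<ge> M'"
    and b: "M - M' \<ge> 1" and K: "K > 0" "K * (M - M') = M / 2" and M2: "M / 2 \<ge> 1"
    and small1: "A_star * K powr (- beta_star) < measure lebesgue (J1 :: 'n spacetime set) / 2"
    and small2: "A0 * (M / 2) powr (- beta0) < measure lebesgue (J1 :: 'n spacetime set) / 2 * (l / 10) ^ (CARD('n) + 2)"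
  shows "(SUP z\<in>Qhat l z0. ereal (v z)) \<ge> ereal M"
proof (rule ccontr)
  assume "\<not> (SUP z\<in>Qhat l z0. ereal (v z)) \<ge> ereal M"
  then have vM: "v z < M" if "z \<in> Qhat l z0" for z
    using that by (auto simp: not_le dest: SUP_lessD)
  \<comment> \<open>The height 10 of Q0 becomes 10 \<rho>^2 = l^2 / 10, which is the height of
    \<open>Qhat\<close>.\<close>
  define \<rho> where "\<rho> = l / 10"
  have \<rho>: "0 < \<rho>" "\<rho> < 1 / 10" using l by (auto simp: \<rho>_def)
  have \<rho>2: "\<rho>\<^sup>2 < 1 / 100" "0 < \<rho>\<^sup>2" using power_strict_mono[OF \<rho>(2), of 2] \<rho>(1) by (auto simp: power_divide)
  define b where "b = M - M'"
  have b1: "b \<ge> 1" using \<open>M - M' \<ge> 1\<close> by (simp add: b_def)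
  note z3 = closure_J3D[OF z0]
  have zoom_fst: "\<bar>fst (zoom \<rho> z0 z) $ i - fst z0 $ i\<bar> = \<rho> * \<bar>fst z $ i\<bar>" for z i
    using \<rho> by (simp add: zoom_def abs_mult)
  have zoom_snd: "snd (zoom \<rho> z0 z) = snd z0 + \<rho>\<^sup>2 * (snd z - 10)" for z by (simp add: zoom_def)
  have time: "snd z0 - 10 * \<rho>\<^sup>2 < snd (zoom \<rho> z0 z) \<and> snd (zoom \<rho> z0 z) \<le> snd z0"
    if "0 < snd z" "snd z \<le> 10" for z
  proof -
    have "\<rho>\<^sup>2 * (- 10) < \<rho>\<^sup>2 * (snd z - 10)" using \<rho>2 that by (intro mult_strict_left_mono) auto
    moreover have "\<rho>\<^sup>2 * (snd z - 10) \<le> 0" using \<rho>2 that by (intro mult_nonneg_nonpos) auto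
    ultimately show ?thesis by (simp add: zoom_snd)
  qed
  have toQhat: "zoom \<rho> z0 z \<in> Qhat l z0" if "z \<in> Q0" for z
  proof -
    have z: "\<And>i. \<bar>fst z $ i\<bar> < 10" "0 < snd z" "snd z \<le> 10" using that by (auto simp: Q0_def in_cyl_cube_iff)
    have "\<rho> * \<bar>fst z $ i\<bar> < l" for i
      using mult_strict_left_mono[OF z(1)[of i] \<rho>(1)] by (simp add: \<rho>_def)
    moreover have "l\<^sup>2 / 10 = 10 * \<rho>\<^sup>2" by (simp add: \<rho>_def power_divide)
    ultimately show ?thesis using time[OF z(2,3)] by (simp add: in_Qhat_iff zoom_fst)
  qed
  have l2: "l\<^sup>2 < 1" using l by (simp add: power_less_one_iff)
  \<comment> \<open>Points of the closure of J3 have time at least 1/4, while \<open>Qhat\<close>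
    reaches back by less than 1/10; sideways there is ample room.\<close>
  have QQ: "z \<in> Q0" if "z \<in> Qhat l z0" for z
  proof -
    have z: "\<And>i. \<bar>fst z $ i - fst z0 $ i\<bar> < l" "snd z0 - l\<^sup>2 / 10 < snd z" "snd z \<le> snd z0"
      using that by (auto simp: in_Qhat_iff)
    have "\<bar>fst z $ i\<bar> < 10" for i using z(1)[of i] z3(1)[of i] l by linarith
    moreover have "0 < snd z" "snd z \<le> 10" using z(2,3) z3(2,3) l2 by linarith+
    ultimately show ?thesis by (simp add: Q0_def in_cyl_cube_iff)
  qed
  have into: "zoom \<rho> z0 z \<in> Q0" if "z \<in> Q0" for z using QQ[OF toQhat[OF that]] .
  define w where "w z = (M - v (zoom \<rho> z0 z)) / b" for z
  have w0: "\<forall>z\<in>Q0. 0 \<le> w z" using vM[OF toQhat] b1 by (auto simp: w_def less_imp_le)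
  have sup: "visc_supersolution p (cube 10) 10
      (\<lambda>z \<xi> X. pucci_plus lam Lam X + (\<rho> * \<mu> (zoom \<rho> z0 z)) * norm \<xi> + \<rho>\<^sup>2 / b * f (zoom \<rho> z0 z)) w"
    unfolding w_def
    by (rule visc_supersolution_zoom[OF sub \<rho>(1) _ p(1) lam into[unfolded Q0_def]]) (use b1 in auto)
  have powr: "\<rho> powr s \<le> \<rho> ^ (CARD('n) + 2)" if "real CARD('n) + 2 \<le> s" for s
  proof -
    have "\<rho> powr s \<le> \<rho> powr (real (CARD('n) + 2))" using \<rho> that by (intro powr_mono') auto
    also have "\<dots> = \<rho> ^ (CARD('n) + 2)" using \<rho>(1) by (rule powr_realpow)
    finally show ?thesis .
  qed
  have q0: "q > 0" using q by (rule less_le_trans[rotated]) simp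
  have \<mu>': "Lp_plus q Q0 (\<lambda>z. \<rho> * \<mu> (zoom \<rho> z0 z))" "Lp_norm q Q0 (\<lambda>z. \<rho> * \<mu> (zoom \<rho> z0 z)) \<le> Lp_norm q Q0 \<mu>"
    by (rule Lp_plus_zoom[OF \<mu> \<rho>(1) q0 _ powr[OF q] into]; use \<rho> in simp)+
  \<comment> \<open>Here b \<ge> 1 enters. The coefficient of the source is at most \<rho>^2, and
    since \<rho> < 1 its p-th power is controlled through 2 p \<ge> n + 2.\<close>
  have "\<rho>\<^sup>2 / b \<le> \<rho>\<^sup>2" using b1 \<rho>2 by (simp add: field_simps)
  then have "(\<rho>\<^sup>2 / b) powr p \<le> (\<rho>\<^sup>2) powr p" using p b1 by (intro powr_mono2) auto
  also have "(\<rho>\<^sup>2) powr p = \<rho> powr (2 * p)" using \<rho>(1) by (simp add: powr_powr flip: powr_numeral)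
  also have "\<dots> \<le> \<rho> ^ (CARD('n) + 2)" by (rule powr[OF p(2)])
  finally have kp: "(\<rho>\<^sup>2 / b) powr p \<le> \<rho> ^ (CARD('n) + 2)" .
  have f': "Lp_plus p Q0 (\<lambda>z. \<rho>\<^sup>2 / b * f (zoom \<rho> z0 z))" "Lp_norm p Q0 (\<lambda>z. \<rho>\<^sup>2 / b * f (zoom \<rho> z0 z)) \<le> Lp_norm p Q0 f"
    by (rule Lp_plus_zoom[OF f(1) \<rho>(1) _ _ kp into]; use p b1 in simp)+
  have "zoom \<rho> z0 (0, 10) = z0" by (simp add: zoom_def)
  then have "w (0, 10) \<le> 1" using vz0 b1 by (simp add: w_def b_def field_simps)
  moreover have "(0, 10) \<in> (J2 :: 'n spacetime set)" by (simp add: J2_def cube_def)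
  ultimately have inf: "(INF z\<in>J2. ereal (w z)) \<le> 1"
    by (intro INF_lower2[of "(0, 10)"]) (auto simp: one_ereal_def)
  have "measure lebesgue {z\<in>J1. w z \<ge> K} \<le> A_star * K powr (- beta_star)"
    using whc[unfolded weak_harnack_constants_def] \<mu>' f' f(2) w0 sup inf K(1)
    by (meson order_trans)
  then have E1: "measure lebesgue {z\<in>J1. w z \<ge> K} < measure lebesgue (J1 :: 'n spacetime set) / 2"
    using small1 by (rule le_less_trans)

  have J1Q: "J1 \<subseteq> (Q0 :: 'n spacetime set)"
  proof
    fix z :: "'n spacetime" assume "z \<in> J1"
    then have z: "\<And>i. \<bar>fst z $ i\<bar> < 1" "0 < snd z" "snd z \<le> 1/2" by (auto simp: J1_def cube_def)
    have "\<bar>fst z $ i\<bar> < 10" for i using z(1)[of i] by linarith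
    then show "z \<in> Q0" using z(2,3) by (simp add: Q0_def in_cyl_cube_iff)
  qed
  \<comment> \<open>The decay hypothesis speaks only of J1, so the zoomed J1 has to stay inside it:
    it extends by at most 1/10 sideways from a point with coordinates at most 1/2, and by less than
    1/10 back from a time at least 1/4.\<close>
  have J1J1: "zoom \<rho> z0 z \<in> J1" if "z \<in> J1" for z
  proof -
    have z: "\<And>i. \<bar>fst z $ i\<bar> < 1" "0 < snd z" "snd z \<le> 1/2" using that by (auto simp: J1_def cube_def)
    have "\<bar>fst (zoom \<rho> z0 z) $ i\<bar> < 1" for i
    proof -
      have "\<rho> * \<bar>fst z $ i\<bar> < 1 / 10" using mult_strict_mono[OF \<rho>(2) z(1)[of i]] \<rho>(1) by simp
      then show ?thesis using zoom_fst[of z i] z3(1)[of i] by linarith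
    qed
    moreover have "0 < snd (zoom \<rho> z0 z)" "snd (zoom \<rho> z0 z) \<le> 1/2"
      using time[of z] z(2,3) z3(2,3) \<rho>2 by linarith+
    ultimately show ?thesis by (cases "zoom \<rho> z0 z") (auto simp: J1_def cube_def)
  qed
  have vc: "continuous_on Q0 v" using sub by (simp add: visc_subsolution_def Q0_def)
  have vzc: "continuous_on J1 (\<lambda>z. v (zoom \<rho> z0 z))"
    by (rule continuous_on_compose2[OF vc continuous_on_zoom]) (use into J1Q in auto)
  let ?E1 = "{z \<in> J1. w z \<ge> K}" and ?E2 = "{z \<in> J1. v (zoom \<rho> z0 z) \<ge> M / 2}" and ?E3 = "{z \<in> J1. v z \<ge> M / 2}"
  have m1: "?E1 \<in> sets borel"
    by (rule continuous_superlevel_borel[OF _ J1_borel])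
      (use vzc b1 in \<open>auto simp: w_def intro!: continuous_intros\<close>)
  have m2: "?E2 \<in> sets borel" by (rule continuous_superlevel_borel[OF vzc J1_borel])
  have m3: "?E3 \<in> sets borel"
    by (rule continuous_superlevel_borel[OF continuous_on_subset[OF vc J1Q] J1_borel])
  have lm: "S \<in> lmeasurable" if "S \<in> sets borel" "S \<subseteq> J1" for S :: "'n spacetime set"
    using that bounded_subset[OF bounded_J1] by (intro bounded_set_imp_lmeasurable) auto
  interpret Z: diag_affine "st_coeff \<rho> (\<rho>\<^sup>2) :: 'n spacetime \<Rightarrow> real" "(fst z0, snd z0 - 10 * \<rho>\<^sup>2)"
    using \<rho> by (intro diag_affine_st_coeff) auto
  have T: "Z.T = zoom \<rho> z0" by (simp add: Z.T_def zoom_daff)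
  have J: "Z.J = \<rho> ^ (CARD('n) + 2)"
    using \<rho> by (simp add: Z.J_def prod_st_coeff power_add) (simp add: power2_eq_square)
  \<comment> \<open>The zoomed copy of \<open>?E2\<close>. Its measure is \<rho>^(n+2) times that of
    \<open>?E2\<close>, and v \<ge> M/2 holds on it, so the decay of v bounds it.\<close>
  let ?S = "Z.T' -` ?E2"
  have S: "?S \<in> sets lebesgue" using measurable_sets[OF Z.measurable_T', of ?E2] m2 by simp
  have "Z.T -` ?S = ?E2" unfolding vimage_def by simp
  then have mS: "measure lebesgue ?S = \<rho> ^ (CARD('n) + 2) * measure lebesgue ?E2"
    using Z.measure_T[OF S] unfolding J by simp
  have "?S \<subseteq> ?E3"
  proof
    fix y assume "y \<in> ?S"
    then have "Z.T' y \<in> J1" "v (zoom \<rho> z0 (Z.T' y)) \<ge> M / 2" by simp_all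
    moreover have "zoom \<rho> z0 (Z.T' y) = y" unfolding T[symmetric] by simp
    ultimately show "y \<in> ?E3" using J1J1 by fastforce
  qed
  then have "measure lebesgue ?S \<le> measure lebesgue ?E3"
    using S lm[OF m3] by (intro measure_mono_fmeasurable) auto
  also have "\<dots> \<le> A0 * (M / 2) powr (- beta0)" using decay M2 by blast
  also have "\<dots> < measure lebesgue (J1 :: 'n spacetime set) / 2 * \<rho> ^ (CARD('n) + 2)"
    using small2 by (simp add: \<rho>_def)
  finally have "\<rho> ^ (CARD('n) + 2) * measure lebesgue ?E2 < \<rho> ^ (CARD('n) + 2) * (measure lebesgue (J1 :: 'n spacetime set) / 2)"
    unfolding mS by (simp only: mult.commute)
  then have E2: "measure lebesgue ?E2 < measure lebesgue (J1 :: 'n spacetime set) / 2"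
    using \<rho>(1) by (subst (asm) mult_less_cancel_left_pos) auto
  \<comment> \<open>Where v is below M/2 after zooming, M - v exceeds M/2 = K b, which is w \<ge>
    K.\<close>
  have "J1 \<subseteq> ?E1 \<union> ?E2"
  proof
    fix z :: "'n spacetime" assume z: "z \<in> J1"
    show "z \<in> ?E1 \<union> ?E2"
    proof (cases "v (zoom \<rho> z0 z) \<ge> M / 2")
      case False
      then have "K * b \<le> M - v (zoom \<rho> z0 z)" using K(2) by (simp add: b_def)
      then have "K \<le> w z" using b1 by (simp add: w_def field_simps)
      then show ?thesis using z by simp
    qed (use z in simp)
  qed
  moreover have "?E1 \<union> ?E2 \<in> lmeasurable" using lm[OF m1] lm[OF m2] by (intro fmeasurable.Un) auto
  ultimately have "measure lebesgue (J1 :: 'n spacetime set) \<le> measure lebesgue (?E1 \<union> ?E2)"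
    by (intro measure_mono_fmeasurable) (auto simp: J1_borel)
  also have "\<dots> \<le> measure lebesgue ?E1 + measure lebesgue ?E2"
    using m1 m2 by (intro measure_Un_le) auto
  finally show False using E1 E2 by linarith
qed

text \<open>The order of quantifiers encodes the dependence of the constants: \<open>A_star\<close>
  and \<open>beta_star\<close> come before \<nu>, n0 and l, whereas the drift, the source,
  \<open>eps1\<close> and v come after. The drift thus influences the constants only through the
  weak Harnack constants. The supremum is an extended real, so it is meaningful without a bound on
  v.\<close>

theorem lemma4p3:
  fixes lam Lam p1 p q A_star beta_star A0 beta0 :: real
  assumes "0 < lam" and "lam \<le> Lam"
    and "ABP_exponent TYPE('n::finite) lam Lam p1"
    and "q > real CARD('n) + 2" and "p1 < p" and "p \<le> q"
    and "beta0 > 0" and "A0 > 1"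
  shows "\<exists>\<nu>>1. \<exists>n0\<ge>1. \<exists>l :: nat \<Rightarrow> real.
    (\<forall>j\<ge>1. 0 < l j \<and> l j < 1) \<and> summable (\<lambda>j. l (Suc j)) \<and>
    (\<forall>\<mu> f eps1. \<forall>v :: 'n spacetime \<Rightarrow> real.
       Lp_plus p Q0 f \<and> Lp_plus q Q0 \<mu> \<and>
       weak_harnack_constants TYPE('n) lam Lam p q (Lp_norm q Q0 \<mu>) A_star beta_star eps1 \<and>
       Lp_norm p Q0 f \<le> eps1 \<and>
       visc_subsolution p (cube 10) 10
         (\<lambda>z \<xi> X. pucci_minus lam Lam X - \<mu> z * norm \<xi> - f z) v \<and>
       (\<forall>s\<ge>1. measure lebesgue {z\<in>J1. v z \<ge> s} \<le> A0 * s powr (- beta0)) \<longrightarrow>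
       (\<forall>j\<ge>n0. \<forall>z0\<in>closure J3.
          v z0 \<ge> \<nu> ^ (j - 1) \<longrightarrow> (SUP z\<in>Qhat (l j) z0. ereal (v z)) \<ge> ereal (\<nu> ^ j)))"
proof (cases "A_star > 0 \<and> beta_star > 0")
  \<comment> \<open>No drift admits such constants, so the implication is vacuous and any admissible
    \<nu>, n0 and l will do.\<close>
  case False
  then have nwhc: "\<not> weak_harnack_constants TYPE('n) lam Lam p q C A_star beta_star e" for C e
    by (auto simp: weak_harnack_constants_def)
  show ?thesis
  proof (intro exI[of _ 2] conjI exI[of _ 1] exI[of _ "\<lambda>j. (1/2) ^ Suc j"])
    show "summable (\<lambda>j. (1 / 2 :: real) ^ Suc (Suc j))"
      by (simp add: summable_geometric)
    show "\<forall>j\<ge>1. 0 < (1 / 2 :: real) ^ Suc j \<and> (1 / 2 :: real) ^ Suc j < 1"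
      using power_Suc_less_one[of "1 / 2 :: real"] by (auto simp del: power_Suc)
  qed (use nwhc in auto)
next
  case True
  let ?m = "measure lebesgue (J1 :: 'n spacetime set)"
  have m: "?m > 0" by (rule J1_measure_pos)
  have p1: "(real CARD('n) + 2) / 2 \<le> p1" using assms(3) by (simp add: ABP_exponent_def)
  then have p: "p \<ge> 1" "real CARD('n) + 2 \<le> 2 * p" using assms(5) by (simp_all add: field_simps)

  have "((\<lambda>x. A_star * x powr (- beta_star)) \<longlongrightarrow> A_star * 0) at_top"
    using True by (intro tendsto_mult tendsto_const tendsto_neg_powr filterlim_ident) auto
  then have "\<forall>\<^sub>F x in at_top. A_star * x powr (- beta_star) < ?m / 2"
    using m by (intro order_tendstoD) auto
  then obtain K0 where K0: "\<And>x. x \<ge> K0 \<Longrightarrow> A_star * x powr (- beta_star) < ?m / 2"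
    by (auto simp: eventually_at_top_linorder)
  define K where "K = max 1 K0"
  have K: "K \<ge> 1" "A_star * K powr (- beta_star) < ?m / 2" using K0[of K] by (auto simp: K_def)

  \<comment> \<open>The solution of K (\<nu> - 1) = \<nu> / 2. As K \<ge> 1, the denominator is
    positive and \<nu> > 1.\<close>
  define \<nu> where "\<nu> = 2 * K / (2 * K - 1)"
  have \<nu>: "\<nu> > 1" using K(1) by (simp add: \<nu>_def field_simps)
  have K\<nu>: "K * (\<nu> - 1) = \<nu> / 2" using K(1) by (simp add: \<nu>_def field_simps)

  define N where "N = CARD('n) + 2"
  have N: "N > 0" "real N > 0" by (simp_all add: N_def)
  \<comment> \<open>Chosen so that \<kappa>^N = \<nu>^(-\<beta>0): the side lengths decay
    geometrically and their N-th powers match the decay of the distribution function of v at the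
    levels \<nu>^j.\<close>
  define \<kappa> where "\<kappa> = \<nu> powr (- beta0 / real N)"
  have \<kappa>: "0 < \<kappa>" "\<kappa> < 1"
    using \<nu> assms(7) N(2) by (auto simp: \<kappa>_def intro!: powr_less_one divide_neg_pos)
  \<comment> \<open>The 10 undoes the division in \<rho> = l / 10, and the power of 2 comes from
    using the level \<nu>^j / 2. Adding 1 makes C / 10 at least 1, so that its N-th power is no
    smaller, and makes the inequality strict.\<close>
  define C where "C = 10 * (1 + 2 * (A0 * 2 powr beta0) / ?m)"
  have C: "C > 0" and C10: "A0 * 2 powr beta0 < ?m / 2 * (C / 10) ^ N"
  proof -
    have nn: "2 * (A0 * 2 powr beta0) / ?m \<ge> 0" using m assms(8) by simp
    then show "C > 0" unfolding C_def by simp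
    have c: "C / 10 = 1 + 2 * (A0 * 2 powr beta0) / ?m" by (simp add: C_def)
    have "A0 * 2 powr beta0 < ?m / 2 * (C / 10)" unfolding c using m by (simp add: field_simps)
    also have "C / 10 \<le> (C / 10) ^ N" using N(1) nn unfolding c by (intro self_le_power) auto
    finally show "A0 * 2 powr beta0 < ?m / 2 * (C / 10) ^ N" using m by simp
  qed
  have pow: "filterlim (\<lambda>j. \<nu> ^ j) at_top sequentially"
    using \<nu> by (intro filterlim_at_infinity_imp_filterlim_at_top filterlim_realpow_sequentially_gt1) auto
  \<comment> \<open>The bound 2 puts the level \<nu>^j / 2 into the range s \<ge> 1 of the decay
    hypothesis; the bound \<nu> / (\<nu> - 1) is equivalent to \<nu>^j - \<nu>^(j-1) \<ge>
    1.\<close>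
  have "\<forall>\<^sub>F j in sequentially. \<nu> ^ j \<ge> max 2 (\<nu> / (\<nu> - 1))"
    using pow unfolding filterlim_at_top by blast
  moreover have "\<forall>\<^sub>F j in sequentially. C * \<kappa> ^ j < 1"
  proof -
    have "(\<lambda>j. C * \<kappa> ^ j) \<longlonglongrightarrow> C * 0"
      using \<kappa> by (intro tendsto_mult tendsto_const LIMSEQ_realpow_zero) auto
    then show ?thesis by (intro order_tendstoD) auto
  qed
  ultimately have "\<forall>\<^sub>F j in sequentially. \<nu> ^ j \<ge> max 2 (\<nu> / (\<nu> - 1)) \<and> C * \<kappa> ^ j < 1"
    by (rule eventually_conj)
  then obtain n1 where n1: "\<And>j. j \<ge> n1 \<Longrightarrow> \<nu> ^ j \<ge> max 2 (\<nu> / (\<nu> - 1)) \<and> C * \<kappa> ^ j < 1"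
    by (auto simp: eventually_sequentially)
  \<comment> \<open>With j \<ge> 1 the natural number j - 1 is a true predecessor.\<close>
  define n0 where "n0 = max 1 n1"
  \<comment> \<open>The value 1/2 for the finitely many earlier indices only serves to stay in (0,
    1); it does not affect summability.\<close>
  define l where "l j = (if n0 \<le> j then C * \<kappa> ^ j else 1 / 2)" for j
  have l: "0 < l j" "l j < 1" for j using n1[of j] C \<kappa> by (auto simp: l_def n0_def)
  have "summable (\<lambda>j. C * \<kappa> ^ j)" using \<kappa> by (intro summable_mult summable_geometric) auto
  moreover have "\<forall>\<^sub>F j in sequentially. l j = C * \<kappa> ^ j"
    by (auto simp: l_def eventually_sequentially)
  ultimately have "summable l" by (simp cong: summable_cong)
  then have suml: "summable (\<lambda>j. l (Suc j))" by (simp add: summable_Suc_iff)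

  have main: "ereal (\<nu> ^ j) \<le> (SUP z\<in>Qhat (l j) z0. ereal (v z))"
    if H: "Lp_plus p Q0 f" "Lp_plus q Q0 \<mu>"
      "weak_harnack_constants TYPE('n) lam Lam p q (Lp_norm q Q0 \<mu>) A_star beta_star eps1"
      "Lp_norm p Q0 f \<le> eps1"
      "visc_subsolution p (cube 10) 10 (\<lambda>z \<xi> X. pucci_minus lam Lam X - \<mu> z * norm \<xi> - f z) v"
      "\<forall>s\<ge>1. measure lebesgue {z\<in>J1. v z \<ge> s} \<le> A0 * s powr (- beta0)"
      and j: "n0 \<le> j" and z0: "z0 \<in> closure J3" "\<nu> ^ (j - 1) \<le> v z0"
    for \<mu> f eps1 v j and z0 :: "'n spacetime"
  proof -
    have j1: "j \<ge> 1" "j \<ge> n1" using j by (auto simp: n0_def)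
    then have \<nu>j: "\<nu> ^ j = \<nu> * \<nu> ^ (j - 1)" by (simp flip: power_Suc)
    have big: "\<nu> ^ j \<ge> 2" "\<nu> ^ j \<ge> \<nu> / (\<nu> - 1)" using n1[OF j1(2)] by auto
    have "\<nu> * (1 / (\<nu> - 1)) \<le> \<nu> * \<nu> ^ (j - 1)" using big(2) \<nu>j by simp
    then have "1 / (\<nu> - 1) \<le> \<nu> ^ (j - 1)" using \<nu> by (subst (asm) mult_le_cancel_left_pos) auto
    then have b: "\<nu> ^ j - \<nu> ^ (j - 1) \<ge> 1"
      using \<nu> unfolding \<nu>j by (simp add: field_simps)
    \<comment> \<open>Passing to real exponents lets the N in \<kappa> cancel.\<close>
    have "\<kappa> ^ j = \<nu> powr (- beta0 / real N * real j)"
      using \<nu> by (simp add: \<kappa>_def powr_realpow[symmetric] powr_powr)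
    then have "(\<kappa> ^ j) ^ N = \<nu> powr (- beta0 / real N * real j * real N)"
      using \<nu> by (simp add: powr_realpow[symmetric] powr_powr)
    also have "- beta0 / real N * real j * real N = real j * (- beta0)" using N by simp
    also have "\<nu> powr (real j * (- beta0)) = (\<nu> ^ j) powr (- beta0)"
      using \<nu> by (simp add: powr_realpow[symmetric] powr_powr)
    finally have \<kappa>N: "(\<kappa> ^ j) ^ N = (\<nu> ^ j) powr (- beta0)" .
    have "A0 * (\<nu> ^ j / 2) powr (- beta0) = (A0 * 2 powr beta0) * (\<nu> ^ j) powr (- beta0)"
      using \<nu> by (simp add: powr_divide powr_minus field_simps)
    also have "\<dots> < (?m / 2 * (C / 10) ^ N) * (\<nu> ^ j) powr (- beta0)"
      using C10 \<nu> by (intro mult_strict_right_mono) auto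
    also have "\<dots> = ?m / 2 * (l j / 10) ^ N"
      using j by (simp add: l_def power_divide power_mult_distrib flip: \<kappa>N)
    finally have small: "A0 * (\<nu> ^ j / 2) powr (- beta0) < ?m / 2 * (l j / 10) ^ N" .
    have "K * (\<nu> ^ j - \<nu> ^ (j - 1)) = (K * (\<nu> - 1)) * \<nu> ^ (j - 1)"
      unfolding \<nu>j by (simp add: algebra_simps)
    then have KM: "K * (\<nu> ^ j - \<nu> ^ (j - 1)) = \<nu> ^ j / 2" unfolding K\<nu> using \<nu>j by simp
    show ?thesis
      by (rule sup_growth_on_Qhat[OF assms(2) p less_imp_le[OF assms(4)] H(1,4,2,3,5,6) l z0 b _ KM _ K(2) small[unfolded N_def]])
        (use K(1) big(1) in auto)
  qed
  show ?thesis
    using \<nu> l suml main by (intro exI[of _ \<nu>] exI[of _ n0] exI[of _ l] conjI) (auto simp: n0_def)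
qed

end
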